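(* Let $k$ be a field and let $R=kQ_R/I_R$ be a bound quiver algebra with orthogonal idempotents $e,e'_1,e'_2$, each a sum of primitive idempotents corresponding to vertices of $Q_R$, such that $1_R=e'_1+e+e'_2$ and $e'_1Re'_2=e'_2Re'_1=0$. Let $e_i=e'_i+e$, $A_i=e_iRe_i=kQ_{A_i}/I_i$ for $i=1,2$ and $C=eRe=kQ_C/I_C$. Assume that $A_1$ and $A_2$ admit semi-normed bases. Then there exists a long exact sequence of simplicial homology groups $$\cdots\to{\rm SH}_n(C)\to{\rm SH}_n(A_1)\oplus{\rm SH}_n(A_2)\to{\rm SH}_n(R)\to{\rm SH}_{n-1}(C)\to\cdots .$$
   Context: Paths are composed left to right; a bound quiver $(Q,I)$ is a quiver with an admissible ideal $I$ of $kQ$ ($F^m\subseteq I\subseteq F^2$ for some $m\ge2$, $F$ the ideal generated by the arrows); $\varepsilon_x$ is the idempotent of the vertex $x$. $Q_C$, $Q_{A_i}$ are the full subquivers of $Q_R$ on the vertices occurring in $e$, $e_i$, and $I_C=kQ_C\cap I_R$, $I_i=kQ_{A_i}\cap I_R$. Let $\Lambda=kQ/I$. For vertices $x,y$ let ${}_y\mathbb B_x$ be a $k$-basis of $\varepsilon_x\Lambda\varepsilon_y$ and $\mathbb B=\bigcup_{x,y}{}_y\mathbb B_x$. $\mathbb B$ is a \emph{semi-normed basis} of $\Lambda$ if (a) $\varepsilon_x\in{}_x\mathbb B_x$ for every vertex $x$; (b) $\alpha+I\in{}_y\mathbb B_x$ for every arrow $\alpha:x\to y$; (c) for $\sigma,\sigma'\in\mathbb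 B$, either $\sigma\sigma'=0$ or $\sigma\sigma'=\lambda_{\sigma,\sigma'}b(\sigma,\sigma')$ with $0\ne\lambda_{\sigma,\sigma'}\in k$ and $b(\sigma,\sigma')\in\mathbb B$. Given a semi-normed basis $\mathbb B$, the chain complex ${\rm SC}_\bullet(\Lambda)$ is: ${\rm SC}_0(\Lambda)$ and ${\rm SC}_1(\Lambda)$ are the free abelian groups on $Q_0$ and $\mathbb B$; for $n\ge2$, ${\rm SC}_n(\Lambda)$ is the free abelian group on the $n$-tuples $(\sigma_1,\dots,\sigma_n)\in\mathbb B^n$ with $\sigma_1\cdots\sigma_n\ne0$ and no $\sigma_i$ equal to a stationary idempotent $\varepsilon_x$. The differential is $d_1(\sigma)=y-x$ for $\sigma\in{}_y\mathbb B_x$, and for $n\ge2$, $d_n(\sigma_1,\dots,\sigma_n)=(\sigma_2,\dots,\sigma_n)+\sum_{j=1}^{n-1}(-1)^j(\sigma_1,\dots,b(\sigma_j,\sigma_{j+1}),\dots,\sigma_n)+(-1)^n(\sigma_1,\dots,\sigma_{n-1})$. ${\rm SH}_n(\Lambda)$ (with respect to $\mathbb B$) is the $n$th homology group of ${\rm SC}_\bullet(\Lambda)$. Bases used: if $\mathbb B_1$, $\mathbb B_2$ are semi-normed bases of $A_1$, $A_2$, the simplicial homology groups of $A_1,A_2,R,C$ are taken with respect to $\mathbb B_1$, $\mathbb B_2$, $\mathbb B_R=\mathbb B_1\cup\mathbb B_2$ and $\mathbb B_C=\mathbb B_1\cap\mathbb B_2$ respectively; the paper asserts that $\mathbb B_R$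 and $\mathbb B_C$ are then semi-normed bases of $R$ and $C$.
   Formalization: The sequence is stated for semi-normed bases of A_1 and A_2 having the same part in C = eRe, since otherwise their union and intersection need not be semi-normed bases; it is also shown that rescaling the basis of A_2 by nonzero scalars always achieves this. *)

theory Defs
  imports
    "Graph_Theory.Digraph_Component"
    "HOL-Algebra.Ideal_Product"
    "HOL-Algebra.QuotRing"
    "HOL-Algebra.Free_Abelian_Groups"
begin

section \<open>Bound quiver algebras\<close>

text \<open>A path is its source, its list of arrows and its target; the stationary path at \<open>x\<close> is
  \<open>(x, [], x)\<close>. Paths are composed from left to right.\<close>

type_synonym ('v, 'a) path = "'v \<times> 'a list \<times> 'v"

definition paths :: "('v, 'a) pre_digraph \<Rightarrow> ('v, 'a) path set" where
  "paths Q = {(x, p, y). pre_digraph.awalk Q x p y}"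

definition path_mult ::
  "(('v, 'a) path \<Rightarrow>\<^sub>0 'k::field) \<Rightarrow> (('v, 'a) path \<Rightarrow>\<^sub>0 'k) \<Rightarrow> (('v, 'a) path \<Rightarrow>\<^sub>0 'k)" where
  "path_mult f g =
     (\<Sum>(x, p, y)\<in>Poly_Mapping.keys f. \<Sum>(y', q, z)\<in>Poly_Mapping.keys g.
        if y = y'
        then Poly_Mapping.single (x, p @ q, z)
               (Poly_Mapping.lookup f (x, p, y) * Poly_Mapping.lookup g (y', q, z))
        else 0)"

text \<open>The path algebra \<open>kQ\<close>, for a quiver with finitely many vertices. The path algebra of a
  subquiver is literally a subset of \<open>kQ\<close>.\<close>

definition path_algebra :: "('v, 'a) pre_digraph \<Rightarrow> (('v, 'a) path \<Rightarrow>\<^sub>0 'k::field) ring" where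
  "path_algebra Q =
     \<lparr>carrier = {f. Poly_Mapping.keys f \<subseteq> paths Q},
      mult = path_mult,
      one = (\<Sum>x\<in>verts Q. Poly_Mapping.single (x, [], x) 1),
      ring.zero = 0,
      ring.add = (+)\<rparr>"

definition arrow :: "('v, 'a) pre_digraph \<Rightarrow> 'a \<Rightarrow> (('v, 'a) path \<Rightarrow>\<^sub>0 'k::field)" where
  "arrow Q a = Poly_Mapping.single (tail Q a, [a], head Q a) 1"

definition arrow_ideal :: "('v, 'a) pre_digraph \<Rightarrow> (('v, 'a) path \<Rightarrow>\<^sub>0 'k::field) set" where
  "arrow_ideal Q = genideal (path_algebra Q) (arrow Q ` arcs Q)"

definition bound_quiver ::
  "('v, 'a) pre_digraph \<Rightarrow> (('v, 'a) path \<Rightarrow>\<^sub>0 'k::field) set \<Rightarrow> bool" where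
  "bound_quiver Q I \<longleftrightarrow>
     wf_digraph Q \<and> finite (verts Q) \<and> ideal I (path_algebra Q) \<and>
     (\<exists>m::nat. m \<ge> 2 \<and>
        arrow_ideal Q [^]\<^bsub>ideals_set (path_algebra Q)\<^esub> m \<subseteq> I \<and>
        I \<subseteq> arrow_ideal Q [^]\<^bsub>ideals_set (path_algebra Q)\<^esub> (2::nat))"

definition bq_algebra ::
  "('v, 'a) pre_digraph \<Rightarrow> (('v, 'a) path \<Rightarrow>\<^sub>0 'k::field) set \<Rightarrow>
   (('v, 'a) path \<Rightarrow>\<^sub>0 'k) set ring" where
  "bq_algebra Q I = path_algebra Q Quot I"

definition coset_smult ::
  "('v, 'a) pre_digraph \<Rightarrow> (('v, 'a) path \<Rightarrow>\<^sub>0 'k::field) set \<Rightarrow>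
   'k \<Rightarrow> (('v, 'a) path \<Rightarrow>\<^sub>0 'k) set \<Rightarrow> (('v, 'a) path \<Rightarrow>\<^sub>0 'k) set" where
  "coset_smult Q I c X = (\<Union>f\<in>X. I +>\<^bsub>path_algebra Q\<^esub> Poly_Mapping.map ((*) c) f)"

definition vertex_idem ::
  "('v, 'a) pre_digraph \<Rightarrow> (('v, 'a) path \<Rightarrow>\<^sub>0 'k::field) set \<Rightarrow> 'v \<Rightarrow>
   (('v, 'a) path \<Rightarrow>\<^sub>0 'k) set" where
  "vertex_idem Q I x = I +>\<^bsub>path_algebra Q\<^esub> Poly_Mapping.single (x, [], x) 1"

definition arrow_class ::
  "('v, 'a) pre_digraph \<Rightarrow> (('v, 'a) path \<Rightarrow>\<^sub>0 'k::field) set \<Rightarrow> 'a \<Rightarrow>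
   (('v, 'a) path \<Rightarrow>\<^sub>0 'k) set" where
  "arrow_class Q I a = I +>\<^bsub>path_algebra Q\<^esub> arrow Q a"

definition idem_sum ::
  "('v, 'a) pre_digraph \<Rightarrow> (('v, 'a) path \<Rightarrow>\<^sub>0 'k::field) set \<Rightarrow> 'v set \<Rightarrow>
   (('v, 'a) path \<Rightarrow>\<^sub>0 'k) set" where
  "idem_sum Q I V = (\<Oplus>\<^bsub>bq_algebra Q I\<^esub> x\<in>V. vertex_idem Q I x)"

text \<open>\<open>e R f\<close>\<close>

definition peirce :: "('r, 'm) ring_scheme \<Rightarrow> 'r \<Rightarrow> 'r \<Rightarrow> 'r set" where
  "peirce R e f = {e \<otimes>\<^bsub>R\<^esub> r \<otimes>\<^bsub>R\<^esub> f | r. r \<in> carrier R}"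

text \<open>For a full subquiver \<open>Q'\<close> of \<open>Q\<close> and \<open>I' = kQ' \<inter> I\<close>, the canonical injection
  \<open>kQ'/I' \<rightarrow> kQ/I\<close> sends \<open>f + I'\<close> to \<open>f + I\<close>.\<close>

definition restrict_ideal ::
  "('v, 'a) pre_digraph \<Rightarrow> (('v, 'a) path \<Rightarrow>\<^sub>0 'k::field) set \<Rightarrow>
   (('v, 'a) path \<Rightarrow>\<^sub>0 'k) set" where
  "restrict_ideal Q' I = carrier (path_algebra Q') \<inter> I"

definition coset_incl ::
  "('v, 'a) pre_digraph \<Rightarrow> (('v, 'a) path \<Rightarrow>\<^sub>0 'k::field) set \<Rightarrow>
   (('v, 'a) path \<Rightarrow>\<^sub>0 'k) set \<Rightarrow> (('v, 'a) path \<Rightarrow>\<^sub>0 'k) set" where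
  "coset_incl Q I X = (\<Union>f\<in>X. I +>\<^bsub>path_algebra Q\<^esub> f)"


section \<open>Semi-normed bases\<close>

definition k_basis ::
  "('v, 'a) pre_digraph \<Rightarrow> (('v, 'a) path \<Rightarrow>\<^sub>0 'k::field) set \<Rightarrow>
   (('v, 'a) path \<Rightarrow>\<^sub>0 'k) set set \<Rightarrow> (('v, 'a) path \<Rightarrow>\<^sub>0 'k) set set \<Rightarrow> bool" where
  "k_basis Q I W B \<longleftrightarrow>
     B \<subseteq> W \<and>
     (\<forall>w\<in>W. \<exists>!c :: (('v, 'a) path \<Rightarrow>\<^sub>0 'k) set \<Rightarrow>\<^sub>0 'k.
        Poly_Mapping.keys c \<subseteq> B \<and>
        w = (\<Oplus>\<^bsub>bq_algebra Q I\<^esub> \<sigma>\<in>Poly_Mapping.keys c.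
               coset_smult Q I (Poly_Mapping.lookup c \<sigma>) \<sigma>))"

text \<open>\<open>hom_space Q I x y\<close> is \<open>\<epsilon>\<^sub>x \<Lambda> \<epsilon>\<^sub>y\<close>, the span of the classes of paths from \<open>x\<close> to \<open>y\<close>.\<close>

definition hom_space ::
  "('v, 'a) pre_digraph \<Rightarrow> (('v, 'a) path \<Rightarrow>\<^sub>0 'k::field) set \<Rightarrow> 'v \<Rightarrow> 'v \<Rightarrow>
   (('v, 'a) path \<Rightarrow>\<^sub>0 'k) set set" where
  "hom_space Q I x y = peirce (bq_algebra Q I) (vertex_idem Q I x) (vertex_idem Q I y)"

text \<open>The basis of \<open>\<epsilon>\<^sub>x \<Lambda> \<epsilon>\<^sub>y\<close> that makes up the \<open>(x, y)\<close>-part of \<open>B\<close> is recovered as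
  \<open>B \<inter> hom_space Q I x y\<close>, because the spaces \<open>\<epsilon>\<^sub>x \<Lambda> \<epsilon>\<^sub>y\<close> intersect pairwise in zero.\<close>

definition semi_normed_basis ::
  "('v, 'a) pre_digraph \<Rightarrow> (('v, 'a) path \<Rightarrow>\<^sub>0 'k::field) set \<Rightarrow>
   (('v, 'a) path \<Rightarrow>\<^sub>0 'k) set set \<Rightarrow> bool" where
  "semi_normed_basis Q I B \<longleftrightarrow>
     B \<subseteq> (\<Union>x\<in>verts Q. \<Union>y\<in>verts Q. hom_space Q I x y) \<and>
     (\<forall>x\<in>verts Q. \<forall>y\<in>verts Q. k_basis Q I (hom_space Q I x y) (B \<inter> hom_space Q I x y)) \<and>
     (\<forall>x\<in>verts Q. vertex_idem Q I x \<in> B) \<and>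
     (\<forall>a\<in>arcs Q. arrow_class Q I a \<in> B) \<and>
     (\<forall>\<sigma>\<in>B. \<forall>\<tau>\<in>B.
        \<sigma> \<otimes>\<^bsub>bq_algebra Q I\<^esub> \<tau> = \<zero>\<^bsub>bq_algebra Q I\<^esub> \<or>
        (\<exists>c \<rho>. c \<noteq> 0 \<and> \<rho> \<in> B \<and> \<sigma> \<otimes>\<^bsub>bq_algebra Q I\<^esub> \<tau> = coset_smult Q I c \<rho>))"


section \<open>Simplicial homology of a semi-normed basis\<close>

text \<open>\<open>b(\<sigma>, \<tau>)\<close>, meaningful only when \<open>\<sigma> \<tau> \<noteq> 0\<close>.\<close>

definition basis_prod ::
  "('v, 'a) pre_digraph \<Rightarrow> (('v, 'a) path \<Rightarrow>\<^sub>0 'k::field) set \<Rightarrow>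
   (('v, 'a) path \<Rightarrow>\<^sub>0 'k) set set \<Rightarrow>
   (('v, 'a) path \<Rightarrow>\<^sub>0 'k) set \<Rightarrow> (('v, 'a) path \<Rightarrow>\<^sub>0 'k) set \<Rightarrow> (('v, 'a) path \<Rightarrow>\<^sub>0 'k) set" where
  "basis_prod Q I B \<sigma> \<tau> =
     (THE \<rho>. \<rho> \<in> B \<and> (\<exists>c. c \<noteq> 0 \<and> \<sigma> \<otimes>\<^bsub>bq_algebra Q I\<^esub> \<tau> = coset_smult Q I c \<rho>))"

definition src ::
  "('v, 'a) pre_digraph \<Rightarrow> (('v, 'a) path \<Rightarrow>\<^sub>0 'k::field) set \<Rightarrow>
   (('v, 'a) path \<Rightarrow>\<^sub>0 'k) set \<Rightarrow> 'v" where
  "src Q I \<sigma> = (THE x. x \<in> verts Q \<and> (\<exists>y\<in>verts Q. \<sigma> \<in> hom_space Q I x y))"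

definition tgt ::
  "('v, 'a) pre_digraph \<Rightarrow> (('v, 'a) path \<Rightarrow>\<^sub>0 'k::field) set \<Rightarrow>
   (('v, 'a) path \<Rightarrow>\<^sub>0 'k) set \<Rightarrow> 'v" where
  "tgt Q I \<sigma> = (THE y. y \<in> verts Q \<and> (\<exists>x\<in>verts Q. \<sigma> \<in> hom_space Q I x y))"

text \<open>Generators of the chain groups: \<open>Inl x\<close> is a vertex (degree 0), \<open>Inr [\<sigma>\<^sub>1, \<dots>, \<sigma>\<^sub>n]\<close> is a
  tuple of degree \<open>n \<ge> 1\<close>. In degree 1 the stationary idempotents are included.\<close>

type_synonym ('v, 'a, 'k) simplex = "'v + (('v, 'a) path \<Rightarrow>\<^sub>0 'k) set list"

definition sc_simplices ::
  "('v, 'a) pre_digraph \<Rightarrow> (('v, 'a) path \<Rightarrow>\<^sub>0 'k::field) set \<Rightarrow>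
   (('v, 'a) path \<Rightarrow>\<^sub>0 'k) set set \<Rightarrow> nat \<Rightarrow> ('v, 'a, 'k) simplex set" where
  "sc_simplices Q I B n =
     (if n = 0 then Inl ` verts Q
      else if n = 1 then {Inr [\<sigma>] | \<sigma>. \<sigma> \<in> B}
      else {Inr \<sigma>s | \<sigma>s. length \<sigma>s = n \<and> set \<sigma>s \<subseteq> B - vertex_idem Q I ` verts Q \<and>
              foldr (mult (bq_algebra Q I)) \<sigma>s \<one>\<^bsub>bq_algebra Q I\<^esub> \<noteq> \<zero>\<^bsub>bq_algebra Q I\<^esub>})"

definition sc_group ::
  "('v, 'a) pre_digraph \<Rightarrow> (('v, 'a) path \<Rightarrow>\<^sub>0 'k::field) set \<Rightarrow>
   (('v, 'a) path \<Rightarrow>\<^sub>0 'k) set set \<Rightarrow> nat \<Rightarrow> (('v, 'a, 'k) simplex \<Rightarrow>\<^sub>0 int) monoid" where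
  "sc_group Q I B n = free_Abelian_group (sc_simplices Q I B n)"

text \<open>The list positions \<open>j - 1\<close> and \<open>j\<close> hold \<open>\<sigma>\<^sub>j\<close> and \<open>\<sigma>\<^sub>j\<^sub>+\<^sub>1\<close>.\<close>

definition sc_face ::
  "('v, 'a) pre_digraph \<Rightarrow> (('v, 'a) path \<Rightarrow>\<^sub>0 'k::field) set \<Rightarrow>
   (('v, 'a) path \<Rightarrow>\<^sub>0 'k) set set \<Rightarrow> nat \<Rightarrow>
   (('v, 'a) path \<Rightarrow>\<^sub>0 'k) set list \<Rightarrow> (('v, 'a) path \<Rightarrow>\<^sub>0 'k) set list" where
  "sc_face Q I B j \<sigma>s =
     take (j - 1) \<sigma>s @ [basis_prod Q I B (\<sigma>s ! (j - 1)) (\<sigma>s ! j)] @ drop (j + 1) \<sigma>s"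

definition sc_boundary_simplex ::
  "('v, 'a) pre_digraph \<Rightarrow> (('v, 'a) path \<Rightarrow>\<^sub>0 'k::field) set \<Rightarrow>
   (('v, 'a) path \<Rightarrow>\<^sub>0 'k) set set \<Rightarrow>
   ('v, 'a, 'k) simplex \<Rightarrow> (('v, 'a, 'k) simplex \<Rightarrow>\<^sub>0 int)" where
  "sc_boundary_simplex Q I B s =
     (case s of
        Inl x \<Rightarrow> 0
      | Inr \<sigma>s \<Rightarrow>
          (if length \<sigma>s = 1
           then frag_of (Inl (tgt Q I (hd \<sigma>s))) - frag_of (Inl (src Q I (hd \<sigma>s)))
           else frag_of (Inr (tl \<sigma>s))
                + (\<Sum>j = 1..length \<sigma>s - 1. frag_cmul ((- 1) ^ j) (frag_of (Inr (sc_face Q I B j \<sigma>s))))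
                + frag_cmul ((- 1) ^ length \<sigma>s) (frag_of (Inr (butlast \<sigma>s)))))"

definition sc_boundary ::
  "('v, 'a) pre_digraph \<Rightarrow> (('v, 'a) path \<Rightarrow>\<^sub>0 'k::field) set \<Rightarrow>
   (('v, 'a) path \<Rightarrow>\<^sub>0 'k) set set \<Rightarrow>
   (('v, 'a, 'k) simplex \<Rightarrow>\<^sub>0 int) \<Rightarrow> (('v, 'a, 'k) simplex \<Rightarrow>\<^sub>0 int)" where
  "sc_boundary Q I B = frag_extend (sc_boundary_simplex Q I B)"

definition simplicial_homology ::
  "('v, 'a) pre_digraph \<Rightarrow> (('v, 'a) path \<Rightarrow>\<^sub>0 'k::field) set \<Rightarrow>
   (('v, 'a) path \<Rightarrow>\<^sub>0 'k) set set \<Rightarrow> nat \<Rightarrow> (('v, 'a, 'k) simplex \<Rightarrow>\<^sub>0 int) set monoid" where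
  "simplicial_homology Q I B n =
     subgroup_generated (sc_group Q I B n)
       {c \<in> carrier (sc_group Q I B n). sc_boundary Q I B c = 0}
     Mod (sc_boundary Q I B ` carrier (sc_group Q I B (Suc n)))"

text \<open>Existence of a long exact sequence
  \<open>\<cdots> \<rightarrow> X\<^sub>n \<rightarrow> Y\<^sub>n \<rightarrow> Z\<^sub>n \<rightarrow> X\<^sub>n\<^sub>-\<^sub>1 \<rightarrow> \<cdots> \<rightarrow> X\<^sub>0 \<rightarrow> Y\<^sub>0 \<rightarrow> Z\<^sub>0 \<rightarrow> 0\<close>.\<close>

definition has_long_exact_sequence ::
  "(nat \<Rightarrow> ('x, 'p) monoid_scheme) \<Rightarrow> (nat \<Rightarrow> ('y, 'q) monoid_scheme) \<Rightarrow>
   (nat \<Rightarrow> ('z, 'r) monoid_scheme) \<Rightarrow> bool" where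
  "has_long_exact_sequence X Y Z \<longleftrightarrow>
     (\<exists>f g \<delta>. \<forall>n.
        f n \<in> hom (X n) (Y n) \<and> g n \<in> hom (Y n) (Z n) \<and> \<delta> n \<in> hom (Z (Suc n)) (X n) \<and>
        f n ` carrier (X n) = kernel (Y n) (Z n) (g n) \<and>
        g (Suc n) ` carrier (Y (Suc n)) = kernel (Z (Suc n)) (X n) (\<delta> n) \<and>
        \<delta> n ` carrier (Z (Suc n)) = kernel (X n) (Y n) (f n) \<and>
        g 0 ` carrier (Y 0) = carrier (Z 0))"

end

theory Submission
  imports Defs
begin

text \<open>Each nonzero path class is a multiple of an element of a semi-normed basis, and the path
  classes span, so by linear independence the basis consists of multiples of path classes; in
  particular any two semi-normed bases agree up to scalars. As \<open>e\<^sub>1' R e\<^sub>2'\<close> and \<open>e\<^sub>2' R e\<^sub>1'\<close> vanish,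
  a tuple of basis elements with nonzero product cannot visit both \<open>V\<^sub>1'\<close> and \<open>V\<^sub>2'\<close>, so it lies in one
  of the two bases. Hence the simplices of \<open>R\<close> are the union of those of \<open>A\<^sub>1\<close> and \<open>A\<^sub>2\<close>, which meet
  in those of \<open>C\<close>, and the sequence is the Mayer--Vietoris sequence of this cover.\<close>

section \<open>Mayer--Vietoris sequences of free chain complexes\<close>

text \<open>\<open>B\<^sub>1\<close> and \<open>B\<^sub>2\<close> may scale a path class in eRe
  differently; their images in R then contain proportional but distinct vectors, and the union is no
  basis. Hence the two halves of the theorem: the bases are made to agree on eRe by nonzero
  rescaling, and the sequence is built for agreeing bases. The four algebras consist of cosets of
  four different ideals, so bases are compared through their images in R, and the intersection is
  pulled back to \<open>C\<close> from there. Both bases see the same lines in eRe because eRe is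
  spanned by paths inside \<open>V\<close>, and such paths belong to both subquivers; this is the
  use made of the presentation of \<open>C\<close>. Faces must again be simplices although
  stationary idempotents are barred above degree 1: since I lies in F^2, no relation has a term of
  length 0 or 1, and a product of nonstationary basis elements is never a multiple of a stationary
  one. The scalars \<lambda> do not enter the differential, so what remains concerns sets of
  simplices only.\<close>

locale chain_complex =
  fixes S :: "nat \<Rightarrow> 's set" and d :: "('s \<Rightarrow>\<^sub>0 int) \<Rightarrow> ('s \<Rightarrow>\<^sub>0 int)"
  assumes d_diff: "d (a - b) = d a - d b"
    and d_chain: "Poly_Mapping.keys c \<subseteq> S (Suc n) \<Longrightarrow> Poly_Mapping.keys (d c) \<subseteq> S n"
    and d_d: "Poly_Mapping.keys c \<subseteq> S (Suc n) \<Longrightarrow> d (d c) = 0"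
    and d_bottom: "Poly_Mapping.keys c \<subseteq> S 0 \<Longrightarrow> d c = 0"
begin

definition chains :: "nat \<Rightarrow> ('s \<Rightarrow>\<^sub>0 int) set" where
  "chains n = {c. Poly_Mapping.keys c \<subseteq> S n}"

definition cycles :: "nat \<Rightarrow> ('s \<Rightarrow>\<^sub>0 int) set" where
  "cycles n = {c \<in> chains n. d c = 0}"

definition boundaries :: "nat \<Rightarrow> ('s \<Rightarrow>\<^sub>0 int) set" where
  "boundaries n = d ` chains (Suc n)"

text \<open>Shaped like \<open>simplicial_homology\<close>, so that the two agree by unfolding.
  \<open>cycles n\<close> is already a subgroup, so \<open>subgroup_generated\<close> adds nothing
  to it (\<open>carrier_cycle_group\<close>).\<close>

definition homology :: "nat \<Rightarrow> ('s \<Rightarrow>\<^sub>0 int) set monoid" where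
  "homology n = subgroup_generated (free_Abelian_group (S n)) (cycles n) Mod boundaries n"

text \<open>The coset of \<open>boundaries n\<close> through \<open>c\<close>. Later arguments
  compute with representatives through \<open>hclass_eq_iff\<close> and \<open>mult_homology\<close>
  and leave the factor group folded.\<close>

definition hclass :: "nat \<Rightarrow> ('s \<Rightarrow>\<^sub>0 int) \<Rightarrow> ('s \<Rightarrow>\<^sub>0 int) set" where
  "hclass n c = (\<lambda>b. b + c) ` boundaries n"

lemma d_zero [simp]: "d 0 = 0"
  using d_diff[of 0 0] by simp

lemma d_minus: "d (- a) = - d a"
  using d_diff[of 0 a] by simp

lemma d_add: "d (a + b) = d a + d b"
  using d_diff[of a "- b"] by (simp add: d_minus)

lemma chains_diff: "a \<in> chains n \<Longrightarrow> b \<in> chains n \<Longrightarrow> a - b \<in> chains n"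
  unfolding chains_def using keys_diff[of a b] by auto

lemma chains_zero [simp]: "0 \<in> chains n"
  by (simp add: chains_def)

lemma chains_minus: "a \<in> chains n \<Longrightarrow> - a \<in> chains n"
  using chains_diff[of 0 n a] by simp

lemma chains_add: "a \<in> chains n \<Longrightarrow> b \<in> chains n \<Longrightarrow> a + b \<in> chains n"
  using chains_diff[of a n "- b"] by (simp add: chains_minus)

lemma d_in_chains: "c \<in> chains (Suc n) \<Longrightarrow> d c \<in> chains n"
  by (simp add: chains_def d_chain)

lemma d_in_cycles: "c \<in> chains (Suc n) \<Longrightarrow> d c \<in> cycles n"
  by (simp add: cycles_def d_in_chains) (simp add: chains_def d_d)

lemma cycles_chains: "c \<in> cycles n \<Longrightarrow> c \<in> chains n"
  by (simp add: cycles_def)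

lemma cycles_0: "cycles 0 = chains 0"
  by (auto simp: cycles_def chains_def d_bottom)

lemma cycles_diff: "a \<in> cycles n \<Longrightarrow> b \<in> cycles n \<Longrightarrow> a - b \<in> cycles n"
  by (simp add: cycles_def chains_diff d_diff)

lemma cycles_add: "a \<in> cycles n \<Longrightarrow> b \<in> cycles n \<Longrightarrow> a + b \<in> cycles n"
  by (simp add: cycles_def chains_add d_add)

lemma cycles_zero [simp]: "0 \<in> cycles n"
  by (simp add: cycles_def)

lemma cycles_minus: "a \<in> cycles n \<Longrightarrow> - a \<in> cycles n"
  using cycles_diff[of 0 n a] by simp

lemma boundaries_diff: "a \<in> boundaries n \<Longrightarrow> b \<in> boundaries n \<Longrightarrow> a - b \<in> boundaries n"
  unfolding boundaries_def by (auto simp flip: d_diff intro: chains_diff)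

lemma boundaries_zero [simp]: "0 \<in> boundaries n"
  unfolding boundaries_def by (metis chains_zero d_zero imageI)

lemma boundaries_minus: "a \<in> boundaries n \<Longrightarrow> - a \<in> boundaries n"
  using boundaries_diff[of 0 n a] by simp

lemma boundaries_add: "a \<in> boundaries n \<Longrightarrow> b \<in> boundaries n \<Longrightarrow> a + b \<in> boundaries n"
  using boundaries_diff[of a n "- b"] by (simp add: boundaries_minus)

lemma hclass_eq_iff: "hclass n a = hclass n b \<longleftrightarrow> a - b \<in> boundaries n"
proof
  assume "hclass n a = hclass n b"
  moreover have "a \<in> hclass n a"
    unfolding hclass_def by (metis add_0 boundaries_zero imageI)
  ultimately obtain e where "e \<in> boundaries n" "a = e + b"
    by (auto simp: hclass_def)
  then show "a - b \<in> boundaries n" by simp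
next
  assume ab: "a - b \<in> boundaries n"
  have "e + a \<in> (\<lambda>e. e + b) ` boundaries n" if "e \<in> boundaries n" for e
    by (rule image_eqI[of _ _ "e + (a - b)"]) (use ab that in \<open>auto intro: boundaries_add\<close>)
  moreover have "e + b \<in> (\<lambda>e. e + a) ` boundaries n" if "e \<in> boundaries n" for e
    by (rule image_eqI[of _ _ "e - (a - b)"]) (use ab that in \<open>auto intro: boundaries_diff\<close>)
  ultimately show "hclass n a = hclass n b"
    unfolding hclass_def by blast
qed

lemma carrier_cycle_group:
  "carrier (subgroup_generated (free_Abelian_group (S n)) (cycles n)) = cycles n"
proof -
  have "subgroup (cycles n) (free_Abelian_group (S n))"
  proof (rule group.subgroupI)
    show "cycles n \<subseteq> carrier (free_Abelian_group (S n))"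
      by (auto simp: cycles_def chains_def)
    show "cycles n \<noteq> {}" using cycles_zero by blast
    show "inv\<^bsub>free_Abelian_group (S n)\<^esub> a \<in> cycles n" if "a \<in> cycles n" for a
      using that cycles_minus[OF that] by (simp add: cycles_def chains_def)
  qed (simp_all add: cycles_add)
  then show ?thesis by (simp add: subgroup.carrier_subgroup_generated_subgroup)
qed

lemma r_coset_cycle_group:
  "boundaries n #>\<^bsub>subgroup_generated (free_Abelian_group (S n)) (cycles n)\<^esub> c = hclass n c"
  by (auto simp: r_coset_def hclass_def)

lemma carrier_homology: "carrier (homology n) = hclass n ` cycles n"
  by (simp add: homology_def FactGroup_def RCOSETS_def carrier_cycle_group r_coset_cycle_group
      UNION_singleton_eq_range)

lemma one_homology: "\<one>\<^bsub>homology n\<^esub> = hclass n 0"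
  by (simp add: homology_def FactGroup_def hclass_def)

lemma mult_homology: "hclass n a \<otimes>\<^bsub>homology n\<^esub> hclass n b = hclass n (a + b)"
proof -
  have 1: "(e + a) + (e' + b) \<in> (\<lambda>e. e + (a + b)) ` boundaries n"
    if "e \<in> boundaries n" "e' \<in> boundaries n" for e e'
    by (rule image_eqI[of _ _ "e + e'"]) (use that in \<open>auto intro: boundaries_add\<close>)
  have 2: "\<exists>h\<in>hclass n a. \<exists>k\<in>hclass n b. e + (a + b) = h + k" if "e \<in> boundaries n" for e
  proof (intro bexI)
    show "e + (a + b) = (e + a) + (0 + b)" by simp
    show "e + a \<in> hclass n a" "0 + b \<in> hclass n b"
      using that boundaries_zero unfolding hclass_def by blast+
  qed
  show ?thesis
    using 1 2 unfolding homology_def FactGroup_def set_mult_def hclass_def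
    by (auto simp: hclass_def)
qed

lemma hclass_eq_one_iff: "hclass n c = \<one>\<^bsub>homology n\<^esub> \<longleftrightarrow> c \<in> boundaries n"
  by (simp add: one_homology hclass_eq_iff)

end

text \<open>All maps of the Mayer--Vietoris sequence come from additive relations between cycles.\<close>

lemma induced_hom:
  assumes "chain_complex S d" "chain_complex S' d'"
    and cyc: "\<And>z c. P z c \<Longrightarrow> c \<in> chain_complex.cycles S' d' m"
    and total: "\<And>z. z \<in> chain_complex.cycles S d n \<Longrightarrow> \<exists>c. P z c"
    and add: "\<And>z w c e. P z c \<Longrightarrow> P w e \<Longrightarrow> P (z + w) (c + e)"
    and diff: "\<And>z w c e. P z c \<Longrightarrow> P w e \<Longrightarrow> P (z - w) (c - e)"
    and bd: "\<And>z c. P z c \<Longrightarrow> z \<in> chain_complex.boundaries S d n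
               \<Longrightarrow> c \<in> chain_complex.boundaries S' d' m"
  shows "\<exists>F \<in> hom (chain_complex.homology S d n) (chain_complex.homology S' d' m).
           \<forall>z c. P z c \<longrightarrow> F (chain_complex.hclass S d n z) = chain_complex.hclass S' d' m c"
proof -
  interpret A: chain_complex S d by fact
  interpret B: chain_complex S' d' by fact
  define F where "F X = B.hclass m (SOME c. \<exists>z. X = A.hclass n z \<and> P z c)" for X
  have F: "F (A.hclass n z) = B.hclass m c" if "P z c" for z c
  proof -
    have "\<exists>c. \<exists>w. A.hclass n z = A.hclass n w \<and> P w c" using that by blast
    then have "\<exists>w. A.hclass n z = A.hclass n w \<and> P w (SOME c. \<exists>w. A.hclass n z = A.hclass n w \<and> P w c)"
      by (rule someI_ex)
    then obtain w where w: "A.hclass n z = A.hclass n w"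
        "P w (SOME c. \<exists>w. A.hclass n z = A.hclass n w \<and> P w c)"
      by blast
    \<comment> \<open>The choice may have used another representative \<open>w\<close> of the class
      of \<open>z\<close>. The differences are again related by \<open>diff\<close>, so
      \<open>bd\<close> makes the two possible values homologous.\<close>
    then have "w - z \<in> A.boundaries n"
      using A.hclass_eq_iff by metis
    then have "(SOME c. \<exists>w. A.hclass n z = A.hclass n w \<and> P w c) - c \<in> B.boundaries m"
      using bd diff[OF w(2) that] by blast
    then show ?thesis
      unfolding F_def B.hclass_eq_iff .
  qed
  have "F \<in> hom (A.homology n) (B.homology m)"
  proof (rule homI)
    fix X assume "X \<in> carrier (A.homology n)"
    then obtain z where z: "z \<in> A.cycles n" "X = A.hclass n z" by (auto simp: A.carrier_homology)
    then obtain c where "P z c" using total by blast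
    then show "F X \<in> carrier (B.homology m)"
      using F cyc z by (auto simp: B.carrier_homology)
  next
    fix X Y assume "X \<in> carrier (A.homology n)" "Y \<in> carrier (A.homology n)"
    then obtain z w where z: "z \<in> A.cycles n" "X = A.hclass n z" and w: "w \<in> A.cycles n" "Y = A.hclass n w"
      by (auto simp: A.carrier_homology)
    then obtain c e where ce: "P z c" "P w e" using total by blast
    show "F (X \<otimes>\<^bsub>A.homology n\<^esub> Y) = F X \<otimes>\<^bsub>B.homology m\<^esub> F Y"
      using F[OF add[OF ce]] F[OF ce(1)] F[OF ce(2)]
      by (simp add: z w A.mult_homology B.mult_homology)
  qed
  with F show ?thesis by blast
qed

text \<open>Injectivity and compatibility with the differentials are asked only on chains of one
  degree. The type of simplices also contains lists that are no simplices, and nothing is known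
  about \<open>j\<close> there.\<close>

locale chain_embedding = A: chain_complex S' d' + R: chain_complex S d
  for S' :: "nat \<Rightarrow> 'a set" and d' and S :: "nat \<Rightarrow> 'r set" and d +
  fixes j :: "('a \<Rightarrow>\<^sub>0 int) \<Rightarrow> ('r \<Rightarrow>\<^sub>0 int)"
  assumes j_diff: "j (x - y) = j x - j y"
    and j_inj: "a \<in> A.chains n \<Longrightarrow> j a = 0 \<Longrightarrow> a = 0"
    and j_d: "a \<in> A.chains n \<Longrightarrow> j (d' a) = d (j a)"
    and j_chains: "a \<in> A.chains n \<Longrightarrow> j a \<in> R.chains n"
begin

lemma j_zero [simp]: "j 0 = 0"
  using j_diff[of 0 0] by simp

lemma j_minus: "j (- x) = - j x"
  using j_diff[of 0 x] by simp

lemma j_add: "j (x + y) = j x + j y"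
  using j_diff[of x "- y"] by (simp add: j_minus)

lemma j_eqD: "a \<in> A.chains n \<Longrightarrow> b \<in> A.chains n \<Longrightarrow> j a = j b \<Longrightarrow> a = b"
  using j_inj[of "a - b" n] by (simp add: j_diff A.chains_diff)

text \<open>Injectivity of \<open>j\<close> one degree lower reflects the vanishing of the boundary,
  so cycles can be recognised inside the big complex. Degree 0 has no lower degree and uses
  \<open>d_bottom\<close>.\<close>

lemma cycle_if_d_j_zero:
  assumes "a \<in> A.chains n" "d (j a) = 0" shows "a \<in> A.cycles n"
proof -
  have "d' a = 0"
  proof (cases n)
    case 0 then show ?thesis using assms A.d_bottom by (simp add: A.chains_def)
  next
    case (Suc m)
    then have "d' a \<in> A.chains m" using assms A.d_in_chains by simp
    then show ?thesis using j_inj j_d assms by metis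
  qed
  then show ?thesis using assms by (simp add: A.cycles_def)
qed

lemma d_j_cycles: "a \<in> A.cycles n \<Longrightarrow> d (j a) = 0"
  using j_d[of a n] by (simp add: A.cycles_def)

lemma j_cycles: "a \<in> A.cycles n \<Longrightarrow> j a \<in> R.cycles n"
  by (simp add: R.cycles_def d_j_cycles j_chains A.cycles_chains)

lemma j_boundaries: "a \<in> A.boundaries n \<Longrightarrow> j a \<in> R.boundaries n"
  unfolding A.boundaries_def R.boundaries_def using j_d j_chains by fastforce

end

text \<open>The inclusion of C into A is not given as a map: both are embedded in R, and
  \<open>c\<close> corresponds to \<open>a\<close> when their images there coincide.
  \<open>lift\<close> makes this correspondence total.\<close>

locale embedding_pair =
  C: chain_complex SC dC + A: chain_complex S1 d1 + R: chain_complex S d +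
  eC: chain_embedding SC dC S d jC + e1: chain_embedding S1 d1 S d j1
  for SC :: "nat \<Rightarrow> 'c set" and dC and S1 :: "nat \<Rightarrow> 'a set" and d1 and S :: "nat \<Rightarrow> 'r set" and d
    and jC j1 +
  assumes lift: "c \<in> C.chains n \<Longrightarrow> \<exists>a\<in>A.chains n. j1 a = jC c"
begin

definition "rel n c a \<longleftrightarrow> c \<in> C.cycles n \<and> a \<in> A.cycles n \<and> jC c = j1 a"

lemma rel_total: "c \<in> C.cycles n \<Longrightarrow> \<exists>a. rel n c a"
  unfolding rel_def using lift C.cycles_chains e1.cycle_if_d_j_zero eC.d_j_cycles by metis

text \<open>A chain bounding \<open>c\<close> lifts to A; the boundary of the lift has the same
  image in R as \<open>a\<close>, and \<open>j1\<close> is injective.\<close>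

lemma rel_boundary: "rel n c a \<Longrightarrow> c \<in> C.boundaries n \<Longrightarrow> a \<in> A.boundaries n"
  unfolding rel_def C.boundaries_def A.boundaries_def
proof (elim conjE imageE)
  fix e assume ca: "a \<in> A.cycles n" "jC c = j1 a" and e: "c = dC e" "e \<in> C.chains (Suc n)"
  obtain a' where a': "a' \<in> A.chains (Suc n)" "j1 a' = jC e" using lift e by blast
  have "j1 (d1 a') = j1 a" using a' e ca eC.j_d e1.j_d by metis
  then have "d1 a' = a" using e1.j_eqD A.d_in_chains[OF a'(1)] A.cycles_chains[OF ca(1)] by blast
  then show "a \<in> d1 ` A.chains (Suc n)" using a' by blast
qed

lemma rel_hom:
  "rel n c a \<Longrightarrow> a \<in> A.cycles n"
  "rel n c a \<Longrightarrow> rel n c' a' \<Longrightarrow> rel n (c + c') (a + a')"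
  "rel n c a \<Longrightarrow> rel n c' a' \<Longrightarrow> rel n (c - c') (a - a')"
  by (simp_all add: rel_def C.cycles_add A.cycles_add eC.j_add e1.j_add C.cycles_diff A.cycles_diff
      eC.j_diff e1.j_diff)

lemma lift_hom:
  "\<exists>F \<in> hom (C.homology n) (A.homology n). \<forall>z c. rel n z c \<longrightarrow> F (C.hclass n z) = A.hclass n c"
  by (rule induced_hom[OF C.chain_complex_axioms A.chain_complex_axioms
        rel_hom(1) rel_total rel_hom(2,3) rel_boundary])

end

text \<open>In each degree the maps c |-> (c, c) and (a, b) |-> a - b form a short exact sequence
  from C through the sum of A and B to R: \<open>lift\<close> and \<open>meet\<close> give exactness
  in the middle, \<open>split\<close> surjectivity on the right.\<close>

locale mayer_vietoris =
  C: chain_complex SC dC + A: chain_complex S1 d1 + B: chain_complex S2 d2 + R: chain_complex S d +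
  eC: chain_embedding SC dC S d jC + e1: chain_embedding S1 d1 S d j1 + e2: chain_embedding S2 d2 S d j2 +
  p1: embedding_pair SC dC S1 d1 S d jC j1 + p2: embedding_pair SC dC S2 d2 S d jC j2
  for SC :: "nat \<Rightarrow> 'c set" and dC and S1 :: "nat \<Rightarrow> 'a set" and d1
    and S2 :: "nat \<Rightarrow> 'b set" and d2 and S :: "nat \<Rightarrow> 'r set" and d and jC j1 j2 +
  assumes meet: "a \<in> A.chains n \<Longrightarrow> b \<in> B.chains n \<Longrightarrow> j1 a = j2 b \<Longrightarrow> \<exists>c\<in>C.chains n. jC c = j1 a"
    and split: "z \<in> R.chains n \<Longrightarrow> \<exists>a\<in>A.chains n. \<exists>b\<in>B.chains n. z = j1 a - j2 b"
begin

lemmas lift1 = p1.lift and lift2 = p2.lift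
lemmas j1_d = e1.j_d and j2_d = e2.j_d and jC_d = eC.j_d
lemmas j1_diff = e1.j_diff and j2_diff = e2.j_diff and jC_diff = eC.j_diff
lemmas j1_chains = e1.j_chains and j2_chains = e2.j_chains
lemmas j_add = eC.j_add e1.j_add e2.j_add
lemmas inj_C = eC.j_eqD
lemmas d1_cycle = e1.cycle_if_d_j_zero and d2_cycle = e2.cycle_if_d_j_zero and dC_cycle = eC.cycle_if_d_j_zero
lemmas d_j_cycles = eC.d_j_cycles e1.d_j_cycles e2.d_j_cycles
lemmas j1_cycles = e1.j_cycles and j2_cycles = e2.j_cycles
lemmas j1_boundaries = e1.j_boundaries and j2_boundaries = e2.j_boundaries

definition "rel_1R n a z \<longleftrightarrow> a \<in> A.cycles n \<and> z = j1 a"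
text \<open>The sign belongs to B alone, so that the sum of the two maps into R is a - b and kills
  the diagonal image of C.\<close>

definition "rel_2R n b z \<longleftrightarrow> b \<in> B.cycles n \<and> z = - j2 b"
text \<open>The connecting map of the snake lemma as a relation: for a cycle z = a - b the
  boundaries of \<open>a\<close> and \<open>b\<close> agree in R, and by \<open>meet\<close> they
  come from a chain of C.\<close>

definition "rel_RC n z c \<longleftrightarrow> z \<in> R.cycles (Suc n) \<and> c \<in> C.cycles n \<and>
  (\<exists>a\<in>A.chains (Suc n). \<exists>b\<in>B.chains (Suc n). z = j1 a - j2 b \<and> jC c = d (j1 a))"

lemma rel_RC_total: assumes z: "z \<in> R.cycles (Suc n)" shows "\<exists>c. rel_RC n z c"
proof -
  obtain a b where ab: "a \<in> A.chains (Suc n)" "b \<in> B.chains (Suc n)" "z = j1 a - j2 b"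
    using split R.cycles_chains[OF z] by blast
  then have "d (j1 a) = d (j2 b)"
    using z by (simp add: R.cycles_def R.d_diff)
  then have eq: "j1 (d1 a) = j2 (d2 b)" using ab j1_d j2_d by metis
  then obtain c where c: "c \<in> C.chains n" "jC c = j1 (d1 a)"
    using meet A.d_in_chains[OF ab(1)] B.d_in_chains[OF ab(2)] by blast
  then have eq': "jC c = d (j1 a)" using j1_d ab by metis
  moreover have "d (d (j1 a)) = 0"
    using R.d_d j1_chains[OF ab(1)] by (simp add: R.chains_def)
  ultimately have "c \<in> C.cycles n" using dC_cycle c by metis
  then show ?thesis unfolding rel_RC_def using z ab eq' by blast
qed

text \<open>If z = d y and y = a' - b', then a - d a' and b - d b' have the same image in R. They
  come from one chain \<open>e\<close> of C, and the boundary of \<open>e\<close> is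
  \<open>c\<close> because d d a' = 0.\<close>

lemma rel_RC_boundary: assumes zc: "rel_RC n z c" and z: "z \<in> R.boundaries (Suc n)"
  shows "c \<in> C.boundaries n"
proof -
  obtain a b where ab: "a \<in> A.chains (Suc n)" "b \<in> B.chains (Suc n)" "z = j1 a - j2 b"
      "jC c = d (j1 a)" and c: "c \<in> C.cycles n"
    using zc unfolding rel_RC_def by blast
  obtain y where y: "y \<in> R.chains (Suc (Suc n))" "z = d y" using z by (auto simp: R.boundaries_def)
  obtain a' b' where ab': "a' \<in> A.chains (Suc (Suc n))" "b' \<in> B.chains (Suc (Suc n))" "y = j1 a' - j2 b'"
    using split y by blast
  have "j1 a - j2 b = j1 (d1 a') - j2 (d2 b')"
    using ab ab' y j1_d j2_d by (metis R.d_diff)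
  then have "j1 (a - d1 a') = j2 (b - d2 b')"
    by (simp add: j1_diff j2_diff algebra_simps)
  moreover have aa: "a - d1 a' \<in> A.chains (Suc n)" and "b - d2 b' \<in> B.chains (Suc n)"
    using ab ab' A.d_in_chains B.d_in_chains A.chains_diff B.chains_diff by blast+
  ultimately obtain e where e: "e \<in> C.chains (Suc n)" "jC e = j1 (a - d1 a')"
    using meet by blast
  have "d1 (d1 a') = 0" using A.d_d ab' by (simp add: A.chains_def)
  have "jC (dC e) = d (j1 (a - d1 a'))" using e jC_d by metis
  also have "\<dots> = j1 (d1 (a - d1 a'))" using aa j1_d by metis
  also have "\<dots> = j1 (d1 a)" using \<open>d1 (d1 a') = 0\<close> by (simp add: A.d_diff)
  also have "\<dots> = jC c" using ab j1_d by metis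
  finally have "dC e = c" using inj_C C.d_in_chains[OF e(1)] C.cycles_chains[OF c] by blast
  then show ?thesis using e by (auto simp: C.boundaries_def)
qed

lemma rel_1R_hom:
  "rel_1R n a z \<Longrightarrow> z \<in> R.cycles n"
  "a \<in> A.cycles n \<Longrightarrow> \<exists>z. rel_1R n a z"
  "rel_1R n a z \<Longrightarrow> rel_1R n a' z' \<Longrightarrow> rel_1R n (a + a') (z + z')"
  "rel_1R n a z \<Longrightarrow> rel_1R n a' z' \<Longrightarrow> rel_1R n (a - a') (z - z')"
  "rel_1R n a z \<Longrightarrow> a \<in> A.boundaries n \<Longrightarrow> z \<in> R.boundaries n"
  by (simp_all add: rel_1R_def A.cycles_add j_add A.cycles_diff j1_diff j1_cycles j1_boundaries)

lemma rel_2R_hom: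
  "rel_2R n b z \<Longrightarrow> z \<in> R.cycles n"
  "b \<in> B.cycles n \<Longrightarrow> \<exists>z. rel_2R n b z"
  "rel_2R n b z \<Longrightarrow> rel_2R n b' z' \<Longrightarrow> rel_2R n (b + b') (z + z')"
  "rel_2R n b z \<Longrightarrow> rel_2R n b' z' \<Longrightarrow> rel_2R n (b - b') (z - z')"
  "rel_2R n b z \<Longrightarrow> b \<in> B.boundaries n \<Longrightarrow> z \<in> R.boundaries n"
  by (simp_all add: rel_2R_def B.cycles_add j_add B.cycles_diff j2_diff j2_cycles j2_boundaries
      R.cycles_minus R.boundaries_minus)

lemma rel_RC_hom:
  "rel_RC n z c \<Longrightarrow> c \<in> C.cycles n"
  "rel_RC n z c \<Longrightarrow> rel_RC n w e \<Longrightarrow> rel_RC n (z + w) (c + e)"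
  "rel_RC n z c \<Longrightarrow> rel_RC n w e \<Longrightarrow> rel_RC n (z - w) (c - e)"
proof -
  show "rel_RC n z c \<Longrightarrow> c \<in> C.cycles n" by (simp add: rel_RC_def)
  assume rel: "rel_RC n z c" "rel_RC n w e"
  then obtain a b a' b' where ab: "a \<in> A.chains (Suc n)" "b \<in> B.chains (Suc n)" "z = j1 a - j2 b" "jC c = d (j1 a)"
    "a' \<in> A.chains (Suc n)" "b' \<in> B.chains (Suc n)" "w = j1 a' - j2 b'" "jC e = d (j1 a')"
    unfolding rel_RC_def by blast
  show "rel_RC n (z + w) (c + e)"
    unfolding rel_RC_def
  proof (intro conjI bexI[of _ "a + a'"] bexI[of _ "b + b'"])
    show "z + w \<in> R.cycles (Suc n)" "c + e \<in> C.cycles n"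
      using rel by (simp_all add: rel_RC_def R.cycles_add C.cycles_add)
    show "a + a' \<in> A.chains (Suc n)" "b + b' \<in> B.chains (Suc n)"
      using ab by (simp_all add: A.chains_add B.chains_add)
    show "z + w = j1 (a + a') - j2 (b + b')" "jC (c + e) = d (j1 (a + a'))"
      by (simp_all add: ab j_add R.d_add)
  qed
  show "rel_RC n (z - w) (c - e)"
    unfolding rel_RC_def
  proof (intro conjI bexI[of _ "a - a'"] bexI[of _ "b - b'"])
    show "z - w \<in> R.cycles (Suc n)" "c - e \<in> C.cycles n"
      using rel by (simp_all add: rel_RC_def R.cycles_diff C.cycles_diff)
    show "a - a' \<in> A.chains (Suc n)" "b - b' \<in> B.chains (Suc n)"
      using ab by (simp_all add: A.chains_diff B.chains_diff)
    show "z - w = j1 (a - a') - j2 (b - b')" "jC (c - e) = d (j1 (a - a'))"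
      by (simp_all add: ab jC_diff j1_diff j2_diff R.d_diff)
  qed
qed

theorem long_exact_sequence:
  "has_long_exact_sequence C.homology (\<lambda>n. A.homology n \<times>\<times> B.homology n) R.homology"
proof -
  obtain f1 where f1: "\<And>n. f1 n \<in> hom (C.homology n) (A.homology n)"
      "\<And>n z c. p1.rel n z c \<Longrightarrow> f1 n (C.hclass n z) = A.hclass n c"
    using p1.lift_hom by metis
  obtain f2 where f2: "\<And>n. f2 n \<in> hom (C.homology n) (B.homology n)"
      "\<And>n z c. p2.rel n z c \<Longrightarrow> f2 n (C.hclass n z) = B.hclass n c"
    using p2.lift_hom by metis
  have "\<exists>F \<in> hom (A.homology n) (R.homology n). \<forall>z c. rel_1R n z c \<longrightarrow> F (A.hclass n z) = R.hclass n c" for n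
    by (rule induced_hom[OF A.chain_complex_axioms R.chain_complex_axioms
        rel_1R_hom])
  then obtain g1 where g1: "\<And>n. g1 n \<in> hom (A.homology n) (R.homology n)"
      "\<And>n z c. rel_1R n z c \<Longrightarrow> g1 n (A.hclass n z) = R.hclass n c"
    by metis
  have "\<exists>F \<in> hom (B.homology n) (R.homology n). \<forall>z c. rel_2R n z c \<longrightarrow> F (B.hclass n z) = R.hclass n c" for n
    by (rule induced_hom[OF B.chain_complex_axioms R.chain_complex_axioms
        rel_2R_hom])
  then obtain g2 where g2: "\<And>n. g2 n \<in> hom (B.homology n) (R.homology n)"
      "\<And>n z c. rel_2R n z c \<Longrightarrow> g2 n (B.hclass n z) = R.hclass n c"
    by metis
  have "\<exists>F \<in> hom (R.homology (Suc n)) (C.homology n). \<forall>z c. rel_RC n z c \<longrightarrow> F (R.hclass (Suc n) z) = C.hclass n c" for n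
    by (rule induced_hom[OF R.chain_complex_axioms C.chain_complex_axioms
        rel_RC_hom(1) rel_RC_total rel_RC_hom(2,3) rel_RC_boundary])
  then obtain \<delta> where \<delta>: "\<And>n. \<delta> n \<in> hom (R.homology (Suc n)) (C.homology n)"
      "\<And>n z c. rel_RC n z c \<Longrightarrow> \<delta> n (R.hclass (Suc n) z) = C.hclass n c"
    by metis
  define f where "f n X = (f1 n X, f2 n X)" for n X
  define g where "g n = (\<lambda>(X, Y). g1 n X \<otimes>\<^bsub>R.homology n\<^esub> g2 n Y)" for n
  have f_hc: "f n (C.hclass n c) = (A.hclass n a, B.hclass n b)"
    if "c \<in> C.cycles n" "a \<in> A.cycles n" "b \<in> B.cycles n" "jC c = j1 a" "jC c = j2 b" for n c a b
    using f1(2)[of n c a] f2(2)[of n c b] that by (simp add: f_def p1.rel_def p2.rel_def)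
  have g_hc: "g n (A.hclass n a, B.hclass n b) = R.hclass n (j1 a - j2 b)"
    if "a \<in> A.cycles n" "b \<in> B.cycles n" for n a b
    using g1(2)[of n a "j1 a"] g2(2)[of n b "- j2 b"] that
    by (simp add: g_def rel_1R_def rel_2R_def R.mult_homology)
  have f_hom: "f n \<in> hom (C.homology n) (A.homology n \<times>\<times> B.homology n)" for n
    using f1(1)[of n] f2(1)[of n] by (auto simp: f_def hom_def DirProd_def)
  have g_hom: "g n \<in> hom (A.homology n \<times>\<times> B.homology n) (R.homology n)" for n
  proof (rule homI)
    fix X assume "X \<in> carrier (A.homology n \<times>\<times> B.homology n)"
    then obtain a b where "a \<in> A.cycles n" "b \<in> B.cycles n" "X = (A.hclass n a, B.hclass n b)"
      by (auto simp: A.carrier_homology B.carrier_homology)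
    then show "g n X \<in> carrier (R.homology n)"
      by (auto simp: g_hc R.carrier_homology intro!: imageI R.cycles_diff j1_cycles j2_cycles)
  next
    fix X Y assume "X \<in> carrier (A.homology n \<times>\<times> B.homology n)" "Y \<in> carrier (A.homology n \<times>\<times> B.homology n)"
    then obtain a b a' b' where "a \<in> A.cycles n" "b \<in> B.cycles n" "X = (A.hclass n a, B.hclass n b)"
      "a' \<in> A.cycles n" "b' \<in> B.cycles n" "Y = (A.hclass n a', B.hclass n b')"
      by (auto simp: A.carrier_homology B.carrier_homology)
    then show "g n (X \<otimes>\<^bsub>A.homology n \<times>\<times> B.homology n\<^esub> Y) = g n X \<otimes>\<^bsub>R.homology n\<^esub> g n Y"
      by (simp add: A.mult_homology B.mult_homology R.mult_homology g_hc A.cycles_add B.cycles_add j_add algebra_simps)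
  qed
  have exact_Y: "f n ` carrier (C.homology n) = kernel (A.homology n \<times>\<times> B.homology n) (R.homology n) (g n)" for n
  proof (intro equalityI subsetI)
    fix X assume "X \<in> f n ` carrier (C.homology n)"
    then obtain c where c: "c \<in> C.cycles n" "X = f n (C.hclass n c)" by (auto simp: C.carrier_homology)
    then obtain a b where ab: "a \<in> A.cycles n" "jC c = j1 a" "b \<in> B.cycles n" "jC c = j2 b"
      using p1.rel_total p2.rel_total unfolding p1.rel_def p2.rel_def by metis
    then have "X = (A.hclass n a, B.hclass n b)" using f_hc c by simp
    moreover have "g n (A.hclass n a, B.hclass n b) = \<one>\<^bsub>R.homology n\<^esub>"
      using ab g_hc by (simp add: R.one_homology)
    ultimately show "X \<in> kernel (A.homology n \<times>\<times> B.homology n) (R.homology n) (g n)"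
      using ab by (auto simp: kernel_def A.carrier_homology B.carrier_homology)
  next
    fix X assume X: "X \<in> kernel (A.homology n \<times>\<times> B.homology n) (R.homology n) (g n)"
    then obtain a b where ab: "a \<in> A.cycles n" "b \<in> B.cycles n" "X = (A.hclass n a, B.hclass n b)"
      by (auto simp: kernel_def A.carrier_homology B.carrier_homology)
    then have "R.hclass n (j1 a - j2 b) = \<one>\<^bsub>R.homology n\<^esub>" using X g_hc by (simp add: kernel_def)
    then have "j1 a - j2 b \<in> R.boundaries n" by (simp add: R.hclass_eq_one_iff)
    then obtain y where y: "y \<in> R.chains (Suc n)" "j1 a - j2 b = d y" by (auto simp: R.boundaries_def)
    obtain a' b' where ab': "a' \<in> A.chains (Suc n)" "b' \<in> B.chains (Suc n)" "y = j1 a' - j2 b'"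
      using split y by blast
    have "j1 a - j2 b = j1 (d1 a') - j2 (d2 b')" using y ab' j1_d j2_d by (metis R.d_diff)
    \<comment> \<open>The bounding chain is split as well. Correcting \<open>a\<close> and
      \<open>b\<close> by the boundaries of its two parts keeps their homology classes and makes the
      images in R equal, so \<open>meet\<close> yields the preimage in C.\<close>
    then have "j1 (a - d1 a') = j2 (b - d2 b')" by (simp add: j1_diff j2_diff algebra_simps)
    moreover have aa: "a - d1 a' \<in> A.cycles n" and bb: "b - d2 b' \<in> B.cycles n"
      using ab ab' A.d_in_cycles B.d_in_cycles A.cycles_diff B.cycles_diff by blast+
    ultimately obtain c where c: "c \<in> C.chains n" "jC c = j1 (a - d1 a')" "jC c = j2 (b - d2 b')"
      using meet A.cycles_chains B.cycles_chains by metis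
    then have "c \<in> C.cycles n" using dC_cycle aa d_j_cycles(2) by metis
    moreover from this have "f n (C.hclass n c) = (A.hclass n (a - d1 a'), B.hclass n (b - d2 b'))"
      using f_hc aa bb c by blast
    moreover have "A.hclass n (a - d1 a') = A.hclass n a" "B.hclass n (b - d2 b') = B.hclass n b"
      using ab' A.boundaries_minus[of "d1 a'" n] B.boundaries_minus[of "d2 b'" n]
      by (simp_all add: A.hclass_eq_iff B.hclass_eq_iff A.boundaries_def B.boundaries_def)
    ultimately have "X = f n (C.hclass n c)" "c \<in> C.cycles n"
      using ab by simp_all
    then show "X \<in> f n ` carrier (C.homology n)"
      by (simp add: C.carrier_homology)
  qed
  have exact_Z: "g (Suc n) ` carrier (A.homology (Suc n) \<times>\<times> B.homology (Suc n)) =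
      kernel (R.homology (Suc n)) (C.homology n) (\<delta> n)" for n
  proof (intro equalityI subsetI)
    fix X assume "X \<in> g (Suc n) ` carrier (A.homology (Suc n) \<times>\<times> B.homology (Suc n))"
    then obtain a b where ab: "a \<in> A.cycles (Suc n)" "b \<in> B.cycles (Suc n)"
        "X = R.hclass (Suc n) (j1 a - j2 b)"
      using g_hc by (auto simp: A.carrier_homology B.carrier_homology)
    have cyc: "j1 a - j2 b \<in> R.cycles (Suc n)" using ab R.cycles_diff j1_cycles j2_cycles by blast
    \<comment> \<open>With both parts cycles, this splitting itself shows that the connecting map
      takes the value 0.\<close>
    have "rel_RC n (j1 a - j2 b) 0"
      unfolding rel_RC_def
    proof (intro conjI bexI[of _ a] bexI[of _ b])
      show "jC 0 = d (j1 a)" using d_j_cycles(2)[OF ab(1)] by simp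
    qed (use cyc A.cycles_chains[OF ab(1)] B.cycles_chains[OF ab(2)] in simp_all)
    then have "\<delta> n X = \<one>\<^bsub>C.homology n\<^esub>" using \<delta>(2) ab by (simp add: C.one_homology)
    then show "X \<in> kernel (R.homology (Suc n)) (C.homology n) (\<delta> n)"
      using ab cyc by (auto simp: kernel_def R.carrier_homology)
  next
    fix X assume X: "X \<in> kernel (R.homology (Suc n)) (C.homology n) (\<delta> n)"
    then obtain z where z: "z \<in> R.cycles (Suc n)" "X = R.hclass (Suc n) z"
      by (auto simp: kernel_def R.carrier_homology)
    obtain c where zc: "rel_RC n z c" using rel_RC_total z by blast
    then have "C.hclass n c = \<one>\<^bsub>C.homology n\<^esub>" using X z \<delta>(2) by (auto simp: kernel_def)
    then obtain e where e: "e \<in> C.chains (Suc n)" "c = dC e"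
      by (auto simp: C.hclass_eq_one_iff C.boundaries_def)
    obtain a b where ab: "a \<in> A.chains (Suc n)" "b \<in> B.chains (Suc n)" "z = j1 a - j2 b" "jC c = d (j1 a)"
      using zc unfolding rel_RC_def by blast
    obtain a' b' where ab': "a' \<in> A.chains (Suc n)" "j1 a' = jC e" "b' \<in> B.chains (Suc n)" "j2 b' = jC e"
      using lift1 lift2 e by blast
    \<comment> \<open>\<open>e\<close> has boundary \<open>c\<close>, hence boundary d a in R.
      Subtracting it from both parts leaves \<open>z\<close> unchanged and turns both parts into
      cycles.\<close>
    have z': "z = j1 (a - a') - j2 (b - b')" using ab ab' by (simp add: j1_diff j2_diff)
    have "d (j1 (a - a')) = 0" using ab ab' e jC_d by (simp add: j1_diff R.d_diff)
    then have a0: "a - a' \<in> A.cycles (Suc n)" using d1_cycle A.chains_diff ab ab' by blast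
    have "d (j2 (b - b')) = d (j1 (a - a')) - d z" by (simp add: z' R.d_diff)
    then have "d (j2 (b - b')) = 0" using z \<open>d (j1 (a - a')) = 0\<close> by (simp add: R.cycles_def)
    then have b0: "b - b' \<in> B.cycles (Suc n)" using d2_cycle B.chains_diff ab ab' by blast
    have "X = g (Suc n) (A.hclass (Suc n) (a - a'), B.hclass (Suc n) (b - b'))"
      using g_hc[OF a0 b0] z z' by simp
    then show "X \<in> g (Suc n) ` carrier (A.homology (Suc n) \<times>\<times> B.homology (Suc n))"
      using a0 b0 by (auto simp: A.carrier_homology B.carrier_homology)
  qed
  have exact_X: "\<delta> n ` carrier (R.homology (Suc n)) =
      kernel (C.homology n) (A.homology n \<times>\<times> B.homology n) (f n)" for n
  proof (intro equalityI subsetI)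
    fix X assume "X \<in> \<delta> n ` carrier (R.homology (Suc n))"
    then obtain z where z: "z \<in> R.cycles (Suc n)" "X = \<delta> n (R.hclass (Suc n) z)"
      by (auto simp: R.carrier_homology)
    obtain c where zc: "rel_RC n z c" using rel_RC_total z by blast
    then have X: "X = C.hclass n c" using z \<delta>(2) by simp
    obtain a b where ab: "a \<in> A.chains (Suc n)" "b \<in> B.chains (Suc n)" "z = j1 a - j2 b" "jC c = d (j1 a)"
        and c: "c \<in> C.cycles n"
      using zc unfolding rel_RC_def by blast
    have "d (j1 a) = d (j2 b)" using z ab by (simp add: R.cycles_def R.d_diff)
    then have "jC c = j1 (d1 a)" "jC c = j2 (d2 b)" using ab j1_d j2_d by metis+
    then have "f n X = (A.hclass n (d1 a), B.hclass n (d2 b))"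
      using f_hc c X ab A.d_in_cycles B.d_in_cycles by blast
    moreover have "A.hclass n (d1 a) = \<one>\<^bsub>A.homology n\<^esub>" "B.hclass n (d2 b) = \<one>\<^bsub>B.homology n\<^esub>"
      using ab by (auto simp: A.hclass_eq_one_iff B.hclass_eq_one_iff A.boundaries_def B.boundaries_def)
    ultimately show "X \<in> kernel (C.homology n) (A.homology n \<times>\<times> B.homology n) (f n)"
      using X c by (auto simp: kernel_def C.carrier_homology)
  next
    fix X assume X: "X \<in> kernel (C.homology n) (A.homology n \<times>\<times> B.homology n) (f n)"
    then obtain c where c: "c \<in> C.cycles n" "X = C.hclass n c"
      by (auto simp: kernel_def C.carrier_homology)
    then obtain a b where ab: "a \<in> A.cycles n" "jC c = j1 a" "b \<in> B.cycles n" "jC c = j2 b"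
      using p1.rel_total p2.rel_total unfolding p1.rel_def p2.rel_def by metis
    have "A.hclass n a = \<one>\<^bsub>A.homology n\<^esub>" "B.hclass n b = \<one>\<^bsub>B.homology n\<^esub>"
      using X c ab f_hc by (auto simp: kernel_def)
    then obtain a' b' where ab': "a' \<in> A.chains (Suc n)" "a = d1 a'" "b' \<in> B.chains (Suc n)" "b = d2 b'"
      by (auto simp: A.hclass_eq_one_iff B.hclass_eq_one_iff A.boundaries_def B.boundaries_def)
    have eq: "jC c = d (j1 a')" "jC c = d (j2 b')" using ab ab' j1_d j2_d by metis+
    \<comment> \<open>Two chains bounding \<open>c\<close>, one in A and one in B, are glued along
      \<open>c\<close> to a cycle of R; the connecting map sends it back to the class of
      \<open>c\<close>.\<close>
    have "j1 a' - j2 b' \<in> R.cycles (Suc n)"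
      using ab' eq by (simp add: R.cycles_def R.chains_diff j1_chains j2_chains R.d_diff)
    moreover from this have "rel_RC n (j1 a' - j2 b') c"
      unfolding rel_RC_def using ab' c eq by blast
    ultimately have "X = \<delta> n (R.hclass (Suc n) (j1 a' - j2 b'))" "j1 a' - j2 b' \<in> R.cycles (Suc n)"
      using \<delta>(2) c by simp_all
    then show "X \<in> \<delta> n ` carrier (R.homology (Suc n))"
      by (simp add: R.carrier_homology)
  qed
  have exact_0: "g 0 ` carrier (A.homology 0 \<times>\<times> B.homology 0) = carrier (R.homology 0)"
  proof
    show "g 0 ` carrier (A.homology 0 \<times>\<times> B.homology 0) \<subseteq> carrier (R.homology 0)"
      using g_hom[of 0] by (auto simp: hom_def)
    show "carrier (R.homology 0) \<subseteq> g 0 ` carrier (A.homology 0 \<times>\<times> B.homology 0)"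
    proof
      fix X assume "X \<in> carrier (R.homology 0)"
      then obtain z where z: "z \<in> R.chains 0" "X = R.hclass 0 z"
        by (auto simp: R.carrier_homology R.cycles_0)
      \<comment> \<open>In degree 0 every chain is a cycle, so the parts of a splitting already
        represent homology classes and the sequence ends with a surjection.\<close>
      obtain a b where ab: "a \<in> A.cycles 0" "b \<in> B.cycles 0" "z = j1 a - j2 b"
        using split[OF z(1)] by (auto simp: A.cycles_0 B.cycles_0)
      then show "X \<in> g 0 ` carrier (A.homology 0 \<times>\<times> B.homology 0)"
        using z g_hc[OF ab(1,2)] by (force simp: A.carrier_homology B.carrier_homology image_iff)
    qed
  qed
  show ?thesis
    unfolding has_long_exact_sequence_def
    by (intro exI[of _ f] exI[of _ g] exI[of _ \<delta>] allI conjI)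
      (rule f_hom g_hom \<delta>(1) exact_Y exact_Z exact_X exact_0)+
qed

end

section \<open>Path algebras\<close>

definition scale :: "'k::field \<Rightarrow> ('b \<Rightarrow>\<^sub>0 'k) \<Rightarrow> ('b \<Rightarrow>\<^sub>0 'k)" where
  "scale c f = Poly_Mapping.map ((*) c) f"

lemma lookup_scale [simp]: "Poly_Mapping.lookup (scale c f) k = c * Poly_Mapping.lookup f k"
  by (simp add: scale_def Poly_Mapping.map.rep_eq when_def)

lemma scale_single [simp]: "scale c (Poly_Mapping.single k a) = Poly_Mapping.single k (c * a)"
  by (rule poly_mapping_eqI) (simp add: lookup_single when_def)

lemma scale_add: "scale c (f + g) = scale c f + scale c g"
  by (rule poly_mapping_eqI) (simp add: lookup_add algebra_simps)

lemma scale_add_left: "scale (c + d) f = scale c f + scale d f"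
  by (rule poly_mapping_eqI) (simp add: lookup_add algebra_simps)

lemma scale_zero [simp]: "scale c 0 = 0" "scale 0 f = 0"
  by (rule poly_mapping_eqI, simp)+

lemma scale_one [simp]: "scale 1 f = f"
  by (rule poly_mapping_eqI) simp

lemma scale_scale: "scale c (scale d f) = scale (c * d) f"
  by (rule poly_mapping_eqI) simp

lemma keys_scale: "Poly_Mapping.keys (scale c f) \<subseteq> Poly_Mapping.keys f"
  by (auto simp: in_keys_iff)

text \<open>The case \<open>single\<close> concerns only the terms of \<open>f\<close> itself, so an
  assumption on the keys of \<open>f\<close>, for instance that they are paths of \<open>Q\<close>,
  can still be used there.\<close>

lemma poly_mapping_additive_induct [case_names zero single add]:
  fixes f :: "'b \<Rightarrow>\<^sub>0 'c::comm_monoid_add"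
  assumes zero: "P 0"
    and single: "\<And>k. k \<in> Poly_Mapping.keys f \<Longrightarrow> P (Poly_Mapping.single k (Poly_Mapping.lookup f k))"
    and add: "\<And>g h. P g \<Longrightarrow> P h \<Longrightarrow> P (g + h)"
  shows "P f"
proof -
  have "P (\<Sum>k\<in>A. Poly_Mapping.single k (Poly_Mapping.lookup f k))" if "A \<subseteq> Poly_Mapping.keys f" for A
    using finite_subset[OF that finite_keys] that
    by (induction A rule: finite_induct) (auto intro: zero single add)
  moreover have "(\<Sum>k\<in>Poly_Mapping.keys f. Poly_Mapping.single k (Poly_Mapping.lookup f k)) = f"
    by (rule poly_mapping_eqI)
      (auto simp: lookup_sum lookup_single when_def in_keys_iff)
  ultimately show ?thesis by (metis order_refl)
qed

text \<open>The sums in \<open>path_mult\<close> run over keys, which may shrink when terms cancel.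
  Over a common finite superset the index sets stay fixed and bilinearity is a matter of
  distributivity.\<close>

lemma path_mult_superset:
  assumes "finite A" "Poly_Mapping.keys f \<subseteq> A" "finite B" "Poly_Mapping.keys g \<subseteq> B"
  shows "path_mult f g = (\<Sum>(x, p, y)\<in>A. \<Sum>(y', q, z)\<in>B.
    if y = y' then Poly_Mapping.single (x, p @ q, z)
       (Poly_Mapping.lookup f (x, p, y) * Poly_Mapping.lookup g (y', q, z)) else 0)"
proof -
  have "(\<Sum>(y', q, z)\<in>Poly_Mapping.keys g.
      if y = y' then Poly_Mapping.single (x, p @ q, z)
         (Poly_Mapping.lookup f (x, p, y) * Poly_Mapping.lookup g (y', q, z)) else 0) =
    (\<Sum>(y', q, z)\<in>B. if y = y' then Poly_Mapping.single (x, p @ q, z)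
         (Poly_Mapping.lookup f (x, p, y) * Poly_Mapping.lookup g (y', q, z)) else 0)" for x p y
    by (rule sum.mono_neutral_left) (use assms in \<open>auto simp: in_keys_iff\<close>)
  then show ?thesis
    unfolding path_mult_def
    by (subst sum.mono_neutral_left[OF assms(1,2)]) (auto simp: in_keys_iff intro!: sum.neutral)
qed

lemma path_mult_single:
  "path_mult (Poly_Mapping.single (x, p, y) a) (Poly_Mapping.single (y', q, z) b) =
     (if y = y' then Poly_Mapping.single (x, p @ q, z) (a * b) else 0)"
  by (subst path_mult_superset[of "{(x, p, y)}" _ "{(y', q, z)}"]) auto

lemma path_mult_add_left: "path_mult (f + g) h = path_mult f h + path_mult g h"
proof -
  let ?A = "Poly_Mapping.keys f \<union> Poly_Mapping.keys g"
  have "Poly_Mapping.keys (f + g) \<subseteq> ?A" by (rule keys_add)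
  then show ?thesis
    by (subst (1 2 3) path_mult_superset[where A = ?A and B = "Poly_Mapping.keys h"])
      (auto simp: lookup_add distrib_right single_add simp flip: sum.distrib intro!: sum.cong)
qed

lemma path_mult_add_right: "path_mult h (f + g) = path_mult h f + path_mult h g"
proof -
  let ?A = "Poly_Mapping.keys f \<union> Poly_Mapping.keys g"
  have "Poly_Mapping.keys (f + g) \<subseteq> ?A" by (rule keys_add)
  then show ?thesis
    by (subst (1 2 3) path_mult_superset[where A = "Poly_Mapping.keys h" and B = ?A])
      (auto simp: lookup_add distrib_left single_add simp flip: sum.distrib intro!: sum.cong)
qed

lemma path_mult_zero [simp]: "path_mult 0 h = 0" "path_mult h 0 = 0"
  by (simp_all add: path_mult_def)

lemma path_mult_sum_left: "path_mult (sum u A) h = (\<Sum>x\<in>A. path_mult (u x) h)"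
  by (induction A rule: infinite_finite_induct) (simp_all add: path_mult_add_left)

lemma path_mult_sum_right: "path_mult h (sum u A) = (\<Sum>x\<in>A. path_mult h (u x))"
  by (induction A rule: infinite_finite_induct) (simp_all add: path_mult_add_right)

lemma path_mult_scale_left: "path_mult (scale c f) g = scale c (path_mult f g)"
proof (induction f rule: poly_mapping_additive_induct)
  case (single k)
  show ?case
  proof (induction g rule: poly_mapping_additive_induct)
    case (single l)
    then show ?case by (cases k; cases l) (simp add: path_mult_single mult.assoc)
  qed (simp_all add: path_mult_add_right scale_add)
qed (simp_all add: path_mult_add_left scale_add)

lemma path_mult_scale_right: "path_mult f (scale c g) = scale c (path_mult f g)"
proof (induction f rule: poly_mapping_additive_induct)
  case (single k)
  show ?case
  proof (induction g rule: poly_mapping_additive_induct)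
    case (single l)
    then show ?case by (cases k; cases l) (simp add: path_mult_single mult.left_commute)
  qed (simp_all add: path_mult_add_right scale_add)
qed (simp_all add: path_mult_add_left scale_add)

lemma path_mult_assoc: "path_mult (path_mult f g) h = path_mult f (path_mult g h)"
proof (induction f rule: poly_mapping_additive_induct)
  case (single k)
  show ?case
  proof (induction g rule: poly_mapping_additive_induct)
    case (single l)
    show ?case
    proof (induction h rule: poly_mapping_additive_induct)
      case (single m)
      show ?case by (cases k; cases l; cases m) (simp add: path_mult_single mult.assoc)
    qed (simp_all add: path_mult_add_right)
  qed (simp_all add: path_mult_add_left path_mult_add_right)
qed (simp_all add: path_mult_add_left)

lemma keys_path_mult:
  assumes "k \<in> Poly_Mapping.keys (path_mult f g)"
  obtains x p y q z where "k = (x, p @ q, z)" "(x, p, y) \<in> Poly_Mapping.keys f"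
    "(y, q, z) \<in> Poly_Mapping.keys g"
proof -
  have "k \<in> (\<Union>(x, p, y)\<in>Poly_Mapping.keys f. \<Union>(y', q, z)\<in>Poly_Mapping.keys g.
      Poly_Mapping.keys (if y = y' then Poly_Mapping.single (x, p @ q, z)
         (Poly_Mapping.lookup f (x, p, y) * Poly_Mapping.lookup g (y', q, z)) else 0))"
    using assms unfolding path_mult_def
    by (fastforce dest!: keys_sum[THEN subsetD] split: prod.splits)
  then show ?thesis using that by (auto split: if_splits)
qed

section \<open>The ring axioms for the path algebra\<close>

lemma path_algebra_simps [simp]:
  "carrier (path_algebra Q) = {f. Poly_Mapping.keys f \<subseteq> paths Q}"
  "mult (path_algebra Q) = path_mult"
  "add (path_algebra Q) = (+)"
  "\<zero>\<^bsub>path_algebra Q\<^esub> = 0"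
  "\<one>\<^bsub>path_algebra Q\<^esub> = (\<Sum>x\<in>verts Q. Poly_Mapping.single (x, [], x) 1)"
  by (simp_all add: path_algebra_def)

lemma nil_path [simp]: "(x, [], y) \<in> paths Q \<longleftrightarrow> x = y \<and> x \<in> verts Q"
  by (auto simp: paths_def pre_digraph.awalk_def pre_digraph.cas.simps)

lemma path_ends: "wf_digraph Q \<Longrightarrow> (x, p, y) \<in> paths Q \<Longrightarrow> x \<in> verts Q \<and> y \<in> verts Q"
  by (auto simp: paths_def wf_digraph.awalk_hd_in_verts wf_digraph.awalk_last_in_verts)

lemma Cons_path: "wf_digraph Q \<Longrightarrow>
  (x, a # p, y) \<in> paths Q \<longleftrightarrow> a \<in> arcs Q \<and> x = tail Q a \<and> (head Q a, p, y) \<in> paths Q"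
  by (simp add: paths_def wf_digraph.awalk_Cons_iff)

lemma append_path: "wf_digraph Q \<Longrightarrow> (x, p, y) \<in> paths Q \<Longrightarrow> (y, q, z) \<in> paths Q \<Longrightarrow> (x, p @ q, z) \<in> paths Q"
  by (induction p arbitrary: x) (simp_all add: Cons_path)

lemma path_mult_closed:
  assumes "wf_digraph Q" "Poly_Mapping.keys f \<subseteq> paths Q" "Poly_Mapping.keys g \<subseteq> paths Q"
  shows "Poly_Mapping.keys (path_mult f g) \<subseteq> paths Q"
  using assms by (blast elim: keys_path_mult intro: append_path)

lemma path_mult_idem_left:
  "path_mult (Poly_Mapping.single (x, [], x) c) (Poly_Mapping.single (y, p, z) d) =
     (if x = y then Poly_Mapping.single (y, p, z) (c * d) else 0)"
  by (simp add: path_mult_single)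

lemma path_mult_idem_right:
  "path_mult (Poly_Mapping.single (y, p, z) d) (Poly_Mapping.single (x, [], x) c) =
     (if x = z then Poly_Mapping.single (y, p, z) (d * c) else 0)"
  by (simp add: path_mult_single)

lemma ring_path_algebra:
  fixes Q :: "('v, 'a) pre_digraph"
  assumes wf: "wf_digraph Q" and fin: "finite (verts Q)"
  shows "ring (path_algebra Q :: (('v, 'a) path \<Rightarrow>\<^sub>0 'k::field) ring)"
proof (rule ringI)
  show "abelian_group (path_algebra Q :: (('v, 'a) path \<Rightarrow>\<^sub>0 'k) ring)"
  proof (rule abelian_groupI)
    fix f :: "('v, 'a) path \<Rightarrow>\<^sub>0 'k" assume "f \<in> carrier (path_algebra Q)"
    then show "\<exists>g\<in>carrier (path_algebra Q). g \<oplus>\<^bsub>path_algebra Q\<^esub> f = \<zero>\<^bsub>path_algebra Q\<^esub>"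
      by (intro bexI[of _ "- f"]) (auto simp: in_keys_iff)
  qed (auto simp: add.assoc add.commute dest: keys_add[THEN subsetD])
  have one: "Poly_Mapping.keys (\<Sum>x\<in>verts Q. Poly_Mapping.single (x, [], x) (1::'k)) \<subseteq> paths Q"
    using keys_sum by fastforce
  \<comment> \<open>Both ends of a path are vertices, so exactly one stationary summand survives
    against each monomial; finiteness of the vertex set makes the sum a genuine one.\<close>
  have l_one: "path_mult (\<Sum>x\<in>verts Q. Poly_Mapping.single (x, [], x) 1) f = f"
    if f: "Poly_Mapping.keys f \<subseteq> paths Q" for f :: "('v, 'a) path \<Rightarrow>\<^sub>0 'k"
  proof (induction f rule: poly_mapping_additive_induct)
    case (single k)
    obtain y p z where k: "k = (y, p, z)" by (cases k)
    have "y \<in> verts Q" using single f path_ends[OF wf] k by blast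
    then show ?case
      using fin by (simp add: k path_mult_sum_left path_mult_idem_left)
  qed (simp_all add: path_mult_add_right)
  have r_one: "path_mult f (\<Sum>x\<in>verts Q. Poly_Mapping.single (x, [], x) 1) = f"
    if f: "Poly_Mapping.keys f \<subseteq> paths Q" for f :: "('v, 'a) path \<Rightarrow>\<^sub>0 'k"
  proof (induction f rule: poly_mapping_additive_induct)
    case (single k)
    obtain y p z where k: "k = (y, p, z)" by (cases k)
    have "z \<in> verts Q" using single f path_ends[OF wf] k by blast
    then show ?case
      using fin by (simp add: k path_mult_sum_right path_mult_idem_right)
  qed (simp_all add: path_mult_add_left)
  show "Group.monoid (path_algebra Q :: (('v, 'a) path \<Rightarrow>\<^sub>0 'k) ring)"
    by (rule monoidI) (simp_all add: one l_one r_one path_mult_assoc path_mult_closed[OF wf])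
qed (simp_all add: path_mult_add_left path_mult_add_right)

lemma path_algebra_minus:
  assumes "wf_digraph Q" "finite (verts Q)" "Poly_Mapping.keys f \<subseteq> paths Q"
  shows "\<ominus>\<^bsub>path_algebra Q\<^esub> f = - f"
  by (rule abelian_group.minus_equality[OF ring.is_abelian_group[OF ring_path_algebra[OF assms(1,2)]]])
    (use assms(3) in auto)

text \<open>A description by supports of the n-th power of the arrow ideal. Admissibility is applied
  in the form I \<subseteq> \<open>long_paths Q 2\<close>: no element of I has a term of length 0 or
  1.\<close>

definition long_paths :: "('v, 'a) pre_digraph \<Rightarrow> nat \<Rightarrow> (('v, 'a) path \<Rightarrow>\<^sub>0 'k::field) set" where
  "long_paths Q n = {f. \<forall>(x, p, y) \<in> Poly_Mapping.keys f. (x, p, y) \<in> paths Q \<and> n \<le> length p}"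

lemma long_paths_mult:
  assumes "wf_digraph Q" "f \<in> long_paths Q m" "g \<in> long_paths Q n"
  shows "path_mult f g \<in> long_paths Q (m + n)"
  unfolding long_paths_def
proof clarify
  fix x p y assume "(x, p, y) \<in> Poly_Mapping.keys (path_mult f g)"
  then show "(x, p, y) \<in> paths Q \<and> m + n \<le> length p"
    using assms by (elim keys_path_mult) (fastforce simp: long_paths_def intro: append_path)
qed

lemma long_paths_add: "f \<in> long_paths Q n \<Longrightarrow> g \<in> long_paths Q n \<Longrightarrow> f + g \<in> long_paths Q n"
  unfolding long_paths_def using keys_add[of f g] by fastforce

lemma long_paths_0: "carrier (path_algebra Q) = long_paths Q 0"
  by (auto simp: long_paths_def)

lemma ideal_long_paths:
  fixes Q :: "('v, 'a) pre_digraph"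
  assumes "wf_digraph Q" "finite (verts Q)"
  shows "ideal (long_paths Q n) (path_algebra Q :: (('v, 'a) path \<Rightarrow>\<^sub>0 'k::field) ring)"
proof (rule idealI)
  interpret K: ring "path_algebra Q :: (('v, 'a) path \<Rightarrow>\<^sub>0 'k) ring" by (rule ring_path_algebra) fact+
  show "ring (path_algebra Q :: (('v, 'a) path \<Rightarrow>\<^sub>0 'k) ring)" by (rule K.ring_axioms)
  show "subgroup (long_paths Q n) (add_monoid (path_algebra Q :: (('v, 'a) path \<Rightarrow>\<^sub>0 'k) ring))"
  proof (rule group.subgroupI)
    show "Group.group (add_monoid (path_algebra Q :: (('v, 'a) path \<Rightarrow>\<^sub>0 'k) ring))" by (rule K.a_group)
    show "(long_paths Q n :: (('v, 'a) path \<Rightarrow>\<^sub>0 'k) set) \<noteq> {}"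
      by (auto simp: long_paths_def intro!: exI[of _ 0])
    show "inv\<^bsub>add_monoid (path_algebra Q)\<^esub> f \<in> long_paths Q n" if "f \<in> long_paths Q n"
      for f :: "('v, 'a) path \<Rightarrow>\<^sub>0 'k"
    proof -
      have "Poly_Mapping.keys f \<subseteq> paths Q" using that by (auto simp: long_paths_def)
      from path_algebra_minus[OF assms this] that show ?thesis
        by (simp add: a_inv_def) (auto simp: long_paths_def in_keys_iff)
    qed
  qed (auto simp: long_paths_add, auto simp: long_paths_def)
next
  fix a x :: "('v, 'a) path \<Rightarrow>\<^sub>0 'k" assume "a \<in> long_paths Q n" "x \<in> carrier (path_algebra Q)"
  then show "x \<otimes>\<^bsub>path_algebra Q\<^esub> a \<in> long_paths Q n" "a \<otimes>\<^bsub>path_algebra Q\<^esub> x \<in> long_paths Q n"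
    using long_paths_mult[OF assms(1), of x 0 a n] long_paths_mult[OF assms(1), of a n x 0]
    unfolding long_paths_0 by simp_all
qed

lemma arrow_ideal_long_paths:
  fixes Q :: "('v, 'a) pre_digraph"
  assumes "wf_digraph Q" "finite (verts Q)"
  shows "arrow_ideal Q \<subseteq> (long_paths Q 1 :: (('v, 'a) path \<Rightarrow>\<^sub>0 'k::field) set)"
proof -
  interpret K: ring "path_algebra Q :: (('v, 'a) path \<Rightarrow>\<^sub>0 'k) ring" by (rule ring_path_algebra) fact+
  show ?thesis
    unfolding arrow_ideal_def
    by (rule K.genideal_minimal[OF ideal_long_paths[OF assms]])
      (auto simp: long_paths_def arrow_def Cons_path[OF assms(1)] wf_digraph.head_in_verts[OF assms(1)])
qed

lemma ideal_prod_long_paths: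
  assumes "wf_digraph Q" "J \<subseteq> long_paths Q m" "J' \<subseteq> long_paths Q n"
  shows "ideal_prod (path_algebra Q) J J' \<subseteq> long_paths Q (m + n)"
proof
  fix f assume "f \<in> ideal_prod (path_algebra Q) J J'"
  then show "f \<in> long_paths Q (m + n)"
  proof induction
    case (prod i j)
    then show ?case using assms by (auto intro: long_paths_mult)
  qed (simp add: long_paths_add)
qed

lemma arrow_ideal_square:
  assumes "wf_digraph Q" "finite (verts Q)"
  shows "arrow_ideal Q [^]\<^bsub>ideals_set (path_algebra Q)\<^esub> (2::nat) \<subseteq> long_paths Q 2"
proof -
  \<comment> \<open>A power in \<open>ideals_set\<close> starts from the unit of that monoid, the
    whole path algebra. The square is therefore (kQ F) F, and the lengths add up as (0 + 1) +
    1.\<close>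
  have "arrow_ideal Q [^]\<^bsub>ideals_set (path_algebra Q)\<^esub> (2::nat) =
      ideal_prod (path_algebra Q) (ideal_prod (path_algebra Q) (carrier (path_algebra Q)) (arrow_ideal Q)) (arrow_ideal Q)"
    by (simp add: ideals_set_def numeral_2_eq_2 nat_pow_def)
  also have "\<dots> \<subseteq> long_paths Q ((0 + 1) + 1)"
    by (intro ideal_prod_long_paths assms arrow_ideal_long_paths) (simp only: long_paths_0)
  finally show ?thesis by (simp add: numeral_2_eq_2)
qed

section \<open>Quotients of path algebras\<close>

text \<open>These conditions pass to a full subquiver with \<open>restrict_ideal\<close>
  (\<open>bound_path_algebra_induce\<close>), so the same lemmas serve R and its corners.\<close>

locale bound_path_algebra =
  fixes Q :: "('v, 'a) pre_digraph" and I :: "(('v, 'a) path \<Rightarrow>\<^sub>0 'k::field) set"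
  assumes wf: "wf_digraph Q" and fin: "finite (verts Q)"
    and ideal_I: "ideal I (path_algebra Q)" and I_long: "I \<subseteq> long_paths Q 2"
begin

sublocale K: ring "path_algebra Q" by (rule ring_path_algebra[OF wf fin])

sublocale I: ideal I "path_algebra Q" by (rule ideal_I)

sublocale L: ring "bq_algebra Q I"
  unfolding bq_algebra_def by (rule I.quotient_is_ring)

definition cl :: "(('v, 'a) path \<Rightarrow>\<^sub>0 'k) \<Rightarrow> (('v, 'a) path \<Rightarrow>\<^sub>0 'k) set" where
  "cl f = I +>\<^bsub>path_algebra Q\<^esub> f"

abbreviation kQ :: "(('v, 'a) path \<Rightarrow>\<^sub>0 'k) set" where
  "kQ \<equiv> {f. Poly_Mapping.keys f \<subseteq> paths Q}"

abbreviation smult :: "'k \<Rightarrow> (('v, 'a) path \<Rightarrow>\<^sub>0 'k) set \<Rightarrow> (('v, 'a) path \<Rightarrow>\<^sub>0 'k) set" (infixr "\<bullet>" 75) where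
  "smult \<equiv> coset_smult Q I"

abbreviation lmult (infixl "\<odot>" 70) where "lmult \<equiv> mult (bq_algebra Q I)"
abbreviation lzero ("\<o>") where "lzero \<equiv> \<zero>\<^bsub>bq_algebra Q I\<^esub>"
abbreviation ladd (infixl "\<boxplus>" 65) where "ladd \<equiv> add (bq_algebra Q I)"
abbreviation idem ("\<epsilon>") where "idem \<equiv> vertex_idem Q I"
abbreviation hs where "hs \<equiv> hom_space Q I"
abbreviation Lam ("\<Lambda>") where "Lam \<equiv> carrier (bq_algebra Q I)"

lemma kQ_add: "f \<in> kQ \<Longrightarrow> g \<in> kQ \<Longrightarrow> f + g \<in> kQ"
  using K.add.m_closed[of f g] by simp

lemma kQ_minus: "f \<in> kQ \<Longrightarrow> - f \<in> kQ"
  by (auto simp: in_keys_iff)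

lemma kQ_diff: "f \<in> kQ \<Longrightarrow> g \<in> kQ \<Longrightarrow> f - g \<in> kQ"
  using kQ_add[of f "- g"] kQ_minus[of g] by simp

lemma kQ_mult: "f \<in> kQ \<Longrightarrow> g \<in> kQ \<Longrightarrow> path_mult f g \<in> kQ"
  using path_mult_closed[OF wf] by blast

lemma kQ_scale: "f \<in> kQ \<Longrightarrow> scale c f \<in> kQ"
  using keys_scale[of c f] by auto

lemma kQ_sum: "(\<And>x. x \<in> A \<Longrightarrow> u x \<in> kQ) \<Longrightarrow> sum u A \<in> kQ"
  by (induction A rule: infinite_finite_induct) (use kQ_add in auto)

lemma I_kQ: "f \<in> I \<Longrightarrow> f \<in> kQ"
  using I.Icarr by simp

lemma I_zero [simp]: "0 \<in> I"
  using I.zero_closed by simp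

lemma I_add: "f \<in> I \<Longrightarrow> g \<in> I \<Longrightarrow> f + g \<in> I"
  using I.a_closed by simp

lemma I_minus: "f \<in> I \<Longrightarrow> - f \<in> I"
  by (metis I.a_inv_closed I_kQ mem_Collect_eq path_algebra_minus[OF wf fin])

lemma I_diff: "f \<in> I \<Longrightarrow> g \<in> I \<Longrightarrow> f - g \<in> I"
  using I_add[of f "- g"] I_minus[of g] by simp

lemma one_kQ: "(\<Sum>x\<in>verts Q. Poly_Mapping.single (x, [], x) 1) \<in> kQ"
  by (rule kQ_sum) simp

text \<open>\<open>ideal\<close> only speaks of ring multiplication; a scalar acts as multiplication
  by the scalar multiple of the identity.\<close>

lemma I_scale: assumes "f \<in> I" shows "scale c f \<in> I"
proof -
  have "path_mult (scale c (\<Sum>x\<in>verts Q. Poly_Mapping.single (x, [], x) 1)) f \<in> I"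
    using I.I_l_closed[OF assms, of "scale c (\<Sum>x\<in>verts Q. Poly_Mapping.single (x, [], x) 1)"]
      kQ_scale[OF one_kQ] by simp
  moreover have "path_mult (\<Sum>x\<in>verts Q. Poly_Mapping.single (x, [], x) 1) f = f"
    using K.l_one[of f] I_kQ[OF assms] by simp
  ultimately show ?thesis by (simp add: path_mult_scale_left)
qed

lemma cl_alt: "cl f = (\<lambda>h. h + f) ` I"
  by (auto simp: cl_def a_r_coset_def r_coset_def)

lemma cl_eq_iff: "cl f = cl g \<longleftrightarrow> f - g \<in> I"
proof
  assume "cl f = cl g"
  moreover have "f \<in> cl f" unfolding cl_alt by (metis I_zero add_0 imageI)
  ultimately obtain h where "h \<in> I" "f = h + g" by (auto simp: cl_alt)
  then show "f - g \<in> I" by simp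
next
  assume fg: "f - g \<in> I"
  have "h + f \<in> (\<lambda>h. h + g) ` I" if "h \<in> I" for h
    by (rule image_eqI[of _ _ "h + (f - g)"]) (use fg that in \<open>auto intro: I_add\<close>)
  moreover have "h + g \<in> (\<lambda>h. h + f) ` I" if "h \<in> I" for h
    by (rule image_eqI[of _ _ "h - (f - g)"]) (use fg that in \<open>auto intro: I_diff\<close>)
  ultimately show "cl f = cl g" unfolding cl_alt by blast
qed

lemma carrier_L: "\<Lambda> = cl ` kQ"
  by (auto simp: bq_algebra_def FactRing_def A_RCOSETS_defs cl_def a_r_coset_def r_coset_def)

lemma cl_L: "f \<in> kQ \<Longrightarrow> cl f \<in> \<Lambda>"
  by (simp add: carrier_L)

lemma L_E: assumes "X \<in> \<Lambda>" obtains f where "f \<in> kQ" "X = cl f"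
  using assms by (auto simp: carrier_L)

lemma zero_L: "\<o> = cl 0"
  by (simp add: bq_algebra_def FactRing_def cl_alt)

lemma add_L: "f \<in> kQ \<Longrightarrow> g \<in> kQ \<Longrightarrow> cl f \<boxplus> cl g = cl (f + g)"
  using I.a_rcos_sum[of f g] by (simp add: bq_algebra_def FactRing_def cl_def)

lemma mult_L: "f \<in> kQ \<Longrightarrow> g \<in> kQ \<Longrightarrow> cl f \<odot> cl g = cl (path_mult f g)"
  using I.rcoset_mult_add[of f g] by (simp add: bq_algebra_def FactRing_def cl_def)

lemma cl_zero_iff: "cl f = \<o> \<longleftrightarrow> f \<in> I"
  by (simp add: zero_L cl_eq_iff)

lemma smult_L: "f \<in> kQ \<Longrightarrow> c \<bullet> cl f = cl (scale c f)"
proof -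
  assume f: "f \<in> kQ"
  have "c \<bullet> cl f = (\<Union>g\<in>cl f. cl (scale c g))"
    by (simp add: coset_smult_def cl_def scale_def)
  \<comment> \<open>\<open>coset_smult\<close> is a union over all representatives of the coset.
    They contribute the same coset because I is closed under scalars.\<close>
  moreover have "cl (scale c g) = cl (scale c f)" if g: "g \<in> cl f" for g
  proof -
    obtain h where "h \<in> I" "g = h + f" using g by (auto simp: cl_alt)
    then show ?thesis by (simp add: cl_eq_iff scale_add I_scale)
  qed
  moreover have "f \<in> cl f" unfolding cl_alt by (metis I_zero add_0 imageI)
  ultimately show ?thesis by blast
qed

lemma smult_closed [simp]: "X \<in> \<Lambda> \<Longrightarrow> c \<bullet> X \<in> \<Lambda>"
  by (elim L_E) (simp add: smult_L cl_L kQ_scale[simplified])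

lemma smult_add_left: "X \<in> \<Lambda> \<Longrightarrow> (c + d) \<bullet> X = c \<bullet> X \<boxplus> d \<bullet> X"
  by (elim L_E) (use kQ_scale in \<open>simp add: smult_L add_L scale_add_left\<close>)

lemma smult_smult: "X \<in> \<Lambda> \<Longrightarrow> c \<bullet> (d \<bullet> X) = (c * d) \<bullet> X"
  by (elim L_E) (use kQ_scale in \<open>simp add: smult_L scale_scale\<close>)

lemma smult_one [simp]: "X \<in> \<Lambda> \<Longrightarrow> 1 \<bullet> X = X"
  by (elim L_E) (simp add: smult_L)

lemma smult_zero_left [simp]: "X \<in> \<Lambda> \<Longrightarrow> 0 \<bullet> X = \<o>"
  by (elim L_E) (simp add: smult_L zero_L)

lemma smult_zero [simp]: "c \<bullet> \<o> = \<o>"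
  by (simp add: smult_L zero_L)

lemma smult_inverse: "X \<in> \<Lambda> \<Longrightarrow> c \<noteq> 0 \<Longrightarrow> c \<bullet> X = Y \<Longrightarrow> X = inverse c \<bullet> Y"
  by (auto simp: smult_smult)

lemma smult_eq_zero: "X \<in> \<Lambda> \<Longrightarrow> c \<bullet> X = \<o> \<longleftrightarrow> c = 0 \<or> X = \<o>"
  using smult_inverse[of X c "\<o>"] by auto

lemma smult_mult_left: "X \<in> \<Lambda> \<Longrightarrow> Y \<in> \<Lambda> \<Longrightarrow> (c \<bullet> X) \<odot> Y = c \<bullet> (X \<odot> Y)"
proof (elim L_E)
  fix f g assume "f \<in> kQ" "g \<in> kQ" "X = cl f" "Y = cl g"
  then show ?thesis
    using kQ_mult[of f g] kQ_scale[of f c] by (simp add: smult_L mult_L path_mult_scale_left)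
qed

lemma smult_mult_right: "X \<in> \<Lambda> \<Longrightarrow> Y \<in> \<Lambda> \<Longrightarrow> X \<odot> (c \<bullet> Y) = c \<bullet> (X \<odot> Y)"
proof (elim L_E)
  fix f g assume "f \<in> kQ" "g \<in> kQ" "X = cl f" "Y = cl g"
  then show ?thesis
    using kQ_mult[of f g] kQ_scale[of g c] by (simp add: smult_L mult_L path_mult_scale_right)
qed

lemma finsum_L: "finite A \<Longrightarrow> (\<And>x. x \<in> A \<Longrightarrow> u x \<in> kQ) \<Longrightarrow> (\<Oplus>\<^bsub>bq_algebra Q I\<^esub>x\<in>A. cl (u x)) = cl (sum u A)"
proof (induction A rule: finite_induct)
  case (insert x A)
  then have "(\<lambda>x. cl (u x)) \<in> A \<rightarrow> \<Lambda>" "cl (u x) \<in> \<Lambda>" by (simp_all add: cl_L)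
  moreover have "sum u A \<in> kQ" using insert by (intro kQ_sum) simp
  ultimately show ?case using insert by (simp add: add_L)
qed (simp add: zero_L)

section \<open>Path classes and the hom-spaces between vertices\<close>

definition pcl :: "('v, 'a) path \<Rightarrow> (('v, 'a) path \<Rightarrow>\<^sub>0 'k) set" where
  "pcl k = cl (Poly_Mapping.single k 1)"

lemma pcl_closed [simp]: "k \<in> paths Q \<Longrightarrow> pcl k \<in> \<Lambda>"
  by (simp add: pcl_def cl_L)

lemma smult_pcl: "k \<in> paths Q \<Longrightarrow> c \<bullet> pcl k = cl (Poly_Mapping.single k c)"
  by (simp add: pcl_def smult_L)

lemma pcl_mult: "(x, p, y) \<in> paths Q \<Longrightarrow> (y', q, z) \<in> paths Q \<Longrightarrow>
    pcl (x, p, y) \<odot> pcl (y', q, z) = (if y = y' then pcl (x, p @ q, z) else \<o>)"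
  by (simp add: pcl_def mult_L path_mult_single zero_L)

lemma vertex_idem_pcl: "\<epsilon> x = pcl (x, [], x)"
  by (simp add: vertex_idem_def pcl_def cl_def)

lemma arrow_class_pcl: "arrow_class Q I a = pcl (tail Q a, [a], head Q a)"
  by (simp add: arrow_class_def arrow_def pcl_def cl_def)

lemma arrow_path: "a \<in> arcs Q \<Longrightarrow> (tail Q a, [a], head Q a) \<in> paths Q"
  using wf by (simp add: Cons_path wf_digraph.head_in_verts)

lemma idem_closed [simp]: "x \<in> verts Q \<Longrightarrow> \<epsilon> x \<in> \<Lambda>"
  by (simp add: vertex_idem_pcl)

lemma idem_mult: "x \<in> verts Q \<Longrightarrow> y \<in> verts Q \<Longrightarrow> \<epsilon> x \<odot> \<epsilon> y = (if x = y then \<epsilon> x else \<o>)"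
  by (simp add: vertex_idem_pcl pcl_mult)

lemma smult_pcl_nonzero:
  assumes "(x, p, y) \<in> paths Q" "length p < 2" "c \<noteq> 0"
  shows "c \<bullet> pcl (x, p, y) \<noteq> \<o>"
proof
  assume "c \<bullet> pcl (x, p, y) = \<o>"
  then have "Poly_Mapping.single (x, p, y) c \<in> I" using assms by (simp add: smult_pcl cl_zero_iff)
  then show False using I_long assms by (auto simp: long_paths_def)
qed

lemma idem_nonzero: "x \<in> verts Q \<Longrightarrow> \<epsilon> x \<noteq> \<o>"
  using smult_pcl_nonzero[of x "[]" x 1] by (simp add: vertex_idem_pcl)

lemma arrow_nonzero: "a \<in> arcs Q \<Longrightarrow> arrow_class Q I a \<noteq> \<o>"
  using smult_pcl_nonzero[OF arrow_path, of a 1] arrow_path[of a] by (simp add: arrow_class_pcl)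

lemma pcl_ne_idem:
  assumes "(x, p, y) \<in> paths Q" "p \<noteq> []" "w \<in> verts Q" "e \<noteq> 0"
  shows "c \<bullet> pcl (x, p, y) \<noteq> e \<bullet> \<epsilon> w"
proof
  assume "c \<bullet> pcl (x, p, y) = e \<bullet> \<epsilon> w"
  then have mem: "Poly_Mapping.single (x, p, y) c - Poly_Mapping.single (w, [], w) e \<in> I"
    using assms by (simp add: smult_pcl vertex_idem_pcl cl_eq_iff)
  have "(w, [], w) \<in> Poly_Mapping.keys (Poly_Mapping.single (x, p, y) c - Poly_Mapping.single (w, [], w) e)"
    using assms by (simp add: in_keys_iff lookup_minus lookup_single)
  then show False using mem I_long by (force simp: long_paths_def)
qed

text \<open>The unspecified middle factor of \<open>peirce\<close> is traded for two idempotent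
  equations, which pass directly to products and scalar multiples.\<close>

lemma hs_iff:
  assumes "x \<in> verts Q" "y \<in> verts Q"
  shows "X \<in> hs x y \<longleftrightarrow> X \<in> \<Lambda> \<and> \<epsilon> x \<odot> X = X \<and> X \<odot> \<epsilon> y = X"
proof
  assume "X \<in> hs x y"
  then obtain r where "r \<in> \<Lambda>" "X = \<epsilon> x \<odot> r \<odot> \<epsilon> y" by (auto simp: hom_space_def peirce_def)
  then show "X \<in> \<Lambda> \<and> \<epsilon> x \<odot> X = X \<and> X \<odot> \<epsilon> y = X"
    using assms by (simp add: L.m_assoc idem_mult) (simp add: L.m_assoc[symmetric] idem_mult)
next
  assume "X \<in> \<Lambda> \<and> \<epsilon> x \<odot> X = X \<and> X \<odot> \<epsilon> y = X"
  then show "X \<in> hs x y"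
    unfolding hom_space_def peirce_def by (metis (mono_tags, lifting) mem_Collect_eq)
qed

lemma hs_closed: "x \<in> verts Q \<Longrightarrow> y \<in> verts Q \<Longrightarrow> X \<in> hs x y \<Longrightarrow> X \<in> \<Lambda>"
  by (simp add: hs_iff)

lemma hs_mult: "x \<in> verts Q \<Longrightarrow> y \<in> verts Q \<Longrightarrow> z \<in> verts Q \<Longrightarrow> X \<in> hs x y \<Longrightarrow> Y \<in> hs y z \<Longrightarrow> X \<odot> Y \<in> hs x z"
  by (simp add: hs_iff L.m_assoc) (metis L.m_assoc idem_closed)

lemma hs_mult_zero:
  assumes "x \<in> verts Q" "y \<in> verts Q" "y' \<in> verts Q" "z \<in> verts Q" "X \<in> hs x y" "Y \<in> hs y' z" "y \<noteq> y'"
  shows "X \<odot> Y = \<o>"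
proof -
  have XY: "X \<in> \<Lambda>" "Y \<in> \<Lambda>" using assms hs_closed by blast+
  have "X \<odot> Y = (X \<odot> \<epsilon> y) \<odot> (\<epsilon> y' \<odot> Y)" using assms by (simp add: hs_iff)
  also have "\<dots> = X \<odot> (\<epsilon> y \<odot> \<epsilon> y') \<odot> Y"
    using XY idem_closed[OF assms(2)] idem_closed[OF assms(3)] by (simp add: L.m_assoc)
  also have "\<dots> = \<o>" using assms by (simp add: idem_mult hs_iff)
  finally show ?thesis .
qed

lemma hs_disjoint:
  assumes "x \<in> verts Q" "y \<in> verts Q" "x' \<in> verts Q" "y' \<in> verts Q" "X \<in> hs x y" "X \<in> hs x' y'" "X \<noteq> \<o>"
  shows "x = x'" "y = y'"
proof -
  have "X = \<epsilon> x \<odot> (\<epsilon> x' \<odot> X)" "X = (X \<odot> \<epsilon> y) \<odot> \<epsilon> y'" using assms by (simp_all add: hs_iff)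
  moreover have "X \<in> \<Lambda>" using assms hs_closed by blast
  ultimately have "X = (\<epsilon> x \<odot> \<epsilon> x') \<odot> X" "X = X \<odot> (\<epsilon> y \<odot> \<epsilon> y')"
    using assms(1-4) by (metis L.m_assoc idem_closed)+
  then show "x = x'" "y = y'" using assms by (auto simp: idem_mult hs_iff split: if_splits)
qed

lemma hs_smult: "x \<in> verts Q \<Longrightarrow> y \<in> verts Q \<Longrightarrow> X \<in> hs x y \<Longrightarrow> c \<bullet> X \<in> hs x y"
  by (simp add: hs_iff smult_mult_left smult_mult_right)

lemma hs_smult_iff: "x \<in> verts Q \<Longrightarrow> y \<in> verts Q \<Longrightarrow> X \<in> \<Lambda> \<Longrightarrow> c \<noteq> 0 \<Longrightarrow> c \<bullet> X \<in> hs x y \<longleftrightarrow> X \<in> hs x y"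
  using hs_smult smult_inverse by metis

lemma hs_zero: "x \<in> verts Q \<Longrightarrow> y \<in> verts Q \<Longrightarrow> \<o> \<in> hs x y"
  by (simp add: hs_iff)

lemma hs_idem: "x \<in> verts Q \<Longrightarrow> \<epsilon> x \<in> hs x x"
  by (simp add: hs_iff idem_mult)

lemma hs_pcl: "(x, p, y) \<in> paths Q \<Longrightarrow> pcl (x, p, y) \<in> hs x y"
  using path_ends[OF wf, of x p y] by (simp add: hs_iff vertex_idem_pcl pcl_mult)

lemma hs_arrow: "a \<in> arcs Q \<Longrightarrow> arrow_class Q I a \<in> hs (tail Q a) (head Q a)"
  by (simp add: arrow_class_pcl hs_pcl arrow_path)

section \<open>Linear combinations in the quotient\<close>

definition lc :: "((('v, 'a) path \<Rightarrow>\<^sub>0 'k) set \<Rightarrow>\<^sub>0 'k) \<Rightarrow> (('v, 'a) path \<Rightarrow>\<^sub>0 'k) set" where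
  "lc c = (\<Oplus>\<^bsub>bq_algebra Q I\<^esub> \<sigma>\<in>Poly_Mapping.keys c. Poly_Mapping.lookup c \<sigma> \<bullet> \<sigma>)"

lemma lc_superset:
  assumes "finite A" "Poly_Mapping.keys c \<subseteq> A" "A \<subseteq> \<Lambda>"
  shows "lc c = (\<Oplus>\<^bsub>bq_algebra Q I\<^esub> \<sigma>\<in>A. Poly_Mapping.lookup c \<sigma> \<bullet> \<sigma>)"
  unfolding lc_def
  by (rule L.add.finprod_mono_neutral_cong_left) (use assms in \<open>auto simp: in_keys_iff\<close>)

lemma lc_zero [simp]: "lc 0 = \<o>"
  by (simp add: lc_def)

lemma lc_single: "\<sigma> \<in> \<Lambda> \<Longrightarrow> lc (Poly_Mapping.single \<sigma> a) = a \<bullet> \<sigma>"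
  by (subst lc_superset[of "{\<sigma>}"]) simp_all

lemma lc_add:
  assumes "Poly_Mapping.keys c \<subseteq> \<Lambda>" "Poly_Mapping.keys d \<subseteq> \<Lambda>"
  shows "lc (c + d) = lc c \<boxplus> lc d"
proof -
  let ?A = "Poly_Mapping.keys c \<union> Poly_Mapping.keys d"
  have A: "finite ?A" "?A \<subseteq> \<Lambda>" using assms by auto
  have cd: "(\<lambda>\<sigma>. Poly_Mapping.lookup c \<sigma> \<bullet> \<sigma>) \<in> ?A \<rightarrow> \<Lambda>" "(\<lambda>\<sigma>. Poly_Mapping.lookup d \<sigma> \<bullet> \<sigma>) \<in> ?A \<rightarrow> \<Lambda>"
    using A by auto
  have "lc (c + d) = (\<Oplus>\<^bsub>bq_algebra Q I\<^esub> \<sigma>\<in>?A. Poly_Mapping.lookup (c + d) \<sigma> \<bullet> \<sigma>)"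
    by (rule lc_superset[OF A(1) keys_add A(2)])
  also have "\<dots> = (\<Oplus>\<^bsub>bq_algebra Q I\<^esub> \<sigma>\<in>?A. Poly_Mapping.lookup c \<sigma> \<bullet> \<sigma> \<boxplus> Poly_Mapping.lookup d \<sigma> \<bullet> \<sigma>)"
    by (rule L.finsum_cong') (use A in \<open>auto simp del: Un_iff simp: lookup_add subset_iff intro!: smult_add_left\<close>)
  also have "\<dots> = (\<Oplus>\<^bsub>bq_algebra Q I\<^esub> \<sigma>\<in>?A. Poly_Mapping.lookup c \<sigma> \<bullet> \<sigma>) \<boxplus>
      (\<Oplus>\<^bsub>bq_algebra Q I\<^esub> \<sigma>\<in>?A. Poly_Mapping.lookup d \<sigma> \<bullet> \<sigma>)"
    by (rule L.finsum_addf[OF cd])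
  also have "\<dots> = lc c \<boxplus> lc d"
    using lc_superset[OF A(1) Un_upper1 A(2)] lc_superset[OF A(1) Un_upper2 A(2)] by simp
  finally show ?thesis .
qed

lemma k_basis_lc:
  "k_basis Q I U B \<longleftrightarrow> B \<subseteq> U \<and> (\<forall>w\<in>U. \<exists>!c. Poly_Mapping.keys c \<subseteq> B \<and> w = lc c)"
  unfolding k_basis_def lc_def ..

end

section \<open>Semi-normed bases inside the algebra\<close>

context bound_path_algebra
begin

text \<open>The semi-normed bases of \<open>e\<^sub>W R e\<^sub>W\<close>, viewed inside \<open>R\<close>, where \<open>e\<^sub>W\<close> is the idempotent of
  the vertex set \<open>W\<close>.\<close>

definition snb :: "'v set \<Rightarrow> (('v, 'a) path \<Rightarrow>\<^sub>0 'k) set set \<Rightarrow> bool" where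
  "snb W B \<longleftrightarrow>
     B \<subseteq> (\<Union>x\<in>W. \<Union>y\<in>W. hs x y) \<and>
     (\<forall>x\<in>W. \<forall>y\<in>W. k_basis Q I (hs x y) (B \<inter> hs x y)) \<and>
     (\<forall>x\<in>W. \<epsilon> x \<in> B) \<and>
     (\<forall>a\<in>arcs (Q \<restriction> W). arrow_class Q I a \<in> B) \<and>
     (\<forall>\<sigma>\<in>B. \<forall>\<tau>\<in>B. \<sigma> \<odot> \<tau> = \<o> \<or> (\<exists>c \<rho>. c \<noteq> 0 \<and> \<rho> \<in> B \<and> \<sigma> \<odot> \<tau> = c \<bullet> \<rho>))"

lemma induce_verts: "Q \<restriction> verts Q = Q"
  using wf by (cases Q) (auto simp: induce_subgraph_def wf_digraph_def)

lemma semi_normed_basis_snb: "semi_normed_basis Q I B \<longleftrightarrow> snb (verts Q) B"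
  by (simp add: semi_normed_basis_def snb_def induce_verts)

lemma paths_induce:
  assumes "W \<subseteq> verts Q" "(x, p, y) \<in> paths (Q \<restriction> W)"
  shows "(x, p, y) \<in> paths Q" "x \<in> W" "y \<in> W"
proof -
  have wf': "wf_digraph (Q \<restriction> W)" using wf by (rule wf_digraph.wellformed_induce_subgraph)
  show "(x, p, y) \<in> paths Q"
    using assms(2)
    by (induction p arbitrary: x) (use assms(1) wf wf' in \<open>auto simp: Cons_path\<close>)
  show "x \<in> W" "y \<in> W" using path_ends[OF wf' assms(2)] by simp_all
qed

lemma paths_induce_mono:
  assumes "U \<subseteq> W" "(x, p, y) \<in> paths (Q \<restriction> U)" shows "(x, p, y) \<in> paths (Q \<restriction> W)"
proof -
  have "wf_digraph (Q \<restriction> U)" "wf_digraph (Q \<restriction> W)"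
    using wf by (auto intro: wf_digraph.wellformed_induce_subgraph)
  then show ?thesis
    using assms(2) by (induction p arbitrary: x) (use assms(1) in \<open>auto simp: Cons_path\<close>)
qed

lemma snb_E:
  assumes "snb W B" "\<sigma> \<in> B" obtains x y where "x \<in> W" "y \<in> W" "\<sigma> \<in> hs x y"
  using assms unfolding snb_def by blast

lemma snb_k_basis: "snb W B \<Longrightarrow> x \<in> W \<Longrightarrow> y \<in> W \<Longrightarrow> k_basis Q I (hs x y) (B \<inter> hs x y)"
  by (simp add: snb_def)

lemma snb_idem: "snb W B \<Longrightarrow> x \<in> W \<Longrightarrow> \<epsilon> x \<in> B"
  by (simp add: snb_def)

lemma snb_arrow: "snb W B \<Longrightarrow> a \<in> arcs (Q \<restriction> W) \<Longrightarrow> arrow_class Q I a \<in> B"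
  unfolding snb_def by blast

lemma snb_closed: "snb W B \<Longrightarrow> W \<subseteq> verts Q \<Longrightarrow> \<sigma> \<in> B \<Longrightarrow> \<sigma> \<in> \<Lambda>"
  by (elim snb_E) (auto intro: hs_closed)

lemma snb_unique:
  assumes "snb W B" "x \<in> W" "y \<in> W" "Poly_Mapping.keys c \<subseteq> B \<inter> hs x y"
    "Poly_Mapping.keys d \<subseteq> B \<inter> hs x y" "lc c = lc d" "lc c \<in> hs x y"
  shows "c = d"
  using assms unfolding snb_def k_basis_lc by metis

text \<open>A zero basis element would give the zero vector two expansions, the empty one and the
  one with coefficient 1.\<close>

lemma snb_nonzero:
  assumes B: "snb W B" and W: "W \<subseteq> verts Q" and \<sigma>: "\<sigma> \<in> B" shows "\<sigma> \<noteq> \<o>"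
proof
  assume z: "\<sigma> = \<o>"
  obtain x y where xy: "x \<in> W" "y \<in> W" "\<sigma> \<in> hs x y" using snb_E[OF B \<sigma>] .
  have "Poly_Mapping.single \<sigma> 1 = (0 :: _ \<Rightarrow>\<^sub>0 'k)"
    by (rule snb_unique[OF B xy(1,2)])
      (use xy \<sigma> z W in \<open>auto simp: lc_single intro: hs_zero\<close>)
  then show False by (metis keys_single keys_zero one_neq_zero insert_not_empty)
qed

lemma snb_ends:
  assumes B: "snb W B" "W \<subseteq> verts Q" "\<sigma> \<in> B" and xy: "\<sigma> \<in> hs x y" "x \<in> verts Q" "y \<in> verts Q"
  shows "x \<in> W" "y \<in> W"
proof -
  obtain u v where uv: "u \<in> W" "v \<in> W" "\<sigma> \<in> hs u v" using snb_E[OF B(1,3)] .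
  then have "u \<in> verts Q" "v \<in> verts Q" using B(2) by auto
  from hs_disjoint[OF xy(2,3) this xy(1) uv(3) snb_nonzero[OF B]] uv
  show "x \<in> W" "y \<in> W" by simp_all
qed

text \<open>Both sides expand the same vector of one hom-space, so uniqueness of coordinates
  applies. This makes the definite description in \<open>basis_prod\<close> meaningful.\<close>

lemma snb_smult_unique:
  assumes B: "snb W B" and W: "W \<subseteq> verts Q" and st: "\<sigma> \<in> B" "\<tau> \<in> B" "c \<bullet> \<sigma> = d \<bullet> \<tau>" "c \<noteq> 0"
  shows "\<sigma> = \<tau>" "c = d"
proof -
  obtain x y where xy: "x \<in> W" "y \<in> W" "\<sigma> \<in> hs x y" using snb_E[OF B st(1)] .
  have V: "x \<in> verts Q" "y \<in> verts Q" using W xy by auto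
  have L: "\<sigma> \<in> \<Lambda>" "\<tau> \<in> \<Lambda>" using snb_closed[OF B W] st by auto
  have nz: "c \<bullet> \<sigma> \<noteq> \<o>" using snb_nonzero[OF B W st(1)] L(1) st(4) smult_eq_zero by blast
  then have d: "d \<noteq> 0" using st(3) smult_zero_left[OF L(2)] by metis
  have mem: "c \<bullet> \<sigma> \<in> hs x y" using xy V hs_smult by blast
  then have "\<tau> \<in> hs x y" using hs_smult_iff[OF V L(2) d] st by simp
  then have "Poly_Mapping.single \<sigma> c = Poly_Mapping.single \<tau> d"
    using st xy L mem by (intro snb_unique[OF B xy(1,2)]) (auto simp: lc_single)
  then have "Poly_Mapping.keys (Poly_Mapping.single \<sigma> c) = Poly_Mapping.keys (Poly_Mapping.single \<tau> d)"
    and l: "Poly_Mapping.lookup (Poly_Mapping.single \<sigma> c) \<sigma> = Poly_Mapping.lookup (Poly_Mapping.single \<tau> d) \<sigma>"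
    by simp_all
  then show "\<sigma> = \<tau>" using st(4) d by simp
  then show "c = d" using l by simp
qed

lemma snb_product:
  assumes "snb W B" "\<sigma> \<in> B" "\<tau> \<in> B" "\<sigma> \<odot> \<tau> \<noteq> \<o>"
  obtains c \<rho> where "c \<noteq> 0" "\<rho> \<in> B" "\<sigma> \<odot> \<tau> = c \<bullet> \<rho>"
  using assms unfolding snb_def by blast

text \<open>Induction on the path from its first arrow: stationary idempotents and arrow classes are
  in \<open>B\<close>, and multiplying an element of \<open>B\<close> by an arrow class gives zero
  or a nonzero multiple of an element of \<open>B\<close>.\<close>

lemma snb_path:
  assumes B: "snb W B" and W: "W \<subseteq> verts Q" and p: "(x, p, y) \<in> paths (Q \<restriction> W)"
  shows "pcl (x, p, y) = \<o> \<or> (\<exists>c b. c \<noteq> 0 \<and> b \<in> B \<and> pcl (x, p, y) = c \<bullet> b)"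
  using p
proof (induction p arbitrary: x)
  case Nil
  then have "x = y" "x \<in> W" by auto
  moreover from this have "pcl (x, [], y) \<in> B" using B by (simp add: snb_def vertex_idem_pcl)
  ultimately show ?case
    using snb_closed[OF B W] smult_one by (metis one_neq_zero)
next
  case (Cons a p)
  have wf': "wf_digraph (Q \<restriction> W)" using wf by (rule wf_digraph.wellformed_induce_subgraph)
  have a: "a \<in> arcs (Q \<restriction> W)" "x = tail Q a" and p: "(head Q a, p, y) \<in> paths (Q \<restriction> W)"
    using Cons.prems wf' by (simp_all add: Cons_path)
  have aB: "arrow_class Q I a \<in> B" using B a unfolding snb_def by blast
  have eq: "pcl (x, a # p, y) = arrow_class Q I a \<odot> pcl (head Q a, p, y)"
    using a paths_induce(1)[OF W p] arrow_path[of a] by (simp add: arrow_class_pcl pcl_mult)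
  from Cons.IH[OF p] show ?case
  proof (elim disjE exE conjE)
    assume "pcl (head Q a, p, y) = \<o>"
    then show ?case using eq snb_closed[OF B W aB] by simp
  next
    fix c b assume b: "c \<noteq> 0" "b \<in> B" "pcl (head Q a, p, y) = c \<bullet> b"
    have L: "b \<in> \<Lambda>" "arrow_class Q I a \<in> \<Lambda>" using snb_closed[OF B W] b aB by auto
    have eq2: "pcl (x, a # p, y) = c \<bullet> (arrow_class Q I a \<odot> b)"
      using eq b L by (simp add: smult_mult_right)
    show ?case
    proof (cases "arrow_class Q I a \<odot> b = \<o>")
      case True then show ?thesis using eq2 by simp
    next
      case False
      then obtain d \<rho> where "d \<noteq> 0" "\<rho> \<in> B" "arrow_class Q I a \<odot> b = d \<bullet> \<rho>"
        using snb_product[OF B aB b(2)] by blast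
      moreover from this have "pcl (x, a # p, y) = (c * d) \<bullet> \<rho>"
        using eq2 snb_closed[OF B W] by (simp add: smult_smult)
      ultimately show ?thesis using b(1) by (metis mult_eq_0_iff)
    qed
  qed
qed

text \<open>Carries the term-by-term induction to cosets. The monomials are those of one chosen
  representative, so it may be taken with paths in a subquiver.\<close>

lemma cl_induct:
  assumes "f \<in> kQ" and zero: "P \<o>"
    and single: "\<And>k. k \<in> Poly_Mapping.keys f \<Longrightarrow> P (Poly_Mapping.lookup f k \<bullet> pcl k)"
    and add: "\<And>X Y. X \<in> \<Lambda> \<Longrightarrow> Y \<in> \<Lambda> \<Longrightarrow> P X \<Longrightarrow> P Y \<Longrightarrow> P (X \<boxplus> Y)"
  shows "P (cl f)"
proof -
  have "f \<in> kQ \<and> P (cl f)"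
  proof (induction f rule: poly_mapping_additive_induct)
    case zero then show ?case using assms(2) by (simp add: zero_L)
  next
    case (single k)
    then have "k \<in> paths Q" using assms(1) by auto
    then show ?case using assms(3)[OF single] by (simp add: smult_pcl)
  next
    case (add g h)
    then have "P (cl g \<boxplus> cl h)" using assms(4) cl_L by blast
    then show ?case using add kQ_add add_L by metis
  qed
  then show ?thesis by simp
qed

text \<open>Were \<sigma> on the line of no such path, each path from \<open>x\<close> to
  \<open>y\<close> occurring in a representative of \<sigma> would lie on the line of another basis
  element, and \<sigma> would be a combination of the others. The subset \<open>W'\<close> of
  \<open>W\<close> may be smaller: to compare two bases of different corners, the path has to run in
  their common part.\<close>

lemma snb_line:
  assumes B: "snb W B" and W: "W' \<subseteq> W" "W \<subseteq> verts Q" and xy: "x \<in> W'" "y \<in> W'"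
    and span: "hs x y \<subseteq> cl ` carrier (path_algebra (Q \<restriction> W'))" and \<sigma>: "\<sigma> \<in> B \<inter> hs x y"
  obtains p c where "(x, p, y) \<in> paths (Q \<restriction> W')" "c \<noteq> 0" "\<sigma> = c \<bullet> pcl (x, p, y)"
proof (rule ccontr)
  assume no: "\<not> thesis"
  have W': "W' \<subseteq> verts Q" using W by simp
  have V: "x \<in> verts Q" "y \<in> verts Q" "x \<in> W" "y \<in> W" using xy W by auto
  obtain f where f: "Poly_Mapping.keys f \<subseteq> paths (Q \<restriction> W')" "\<sigma> = cl f"
    using span \<sigma> by auto
  have fQ: "f \<in> kQ" using f(1) paths_induce(1)[OF W'] by auto
  \<comment> \<open>\<open>T X\<close>: after cutting down to the hom-space from \<open>x\<close> to
    \<open>y\<close>, \<open>X\<close> lies in the span of the basis elements other than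
    \<sigma>.\<close>
  define T where "T X \<longleftrightarrow> (\<exists>c. Poly_Mapping.keys c \<subseteq> B \<inter> hs x y - {\<sigma>} \<and> \<epsilon> x \<odot> X \<odot> \<epsilon> y = lc c)" for X
  have T0: "T \<o>" unfolding T_def using V by (intro exI[of _ 0]) simp
  have "T (cl f)"
  proof (rule cl_induct[OF fQ])
    fix X Y assume XY: "X \<in> \<Lambda>" "Y \<in> \<Lambda>" "T X" "T Y"
    then obtain c d where "Poly_Mapping.keys c \<subseteq> B \<inter> hs x y - {\<sigma>}" "\<epsilon> x \<odot> X \<odot> \<epsilon> y = lc c"
      "Poly_Mapping.keys d \<subseteq> B \<inter> hs x y - {\<sigma>}" "\<epsilon> x \<odot> Y \<odot> \<epsilon> y = lc d"
      unfolding T_def by blast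
    moreover from this have "lc (c + d) = lc c \<boxplus> lc d"
      using snb_closed[OF B W(2)] by (intro lc_add) blast+
    ultimately show "T (X \<boxplus> Y)"
      unfolding T_def using keys_add[of c d] XY V
      by (intro exI[of _ "c + d"]) (auto simp: L.l_distr L.r_distr)
  next
    fix k assume k: "k \<in> Poly_Mapping.keys f"
    obtain u p v where upv: "k = (u, p, v)" by (cases k)
    let ?a = "Poly_Mapping.lookup f k"
    have a: "?a \<noteq> 0" using k by (simp add: in_keys_iff)
    have pW': "(u, p, v) \<in> paths (Q \<restriction> W')" using k f upv by blast
    have pQ: "(u, p, v) \<in> paths Q" using paths_induce(1)[OF W' pW'] .
    have pW: "(u, p, v) \<in> paths (Q \<restriction> W)"
      using paths_induce_mono[OF W(1) pW'] .
    have uv: "u \<in> verts Q" "v \<in> verts Q" using path_ends[OF wf pQ] by auto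
    show "T (?a \<bullet> pcl k)"
    proof (cases "u = x \<and> v = y \<and> pcl k \<noteq> \<o>")
      case True
      then obtain c b where b: "c \<noteq> 0" "b \<in> B" "pcl k = c \<bullet> b"
        using snb_path[OF B W(2) pW] upv by auto
      have bL: "b \<in> \<Lambda>" using snb_closed[OF B W(2)] b by simp
      have mem: "pcl k \<in> hs x y" using hs_pcl[OF pQ] True upv by simp
      then have bh: "b \<in> hs x y" using hs_smult_iff[OF V(1,2) bL b(1)] b(3) by simp
      \<comment> \<open>Inverting \<open>c\<close> would otherwise exhibit \<sigma> as a multiple of
        a path class inside \<open>W'\<close>, which is excluded by assumption.\<close>
      have "b \<noteq> \<sigma>"
      proof
        assume "b = \<sigma>"
        then have "\<sigma> = inverse c \<bullet> pcl (x, p, y)" using b bL smult_inverse[OF bL b(1)] True upv by simp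
        then show False using no that[of p "inverse c"] pW' True b(1) by simp
      qed
      moreover have "\<epsilon> x \<odot> (?a \<bullet> pcl k) \<odot> \<epsilon> y = lc (Poly_Mapping.single b (?a * c))"
      proof -
        have "\<epsilon> x \<odot> (?a \<bullet> pcl k) \<odot> \<epsilon> y = ?a \<bullet> pcl k"
          using hs_smult[OF V(1,2) mem, of ?a] V by (simp add: hs_iff)
        then show ?thesis using b bL by (simp add: lc_single smult_smult)
      qed
      ultimately show ?thesis
        unfolding T_def using b bh by (intro exI[of _ "Poly_Mapping.single b (?a * c)"]) simp
    next
      case False
      have "\<epsilon> x \<odot> pcl k \<odot> \<epsilon> y = \<o>"
      proof (cases "pcl k = \<o>")
        case False
        then have "u \<noteq> x \<or> v \<noteq> y" using \<open>\<not> (u = x \<and> v = y \<and> pcl k \<noteq> \<o>)\<close> by blast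
        then show ?thesis
          using pQ V uv by (auto simp: vertex_idem_pcl upv pcl_mult split: if_splits)
      qed (use V in simp)
      then have "\<epsilon> x \<odot> (?a \<bullet> pcl k) \<odot> \<epsilon> y = \<o>"
        using pQ upv V by (simp add: smult_mult_left smult_mult_right)
      then show ?thesis unfolding T_def by (intro exI[of _ 0]) simp
    qed
  qed (rule T0)
  moreover have "\<epsilon> x \<odot> \<sigma> \<odot> \<epsilon> y = \<sigma>" using \<sigma> V by (simp add: hs_iff)
  ultimately obtain c where c: "Poly_Mapping.keys c \<subseteq> B \<inter> hs x y - {\<sigma>}" "\<sigma> = lc c"
    unfolding T_def f by auto
  have "\<sigma> \<in> \<Lambda>" using snb_closed[OF B W(2)] \<sigma> by blast
  \<comment> \<open>Two expansions of \<sigma>, one of which avoids \<sigma>.\<close>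
  then have "Poly_Mapping.single \<sigma> 1 = c"
    using c \<sigma> by (intro snb_unique[OF B V(3,4)]) (auto simp: lc_single)
  then show False using c(1) by auto
qed

end

section \<open>The chain complex of a semi-normed basis\<close>

locale semi_normed_algebra = bound_path_algebra Q I
  for Q :: "('v, 'a) pre_digraph" and I :: "(('v, 'a) path \<Rightarrow>\<^sub>0 'k::field) set" +
  fixes B
  assumes basis: "semi_normed_basis Q I B"
begin

lemmas basis_snb = basis[unfolded semi_normed_basis_snb]
lemmas basis_closed [simp] = snb_closed[OF basis_snb order_refl]
lemmas basis_nonzero = snb_nonzero[OF basis_snb order_refl]
lemmas basis_smult_unique = snb_smult_unique[OF basis_snb order_refl]
lemmas basis_product = snb_product[OF basis_snb]

section \<open>Sources, targets and products of basis elements\<close>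

abbreviation bp where "bp \<equiv> basis_prod Q I B"
abbreviation sr where "sr \<equiv> src Q I"
abbreviation tg where "tg \<equiv> tgt Q I"

lemma src_tgt_eq:
  assumes "x \<in> verts Q" "y \<in> verts Q" "\<sigma> \<in> hs x y" "\<sigma> \<noteq> \<o>"
  shows "sr \<sigma> = x" "tg \<sigma> = y"
proof -
  have "x' = x \<and> y' = y" if "x' \<in> verts Q" "y' \<in> verts Q" "\<sigma> \<in> hs x' y'" for x' y'
    using hs_disjoint[OF that(1,2) assms(1,2) that(3) assms(3,4)] by simp
  then show "sr \<sigma> = x" "tg \<sigma> = y"
    unfolding src_def tgt_def using assms(1-3) by (intro the_equality; blast)+
qed

lemma src_tgt:
  assumes "\<sigma> \<in> B" shows "sr \<sigma> \<in> verts Q" "tg \<sigma> \<in> verts Q" "\<sigma> \<in> hs (sr \<sigma>) (tg \<sigma>)"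
  using snb_E[OF basis_snb assms] src_tgt_eq basis_nonzero[OF assms] by metis+

lemma bp_eq:
  assumes "\<rho> \<in> B" "c \<noteq> 0" "\<sigma> \<odot> \<tau> = c \<bullet> \<rho>" shows "bp \<sigma> \<tau> = \<rho>"
  unfolding basis_prod_def
proof (rule the_equality)
  fix \<rho>' assume "\<rho>' \<in> B \<and> (\<exists>c. c \<noteq> 0 \<and> \<sigma> \<odot> \<tau> = c \<bullet> \<rho>')"
  then show "\<rho>' = \<rho>" using assms basis_smult_unique(1) by metis
qed (use assms in blast)

lemma bp:
  assumes "\<sigma> \<in> B" "\<tau> \<in> B" "\<sigma> \<odot> \<tau> \<noteq> \<o>"
  obtains c where "bp \<sigma> \<tau> \<in> B" "c \<noteq> 0" "\<sigma> \<odot> \<tau> = c \<bullet> bp \<sigma> \<tau>"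
  using basis_product[OF assms] bp_eq by metis

lemma tgt_eq_src:
  assumes "\<sigma> \<in> B" "\<tau> \<in> B" "\<sigma> \<odot> \<tau> \<noteq> \<o>" shows "tg \<sigma> = sr \<tau>"
  using hs_mult_zero[OF src_tgt(1,2)[OF assms(1)] src_tgt(1,2)[OF assms(2)]
      src_tgt(3)[OF assms(1)] src_tgt(3)[OF assms(2)]] assms(3) by blast

lemma src_tgt_bp:
  assumes "\<sigma> \<in> B" "\<tau> \<in> B" "\<sigma> \<odot> \<tau> \<noteq> \<o>"
  shows "sr (bp \<sigma> \<tau>) = sr \<sigma>" "tg (bp \<sigma> \<tau>) = tg \<tau>"
proof -
  obtain c where c: "bp \<sigma> \<tau> \<in> B" "c \<noteq> 0" "\<sigma> \<odot> \<tau> = c \<bullet> bp \<sigma> \<tau>" using bp[OF assms] .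
  have v: "sr \<sigma> \<in> verts Q" "tg \<sigma> \<in> verts Q" "tg \<tau> \<in> verts Q" using assms src_tgt by auto
  have "\<sigma> \<odot> \<tau> \<in> hs (sr \<sigma>) (tg \<tau>)"
    using hs_mult[OF v, of \<sigma> \<tau>] src_tgt(3) assms(1,2) tgt_eq_src[OF assms] by metis
  then have mem: "bp \<sigma> \<tau> \<in> hs (sr \<sigma>) (tg \<tau>)"
    using hs_smult_iff[OF v(1,3) basis_closed[OF c(1)] c(2)] c(3) by simp
  show "sr (bp \<sigma> \<tau>) = sr \<sigma>" "tg (bp \<sigma> \<tau>) = tg \<tau>"
    by (rule src_tgt_eq[OF v(1,3) mem basis_nonzero[OF c(1)]])+
qed

text \<open>Both sides are the basis element on the line of the nonzero triple product.
  \<open>bp\<close> forgets the scalars, so they need not satisfy any cocycle identity for this to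
  be an equality.\<close>

lemma bp_assoc:
  assumes B: "\<sigma> \<in> B" "\<tau> \<in> B" "\<rho> \<in> B" and nz: "\<sigma> \<odot> \<tau> \<odot> \<rho> \<noteq> \<o>"
  shows "bp (bp \<sigma> \<tau>) \<rho> = bp \<sigma> (bp \<tau> \<rho>)"
proof -
  have as: "\<sigma> \<odot> \<tau> \<odot> \<rho> = \<sigma> \<odot> (\<tau> \<odot> \<rho>)" using B by (simp add: L.m_assoc)
  have nz1: "\<sigma> \<odot> \<tau> \<noteq> \<o>" using nz L.l_null[OF basis_closed[OF B(3)]] by metis
  have nz2: "\<tau> \<odot> \<rho> \<noteq> \<o>" using nz as L.r_null[OF basis_closed[OF B(1)]] by metis
  obtain c where c: "bp \<sigma> \<tau> \<in> B" "c \<noteq> 0" "\<sigma> \<odot> \<tau> = c \<bullet> bp \<sigma> \<tau>" using bp[OF B(1,2) nz1] .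
  obtain d where d: "bp \<tau> \<rho> \<in> B" "d \<noteq> 0" "\<tau> \<odot> \<rho> = d \<bullet> bp \<tau> \<rho>" using bp[OF B(2,3) nz2] .
  have 1: "\<sigma> \<odot> \<tau> \<odot> \<rho> = c \<bullet> (bp \<sigma> \<tau> \<odot> \<rho>)" using B c by (simp add: smult_mult_left)
  have 2: "\<sigma> \<odot> \<tau> \<odot> \<rho> = d \<bullet> (\<sigma> \<odot> bp \<tau> \<rho>)" unfolding as using B d by (simp add: smult_mult_right)
  have nz3: "\<sigma> \<odot> bp \<tau> \<rho> \<noteq> \<o>" using 2 nz smult_zero by metis
  obtain e where e: "bp \<sigma> (bp \<tau> \<rho>) \<in> B" "e \<noteq> 0" "\<sigma> \<odot> bp \<tau> \<rho> = e \<bullet> bp \<sigma> (bp \<tau> \<rho>)"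
    using bp[OF B(1) d(1) nz3] .
  have "bp \<sigma> \<tau> \<odot> \<rho> \<in> \<Lambda>" using B c by simp
  then have "bp \<sigma> \<tau> \<odot> \<rho> = inverse c \<bullet> (d \<bullet> (\<sigma> \<odot> bp \<tau> \<rho>))"
    using smult_inverse c(2) 1 2 by metis
  also have "\<dots> = (inverse c * (d * e)) \<bullet> bp \<sigma> (bp \<tau> \<rho>)" using e by (simp add: smult_smult)
  finally show ?thesis by (intro bp_eq[OF e(1)]) (use c d e in simp_all)
qed

definition nonidem where "nonidem = B - \<epsilon> ` verts Q"

text \<open>\<open>snb_line\<close> on the whole quiver supplies a path; if it were stationary,
  \<sigma> would be proportional to a stationary idempotent of the basis and hence equal to
  it.\<close>

lemma nonidem_path:
  assumes "\<sigma> \<in> nonidem"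
  obtains x p y c where "(x, p, y) \<in> paths Q" "p \<noteq> []" "c \<noteq> 0" "\<sigma> = c \<bullet> pcl (x, p, y)"
proof -
  have \<sigma>: "\<sigma> \<in> B" using assms by (simp add: nonidem_def)
  note v = src_tgt[OF \<sigma>]
  have "hs (sr \<sigma>) (tg \<sigma>) \<subseteq> cl ` carrier (path_algebra (Q \<restriction> verts Q))"
    using hs_closed[OF v(1,2)] by (auto simp: induce_verts carrier_L[symmetric])
  from snb_line[OF basis_snb order_refl order_refl v(1,2) this, of \<sigma>] \<sigma> v(3)
  obtain p c where pc: "(sr \<sigma>, p, tg \<sigma>) \<in> paths Q" "c \<noteq> 0" "\<sigma> = c \<bullet> pcl (sr \<sigma>, p, tg \<sigma>)"
    by (auto simp: induce_verts)
  have "p \<noteq> []"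
  proof
    assume "p = []"
    then have "sr \<sigma> = tg \<sigma>" using pc(1) by simp
    then have "\<sigma> = c \<bullet> \<epsilon> (sr \<sigma>)" using pc(3) \<open>p = []\<close> by (simp add: vertex_idem_pcl)
    then have "1 \<bullet> \<sigma> = c \<bullet> \<epsilon> (sr \<sigma>)" using smult_one[OF basis_closed[OF \<sigma>]] by simp
    moreover have "\<epsilon> (sr \<sigma>) \<in> B" using basis_snb v(1) by (simp add: snb_def)
    ultimately have "\<sigma> = \<epsilon> (sr \<sigma>)" using basis_smult_unique(1)[OF \<sigma> _ _ one_neq_zero] by metis
    then show False using assms v(1) by (auto simp: nonidem_def)
  qed
  then show ?thesis using that pc by blast
qed

text \<open>Keeps inner faces among the generators: the concatenation of nonempty paths is nonempty,
  and \<open>pcl_ne_idem\<close> separates its class from every multiple of a stationary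
  idempotent.\<close>

lemma bp_nonidem:
  assumes "\<sigma> \<in> nonidem" "\<tau> \<in> nonidem" "\<sigma> \<odot> \<tau> \<noteq> \<o>" shows "bp \<sigma> \<tau> \<in> nonidem"
proof -
  have B: "\<sigma> \<in> B" "\<tau> \<in> B" using assms by (auto simp: nonidem_def)
  obtain e where e: "bp \<sigma> \<tau> \<in> B" "e \<noteq> 0" "\<sigma> \<odot> \<tau> = e \<bullet> bp \<sigma> \<tau>" using bp[OF B assms(3)] .
  obtain x p y c where p: "(x, p, y) \<in> paths Q" "p \<noteq> []" "\<sigma> = c \<bullet> pcl (x, p, y)"
    using nonidem_path[OF assms(1)] by metis
  obtain y' q z d where q: "(y', q, z) \<in> paths Q" "\<tau> = d \<bullet> pcl (y', q, z)"
    using nonidem_path[OF assms(2)] by metis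
  have prod: "\<sigma> \<odot> \<tau> = (c * d) \<bullet> (pcl (x, p, y) \<odot> pcl (y', q, z))"
    using p q by (simp add: smult_mult_left smult_mult_right smult_smult mult.commute)
  have "y = y'" using prod assms(3) p q smult_zero by (metis pcl_mult)
  then have prod: "\<sigma> \<odot> \<tau> = (c * d) \<bullet> pcl (x, p @ q, z)" using prod p q by (simp add: pcl_mult)
  have pq: "(x, p @ q, z) \<in> paths Q" using p q \<open>y = y'\<close> append_path[OF wf] by blast
  have "bp \<sigma> \<tau> \<noteq> \<epsilon> w" if w: "w \<in> verts Q" for w
    using pcl_ne_idem[OF pq _ w e(2), of "c * d"] prod e(3) p(2) by (metis append_is_Nil_conv)
  then show ?thesis using e(1) unfolding nonidem_def by blast
qed

section \<open>Tuples with nonzero product and their faces\<close>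

abbreviation prodl where "prodl xs \<equiv> foldr lmult xs \<one>\<^bsub>bq_algebra Q I\<^esub>"

lemma prodl_closed: "set xs \<subseteq> \<Lambda> \<Longrightarrow> prodl xs \<in> \<Lambda>"
  by (induction xs) auto

lemma prodl_append: "set xs \<subseteq> \<Lambda> \<Longrightarrow> set ys \<subseteq> \<Lambda> \<Longrightarrow> prodl (xs @ ys) = prodl xs \<odot> prodl ys"
  by (induction xs) (auto simp: L.m_assoc prodl_closed)

lemma prodl_append_nonzero:
  "set xs \<subseteq> \<Lambda> \<Longrightarrow> set ys \<subseteq> \<Lambda> \<Longrightarrow> prodl (xs @ ys) \<noteq> \<o> \<Longrightarrow> prodl xs \<noteq> \<o> \<and> prodl ys \<noteq> \<o>"
  using prodl_closed[of xs] prodl_closed[of ys] L.l_null L.r_null by (metis prodl_append)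

text \<open>The condition on simplices of degree at least 2, freed from the degree so that it passes
  to sublists and faces. In length 1 it is stricter than \<open>S 1\<close>, which admits stationary
  idempotents.\<close>

definition chainl where "chainl xs \<longleftrightarrow> set xs \<subseteq> nonidem \<and> prodl xs \<noteq> \<o>"

lemma nonidem_closed: "nonidem \<subseteq> \<Lambda>" "nonidem \<subseteq> B"
  by (auto simp: nonidem_def)

lemma chainl_append: "chainl (xs @ ys) \<Longrightarrow> chainl xs \<and> chainl ys"
  using prodl_append_nonzero[of xs ys] nonidem_closed by (auto simp: chainl_def)

text \<open>One formula for all faces: index 0 drops the first entry, index \<open>length xs\<close>
  drops the last, and the indices between them agree with \<open>sc_face\<close>. The simplicial
  identities can then be checked entry by entry.\<close>

definition mface where
  "mface j xs = map (\<lambda>k. if k + 1 < j then xs ! k else if k + 1 = j then bp (xs ! k) (xs ! (k + 1))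
     else xs ! (k + 1)) [0..<length xs - 1]"

lemma length_mface [simp]: "length (mface j xs) = length xs - 1"
  by (simp add: mface_def)

lemma nth_mface: "k < length xs - 1 \<Longrightarrow> mface j xs ! k =
    (if k + 1 < j then xs ! k else if k + 1 = j then bp (xs ! k) (xs ! (k + 1)) else xs ! (k + 1))"
  by (simp add: mface_def)

lemma mface_0: "mface 0 xs = tl xs"
  by (rule nth_equalityI) (simp_all add: nth_mface nth_tl)

lemma mface_length: "mface (length xs) xs = butlast xs"
  by (rule nth_equalityI) (auto simp: nth_mface nth_butlast)

lemma mface_inner: "1 \<le> j \<Longrightarrow> j < length xs \<Longrightarrow> mface j xs = sc_face Q I B j xs"
  by (rule nth_equalityI) (auto simp: nth_mface sc_face_def nth_append min_def nth_Cons')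

text \<open>An outer face is a sublist of a tuple with nonzero product. An inner face merges two
  neighbours and changes the product by a nonzero scalar only.\<close>

lemma chainl_mface:
  assumes xs: "chainl xs" "j \<le> length xs" shows "chainl (mface j xs)"
proof -
  consider "j = 0" | "j = length xs" | "1 \<le> j" "j < length xs" using assms(2) by linarith
  then show ?thesis
  proof cases
    case 1
    have "chainl (take 1 xs @ drop 1 xs)" using xs by simp
    then show ?thesis using 1 chainl_append by (metis mface_0 drop_Suc drop_0 One_nat_def)
  next
    case 2
    have "chainl (take (length xs - 1) xs @ drop (length xs - 1) xs)" using xs by simp
    then show ?thesis using 2 chainl_append by (metis mface_length butlast_conv_take)
  next
    case 3
    let ?ys = "take (j - 1) xs" and ?zs = "drop (j + 1) xs" and ?a = "xs ! (j - 1)" and ?b = "xs ! j"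
    have eq: "xs = ?ys @ [?a, ?b] @ ?zs"
      using 3 by (metis Cons_nth_drop_Suc One_nat_def Suc_eq_plus1 Suc_pred append_Cons append_Nil
          append_take_drop_id less_imp_diff_less less_le_trans zero_less_one)
    then have "chainl [?a, ?b]" using chainl_append xs(1) by metis
    then have ab0: "?a \<in> nonidem" "?b \<in> nonidem" by (simp_all add: chainl_def)
    then have abB: "?a \<in> B" "?b \<in> B" using nonidem_closed by blast+
    have ab: "?a \<in> nonidem" "?b \<in> nonidem" "?a \<odot> ?b \<noteq> \<o>"
      using \<open>chainl [?a, ?b]\<close> abB by (simp_all add: chainl_def)
    have sub: "set ?ys \<subseteq> nonidem" "set ?zs \<subseteq> nonidem"
      using xs(1) set_take_subset[of "j - 1" xs] set_drop_subset[of "j + 1" xs] by (auto simp: chainl_def)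
    have subL: "set ?ys \<subseteq> \<Lambda>" "set ?zs \<subseteq> \<Lambda>" using sub nonidem_closed by auto
    obtain c where c: "bp ?a ?b \<in> B" "c \<noteq> 0" "?a \<odot> ?b = c \<bullet> bp ?a ?b" using bp[OF abB ab(3)] .
    have "prodl xs = prodl ?ys \<odot> (?a \<odot> ?b \<odot> prodl ?zs)"
      using subL abB prodl_closed[OF subL(2)]
      by (subst eq, subst prodl_append) (simp_all add: L.m_assoc)
    also have "\<dots> = c \<bullet> (prodl ?ys \<odot> (bp ?a ?b \<odot> prodl ?zs))"
      using subL c abB prodl_closed[OF subL(1)] prodl_closed[OF subL(2)]
      by (simp add: smult_mult_left smult_mult_right)
    also have "prodl ?ys \<odot> (bp ?a ?b \<odot> prodl ?zs) = prodl (?ys @ [bp ?a ?b] @ ?zs)"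
      using subL c by (subst prodl_append) simp_all
    finally have "prodl xs = c \<bullet> prodl (mface j xs)"
      using 3 by (simp add: mface_inner sc_face_def)
    then have "prodl (mface j xs) \<noteq> \<o>" using xs(1) smult_zero unfolding chainl_def by metis
    moreover have "set (mface j xs) \<subseteq> nonidem"
      using 3 sub bp_nonidem[OF ab] by (auto simp: mface_inner sc_face_def)
    ultimately show ?thesis by (simp add: chainl_def)
  qed
qed

lemma chainl_assoc:
  assumes "chainl xs" "Suc (Suc k) < length xs"
  shows "bp (bp (xs ! k) (xs ! Suc k)) (xs ! Suc (Suc k)) = bp (xs ! k) (bp (xs ! Suc k) (xs ! Suc (Suc k)))"
proof -
  let ?a = "xs ! k" and ?b = "xs ! Suc k" and ?c = "xs ! Suc (Suc k)"
  have "xs = take k xs @ [?a, ?b, ?c] @ drop (Suc (Suc (Suc k))) xs"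
    using assms(2) by (simp add: Cons_nth_drop_Suc)
  then have "chainl [?a, ?b, ?c]" using chainl_append assms(1) by metis
  then have ch: "set [?a, ?b, ?c] \<subseteq> nonidem" "prodl [?a, ?b, ?c] \<noteq> \<o>"
    unfolding chainl_def by blast+
  then have B: "?a \<in> B" "?b \<in> B" "?c \<in> B" using nonidem_closed by auto
  then have "?a \<odot> (?b \<odot> ?c) \<noteq> \<o>" using ch(2) by simp
  then show ?thesis using B by (intro bp_assoc) (simp_all add: L.m_assoc)
qed

text \<open>Beyond index arithmetic, the only case is that of two adjacent inner faces, where three
  neighbours are merged in two orders and \<open>chainl_assoc\<close> applies.\<close>

lemma mface_mface:
  assumes "chainl xs" "i < j" "j \<le> length xs"
  shows "mface i (mface j xs) = mface (j - 1) (mface i xs)"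
proof (rule nth_equalityI)
  fix k assume "k < length (mface i (mface j xs))"
  then have k: "Suc (Suc k) < length xs" by simp
  then show "mface i (mface j xs) ! k = mface (j - 1) (mface i xs) ! k"
    using assms(2,3) chainl_assoc[OF assms(1) k] by (auto simp: nth_mface)
qed simp

text \<open>Extends the faces to degree 1: face 0 is the target and face 1 the source, so the
  alternating sum is target minus source. The value at a vertex is a mere default.\<close>

definition sface where
  "sface j s = (case s of Inl x \<Rightarrow> Inl x | Inr xs \<Rightarrow>
     if length xs = 1 then Inl (if j = 0 then tg (hd xs) else sr (hd xs)) else Inr (mface j xs))"

abbreviation S where "S \<equiv> sc_simplices Q I B"

lemma S_0: "S 0 = Inl ` verts Q" and S_1: "S (Suc 0) = {Inr [\<sigma>] | \<sigma>. \<sigma> \<in> B}"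
  and S_2: "S (Suc (Suc n)) = {Inr xs | xs. length xs = Suc (Suc n) \<and> chainl xs}"
  by (auto simp: sc_simplices_def chainl_def nonidem_def)

lemma sface_S:
  assumes "s \<in> S (Suc n)" "j \<le> Suc n" shows "sface j s \<in> S n"
proof (cases n)
  case 0
  then show ?thesis using assms src_tgt by (auto simp: S_1 S_0 sface_def)
next
  case (Suc m)
  then obtain xs where xs: "s = Inr xs" "length xs = Suc (Suc m)" "chainl xs"
    using assms(1) by (auto simp: S_2)
  have face: "sface j s = Inr (mface j xs)" "chainl (mface j xs)"
    using xs chainl_mface[OF xs(3)] assms(2) Suc by (simp_all add: sface_def)
  show ?thesis
  proof (cases m)
    case 0
    then have "length (mface j xs) = Suc 0" using xs(2) by simp
    then obtain \<sigma> where "mface j xs = [\<sigma>]" by (metis length_0_conv length_Suc_conv)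
    then show ?thesis using face nonidem_closed Suc 0 by (auto simp: S_1 chainl_def)
  next
    case (Suc m')
    then show ?thesis using face xs \<open>n = Suc m\<close> by (auto simp: S_2)
  qed
qed

text \<open>For a pair (a, b) the identities say that \<open>a\<close> ends where \<open>b\<close>
  begins and that the merged element has the source of \<open>a\<close> and the target of
  \<open>b\<close>. Longer tuples reduce to \<open>mface_mface\<close>.\<close>

lemma sface_sface:
  assumes s: "s \<in> S (Suc (Suc n))" and ij: "i < j" "j \<le> Suc (Suc n)"
  shows "sface i (sface j s) = sface (j - 1) (sface i s)"
proof -
  obtain xs where xs: "s = Inr xs" "length xs = Suc (Suc n)" "chainl xs"
    using s by (auto simp: S_2)
  show ?thesis
  proof (cases n)
    case 0
    then obtain a b where ab: "xs = [a, b]" using xs(2) by (auto simp: length_Suc_conv)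
    then have "a \<in> B" "b \<in> B" using xs(3) nonidem_closed by (simp_all add: chainl_def subset_iff)
    then have B: "a \<in> B" "b \<in> B" "a \<odot> b \<noteq> \<o>" using xs(3) ab by (simp_all add: chainl_def)
    have m: "mface 0 xs = [b]" "mface (Suc 0) xs = [bp a b]" "mface (Suc (Suc 0)) xs = [a]"
      by (simp_all add: ab mface_def)
    consider "i = 0" "j = Suc 0" | "i = 0" "j = Suc (Suc 0)" | "i = Suc 0" "j = Suc (Suc 0)"
      using ij 0 by linarith
    then show ?thesis
      by cases (use xs(1,2) 0 m src_tgt_bp[OF B] tgt_eq_src[OF B] in \<open>simp_all add: sface_def\<close>)
  next
    case (Suc m)
    then show ?thesis using xs mface_mface[OF xs(3)] ij by (simp add: sface_def)
  qed
qed

text \<open>The differential treats degree 1 and the two outer faces separately; as one alternating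
  sum it becomes accessible to the usual cancellation.\<close>

lemma boundary_simplex:
  assumes "s \<in> S (Suc n)"
  shows "sc_boundary_simplex Q I B s = (\<Sum>j\<le>Suc n. frag_cmul ((- 1) ^ j) (frag_of (sface j s)))"
proof (cases n)
  case 0
  then show ?thesis using assms by (auto simp: S_1 sc_boundary_simplex_def sface_def)
next
  case (Suc m)
  then obtain xs where xs: "s = Inr xs" "length xs = Suc (Suc m)" "chainl xs"
    using assms by (auto simp: S_2)
  have "(\<Sum>j\<le>Suc n. frag_cmul ((- 1) ^ j) (frag_of (sface j s))) =
      (\<Sum>j\<le>Suc (Suc m). frag_cmul ((- 1) ^ j) (frag_of (Inr (mface j xs) :: ('v, 'a, 'k) simplex)))"
    using xs Suc by (intro sum.cong) (simp_all add: sface_def)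
  also have "{..Suc (Suc m)} = insert 0 (insert (Suc (Suc m)) {1..Suc m})" by auto
  also have "(\<Sum>j\<in>insert 0 (insert (Suc (Suc m)) {1..Suc m}).
        frag_cmul ((- 1) ^ j) (frag_of (Inr (mface j xs) :: ('v, 'a, 'k) simplex))) =
      frag_of (Inr (tl xs)) + (frag_cmul ((- 1) ^ Suc (Suc m)) (frag_of (Inr (butlast xs))) +
      (\<Sum>j\<in>{1..Suc m}. frag_cmul ((- 1) ^ j) (frag_of (Inr (mface j xs)))))"
    using mface_length[of xs] xs(2) by (simp add: mface_0)
  also have "(\<Sum>j\<in>{1..Suc m}. frag_cmul ((- 1) ^ j) (frag_of (Inr (mface j xs) :: ('v, 'a, 'k) simplex))) =
      (\<Sum>j = 1..Suc m. frag_cmul ((- 1) ^ j) (frag_of (Inr (sc_face Q I B j xs))))"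
    using xs(2) by (intro sum.cong) (simp_all add: mface_inner)
  finally show ?thesis
    using xs by (simp add: sc_boundary_simplex_def algebra_simps)
qed

end

text \<open>The map (j, i) |-> (i, j - 1) is a bijection from the pairs with i < j onto the
  remaining pairs; it matches equal terms and lowers the exponent of the sign by one.\<close>

lemma alternating_faces_cancel:
  fixes a :: "nat \<Rightarrow> nat \<Rightarrow> 's \<Rightarrow>\<^sub>0 int"
  assumes "\<And>i j. i < j \<Longrightarrow> j \<le> Suc n \<Longrightarrow> a i j = a (j - 1) i"
  shows "(\<Sum>j\<le>Suc n. frag_cmul ((- 1) ^ j) (\<Sum>i\<le>n. frag_cmul ((- 1) ^ i) (a i j))) = 0"
proof -
  define g where "g = (\<lambda>(j, i). frag_cmul ((- 1) ^ (i + j)) (a i j))"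
  let ?X = "{..Suc n} \<times> {..n}"
  let ?P = "{x \<in> ?X. snd x < fst x}" and ?N = "{x \<in> ?X. \<not> snd x < fst x}"
  have "(\<Sum>j\<le>Suc n. frag_cmul ((- 1) ^ j) (\<Sum>i\<le>n. frag_cmul ((- 1) ^ i) (a i j))) = sum g ?X"
    by (simp add: sum.cartesian_product g_def frag_cmul_sum power_add mult.commute)
  also have "\<dots> = sum g ?P + sum g ?N"
    by (subst sum.union_disjoint[symmetric]) (auto intro!: sum.cong)
  also have "sum g ?P = (\<Sum>x\<in>?N. - g x)"
  proof (rule sum.reindex_bij_witness[of _ "\<lambda>(j, i). (Suc i, j)" "\<lambda>(j, i). (i, j - 1)"])
    fix x assume "x \<in> ?P"
    then obtain i j where x: "x = (j, i)" "i < j" "j \<le> Suc n" by auto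
    then obtain j' where "j = Suc j'" using less_imp_Suc_add by blast
    then show "- g ((\<lambda>(j, i). (i, j - 1)) x) = g x"
      using assms[OF x(2,3)] x by (simp add: g_def add.commute)
  qed auto
  finally show ?thesis by (simp add: sum_negf)
qed

context semi_normed_algebra
begin

lemma chain_complex_basis: "chain_complex S (sc_boundary Q I B)"
proof
  fix a b :: "('v, 'a, 'k) simplex \<Rightarrow>\<^sub>0 int"
  show "sc_boundary Q I B (a - b) = sc_boundary Q I B a - sc_boundary Q I B b"
    by (simp add: sc_boundary_def frag_extend_diff)
next
  fix c :: "('v, 'a, 'k) simplex \<Rightarrow>\<^sub>0 int" and n
  assume c: "Poly_Mapping.keys c \<subseteq> S (Suc n)"
  have "Poly_Mapping.keys (sc_boundary_simplex Q I B s) \<subseteq> S n" if s: "s \<in> S (Suc n)" for s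
  proof -
    have "Poly_Mapping.keys (sc_boundary_simplex Q I B s) \<subseteq>
        (\<Union>j\<le>Suc n. Poly_Mapping.keys (frag_cmul ((- 1) ^ j) (frag_of (sface j s))))"
      unfolding boundary_simplex[OF s] by (rule keys_sum)
    also have "\<dots> \<subseteq> S n" using sface_S[OF s] by auto
    finally show ?thesis .
  qed
  then show "Poly_Mapping.keys (sc_boundary Q I B c) \<subseteq> S n"
    unfolding sc_boundary_def using keys_frag_extend c by fastforce
next
  fix c :: "('v, 'a, 'k) simplex \<Rightarrow>\<^sub>0 int" and n
  assume "Poly_Mapping.keys c \<subseteq> S (Suc n)"
  then show "sc_boundary Q I B (sc_boundary Q I B c) = 0"
  proof (induction c rule: frag_induction)
    case (one s)
    have "sc_boundary Q I B (sc_boundary_simplex Q I B s) =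
        (\<Sum>j\<le>Suc n. frag_cmul ((- 1) ^ j) (sc_boundary_simplex Q I B (sface j s)))"
      unfolding boundary_simplex[OF one]
      by (simp add: sc_boundary_def frag_extend_sum frag_extend_cmul del: sum.atMost_Suc)
    also have "\<dots> = 0"
    proof (cases n)
      \<comment> \<open>The faces are vertices here, on which the differential is zero, so each
        summand vanishes by itself.\<close>
      case 0
      then show ?thesis using sface_S[OF one] by (intro sum.neutral) (force simp: S_0 sc_boundary_simplex_def)
    next
      case (Suc m)
      have "(\<Sum>j\<le>Suc n. frag_cmul ((- 1) ^ j) (sc_boundary_simplex Q I B (sface j s))) =
        (\<Sum>j\<le>Suc n. frag_cmul ((- 1) ^ j) (\<Sum>i\<le>n. frag_cmul ((- 1) ^ i) (frag_of (sface i (sface j s)))))"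
        using boundary_simplex[of _ m] sface_S[OF one] unfolding Suc
        by (intro sum.cong) (simp_all del: sum.atMost_Suc)
      also have "\<dots> = 0"
        by (rule alternating_faces_cancel) (use sface_sface one Suc in simp)
      finally show ?thesis .
    qed
    finally show ?case by (simp add: sc_boundary_def)
  qed (simp_all add: sc_boundary_def frag_extend_diff)
next
  fix c :: "('v, 'a, 'k) simplex \<Rightarrow>\<^sub>0 int"
  assume "Poly_Mapping.keys c \<subseteq> S 0"
  then show "sc_boundary Q I B c = 0"
    unfolding sc_boundary_def by (intro frag_extend_eq_0) (auto simp: S_0 sc_boundary_simplex_def)
qed

sublocale X: chain_complex S "sc_boundary Q I B" by (rule chain_complex_basis)

lemma simplicial_homology_eq: "simplicial_homology Q I B = X.homology"
proof
  fix n
  have "carrier (free_Abelian_group (S m)) = X.chains m" for m by (auto simp: X.chains_def)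
  then show "simplicial_homology Q I B n = X.homology n"
    by (simp add: simplicial_homology_def X.homology_def X.cycles_def X.boundaries_def sc_group_def)
qed

end

section \<open>Corner algebras\<close>

context bound_path_algebra
begin

section \<open>Idempotents attached to sets of vertices\<close>

lemma idem_sum_cl:
  assumes "U \<subseteq> verts Q"
  shows "idem_sum Q I U = cl (\<Sum>x\<in>U. Poly_Mapping.single (x, [], x) 1)"
  unfolding idem_sum_def vertex_idem_pcl pcl_def
  using finite_subset[OF assms fin] assms by (intro finsum_L) auto

lemma idem_sum_closed [simp]: "U \<subseteq> verts Q \<Longrightarrow> idem_sum Q I U \<in> \<Lambda>"
  unfolding idem_sum_cl by (intro cl_L kQ_sum) auto

lemma idem_sum_mult:
  assumes "U \<subseteq> verts Q" "x \<in> verts Q"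
  shows "idem_sum Q I U \<odot> \<epsilon> x = (if x \<in> U then \<epsilon> x else \<o>)"
    "\<epsilon> x \<odot> idem_sum Q I U = (if x \<in> U then \<epsilon> x else \<o>)"
proof -
  have U: "(\<Sum>x\<in>U. Poly_Mapping.single (x, [], x) 1) \<in> kQ" "finite U"
    using assms finite_subset[OF assms(1) fin] by (auto intro!: kQ_sum[simplified])
  show "idem_sum Q I U \<odot> \<epsilon> x = (if x \<in> U then \<epsilon> x else \<o>)"
    "\<epsilon> x \<odot> idem_sum Q I U = (if x \<in> U then \<epsilon> x else \<o>)"
    using U assms
    by (simp_all add: idem_sum_cl vertex_idem_pcl pcl_def mult_L path_mult_sum_left path_mult_sum_right
        path_mult_single zero_L)
qed

lemma idem_sum_union:
  assumes "U \<subseteq> verts Q" "U' \<subseteq> verts Q" "U \<inter> U' = {}"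
  shows "idem_sum Q I U \<boxplus> idem_sum Q I U' = idem_sum Q I (U \<union> U')"
proof -
  have "finite U" "finite U'" using assms fin finite_subset by blast+
  moreover have "(\<Sum>x\<in>U. Poly_Mapping.single (x, [], x) 1) \<in> kQ"
    "(\<Sum>x\<in>U'. Poly_Mapping.single (x, [], x) 1) \<in> kQ"
    using assms by (auto intro!: kQ_sum[simplified])
  ultimately show ?thesis
    using assms by (simp add: idem_sum_cl add_L sum.union_disjoint)
qed

lemma hs_idem_sum:
  assumes "U \<subseteq> verts Q" "x \<in> verts Q" "y \<in> verts Q" "X \<in> hs x y"
  shows "idem_sum Q I U \<odot> X = (if x \<in> U then X else \<o>)"
    "X \<odot> idem_sum Q I U = (if y \<in> U then X else \<o>)"
proof -
  have X: "X \<in> \<Lambda>" "\<epsilon> x \<odot> X = X" "X \<odot> \<epsilon> y = X" using assms by (auto simp: hs_iff)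
  have "idem_sum Q I U \<odot> X = (idem_sum Q I U \<odot> \<epsilon> x) \<odot> X"
    using X assms(1,2) by (simp add: L.m_assoc)
  then show "idem_sum Q I U \<odot> X = (if x \<in> U then X else \<o>)"
    using X assms by (simp add: idem_sum_mult)
  have "X \<odot> idem_sum Q I U = X \<odot> (\<epsilon> y \<odot> idem_sum Q I U)"
    using X assms by (simp add: L.m_assoc[symmetric])
  then show "X \<odot> idem_sum Q I U = (if y \<in> U then X else \<o>)"
    using X assms by (simp add: idem_sum_mult)
qed

text \<open>For nonzero \<open>X\<close> from \<open>x\<close> to \<open>y\<close>, multiplication
  by the stationary idempotents at \<open>x\<close> and \<open>y\<close> fixes \<open>X\<close> but
  would annihilate e r e' if \<open>x\<close> or \<open>y\<close> were missing from the respective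
  set.\<close>

lemma peirce_iff:
  assumes "U \<subseteq> verts Q" "U' \<subseteq> verts Q" "x \<in> verts Q" "y \<in> verts Q" "X \<in> hs x y" "X \<noteq> \<o>"
  shows "X \<in> peirce (bq_algebra Q I) (idem_sum Q I U) (idem_sum Q I U') \<longleftrightarrow> x \<in> U \<and> y \<in> U'"
proof
  let ?e = "idem_sum Q I U" and ?e' = "idem_sum Q I U'"
  have XL: "X \<in> \<Lambda>" using assms hs_closed by blast
  assume "X \<in> peirce (bq_algebra Q I) ?e ?e'"
  then obtain r where r: "r \<in> \<Lambda>" "X = ?e \<odot> r \<odot> ?e'" by (auto simp: peirce_def)
  have "\<epsilon> x \<odot> X = (\<epsilon> x \<odot> ?e) \<odot> (r \<odot> ?e')" "X \<odot> \<epsilon> y = ?e \<odot> r \<odot> (?e' \<odot> \<epsilon> y)"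
    using r assms(1-4) by (simp_all add: L.m_assoc)
  then have "X = (\<epsilon> x \<odot> ?e) \<odot> (r \<odot> ?e')" "X = ?e \<odot> r \<odot> (?e' \<odot> \<epsilon> y)"
    using assms(3-5) hs_iff by metis+
  then show "x \<in> U \<and> y \<in> U'"
    using assms(1-4,6) r(1) by (metis L.l_null L.r_null L.m_closed idem_sum_closed idem_sum_mult)
next
  let ?e = "idem_sum Q I U" and ?e' = "idem_sum Q I U'"
  assume "x \<in> U \<and> y \<in> U'"
  then have "X = ?e \<odot> X \<odot> ?e'" using hs_idem_sum[OF assms(1,3-5)] hs_idem_sum[OF assms(2,3-5)] by simp
  moreover have "X \<in> \<Lambda>" using assms hs_closed by blast
  ultimately show "X \<in> peirce (bq_algebra Q I) ?e ?e'" unfolding peirce_def by blast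
qed

lemma bound_path_algebra_induce:
  assumes W: "W \<subseteq> verts Q"
  shows "bound_path_algebra (Q \<restriction> W) (restrict_ideal (Q \<restriction> W) I)"
proof (rule bound_path_algebra.intro)
  show wf': "wf_digraph (Q \<restriction> W)" using wf by (rule wf_digraph.wellformed_induce_subgraph)
  show fin': "finite (verts (Q \<restriction> W))" using W fin finite_subset by auto
  have sub: "paths (Q \<restriction> W) \<subseteq> paths Q" using paths_induce(1)[OF W] by auto
  show "restrict_ideal (Q \<restriction> W) I \<subseteq> long_paths (Q \<restriction> W) 2"
    using I_long by (auto simp: restrict_ideal_def long_paths_def)
  interpret K': ring "path_algebra (Q \<restriction> W) :: (('v, 'a) path \<Rightarrow>\<^sub>0 'k) ring"
    by (rule ring_path_algebra[OF wf' fin'])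
  have keys: "Poly_Mapping.keys f \<subseteq> paths Q" if "Poly_Mapping.keys f \<subseteq> paths (Q \<restriction> W)" for f :: "('v, 'a) path \<Rightarrow>\<^sub>0 'k"
    using that sub by simp
  show "ideal (restrict_ideal (Q \<restriction> W) I) (path_algebra (Q \<restriction> W))"
  proof (rule idealI)
    show "ring (path_algebra (Q \<restriction> W) :: (('v, 'a) path \<Rightarrow>\<^sub>0 'k) ring)" by (rule K'.ring_axioms)
    show "subgroup (restrict_ideal (Q \<restriction> W) I) (add_monoid (path_algebra (Q \<restriction> W)))"
    proof (rule group.subgroupI)
      show "Group.group (add_monoid (path_algebra (Q \<restriction> W) :: (('v, 'a) path \<Rightarrow>\<^sub>0 'k) ring))" by (rule K'.a_group)
      have "0 \<in> restrict_ideal (Q \<restriction> W) I" by (simp add: restrict_ideal_def)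
      then show "restrict_ideal (Q \<restriction> W) I \<noteq> {}" by blast
      show "inv\<^bsub>add_monoid (path_algebra (Q \<restriction> W))\<^esub> f \<in> restrict_ideal (Q \<restriction> W) I"
        if "f \<in> restrict_ideal (Q \<restriction> W) I" for f
      proof -
        have f: "Poly_Mapping.keys f \<subseteq> paths (Q \<restriction> W)" "f \<in> I" using that by (auto simp: restrict_ideal_def)
        then have "- f \<in> restrict_ideal (Q \<restriction> W) I"
          using I_minus by (auto simp: restrict_ideal_def in_keys_iff)
        then show ?thesis using path_algebra_minus[OF wf' fin' f(1)] by (simp add: a_inv_def)
      qed
    qed (use I_add in \<open>auto simp: restrict_ideal_def dest: keys_add[THEN subsetD]\<close>)
  next
    fix a x :: "('v, 'a) path \<Rightarrow>\<^sub>0 'k" assume a: "a \<in> restrict_ideal (Q \<restriction> W) I" and x: "x \<in> carrier (path_algebra (Q \<restriction> W))"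
    then have "path_mult x a \<in> I" "path_mult a x \<in> I"
      using I.I_l_closed[of a x] I.I_r_closed[of a x] keys by (auto simp: restrict_ideal_def)
    then show "x \<otimes>\<^bsub>path_algebra (Q \<restriction> W)\<^esub> a \<in> restrict_ideal (Q \<restriction> W) I"
      "a \<otimes>\<^bsub>path_algebra (Q \<restriction> W)\<^esub> x \<in> restrict_ideal (Q \<restriction> W) I"
      using path_mult_closed[OF wf', of x a] path_mult_closed[OF wf', of a x] a x
      by (auto simp: restrict_ideal_def)
  qed
qed

end

lemma bound_quiver_bound_path_algebra:
  assumes "bound_quiver Q I" shows "bound_path_algebra Q I"
proof -
  have "wf_digraph Q" "finite (verts Q)" using assms by (simp_all add: bound_quiver_def)
  from arrow_ideal_square[OF this] show ?thesis
    using assms unfolding bound_quiver_def bound_path_algebra_def by blast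
qed

text \<open>Injectivity keeps the support of the pulled back family finite. Together with
  \<open>poly_mapping_push\<close> this moves coordinates between a corner and R.\<close>

lemma poly_mapping_transport:
  fixes c' :: "'b \<Rightarrow>\<^sub>0 'c::zero"
  assumes inj: "inj_on f B" and c': "Poly_Mapping.keys c' \<subseteq> f ` B"
  obtains c :: "'a \<Rightarrow>\<^sub>0 'c" where "Poly_Mapping.keys c \<subseteq> B" "\<And>\<sigma>. \<sigma> \<in> B \<Longrightarrow> Poly_Mapping.lookup c' (f \<sigma>) = Poly_Mapping.lookup c \<sigma>"
proof -
  define u where "u \<sigma> = (if \<sigma> \<in> B then Poly_Mapping.lookup c' (f \<sigma>) else 0)" for \<sigma>
  have "{\<sigma>. u \<sigma> \<noteq> 0} \<subseteq> f -` Poly_Mapping.keys c' \<inter> B" by (auto simp: u_def in_keys_iff)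
  then have "finite {\<sigma>. u \<sigma> \<noteq> 0}" using finite_vimage_IntI[OF finite_keys inj] finite_subset by blast
  then have l: "Poly_Mapping.lookup (Abs_poly_mapping u) = u" by simp
  show thesis
    by (rule that[of "Abs_poly_mapping u"]) (auto simp: in_keys_iff l u_def split: if_splits)
qed

lemma poly_mapping_push:
  fixes c :: "'a \<Rightarrow>\<^sub>0 'c::zero"
  assumes inj: "inj_on f B" and c: "Poly_Mapping.keys c \<subseteq> B"
  obtains c' :: "'b \<Rightarrow>\<^sub>0 'c" where "Poly_Mapping.keys c' \<subseteq> f ` B" "\<And>\<sigma>. \<sigma> \<in> B \<Longrightarrow> Poly_Mapping.lookup c' (f \<sigma>) = Poly_Mapping.lookup c \<sigma>"
proof -
  have eq: "inv_into B f ` f ` B = B" using inj by simp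
  obtain c' :: "'b \<Rightarrow>\<^sub>0 'c" where c': "Poly_Mapping.keys c' \<subseteq> f ` B"
    "\<And>\<tau>. \<tau> \<in> f ` B \<Longrightarrow> Poly_Mapping.lookup c (inv_into B f \<tau>) = Poly_Mapping.lookup c' \<tau>"
    using poly_mapping_transport[OF inj_on_inv_into[of "f ` B" f B], of c] c eq by auto
  show thesis
    by (rule that[OF c'(1)]) (use c'(2) inj in force)
qed

text \<open>\<open>P\<close> is a one-to-one correspondence between the candidates on the two sides
  that respects being a solution.\<close>

lemma ex1_transfer:
  assumes "\<And>c c'. P c c' \<Longrightarrow> X c \<longleftrightarrow> Y c'"
    and "\<And>c. X c \<Longrightarrow> \<exists>c'. P c c'" and "\<And>c'. Y c' \<Longrightarrow> \<exists>c. P c c'"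
    and "\<And>c d c'. P c c' \<Longrightarrow> P d c' \<Longrightarrow> c = d" and "\<And>c c' d'. P c c' \<Longrightarrow> P c d' \<Longrightarrow> c' = d'"
  shows "(\<exists>!c. X c) \<longleftrightarrow> (\<exists>!c'. Y c')"
  using assms by metis

text \<open>Injectivity of the inclusion follows from the choice of \<open>J\<close>
  (\<open>iota_inj\<close>). The equation adds that every element of R between vertices of
  \<open>W\<close> is represented by paths that do not leave \<open>W\<close>, as exploited in
  \<open>hs_range\<close> and \<open>hs_span\<close>.\<close>

locale corner = bound_path_algebra Q I
  for Q :: "('v, 'a) pre_digraph" and I :: "(('v, 'a) path \<Rightarrow>\<^sub>0 'k::field) set" +
  fixes W
  assumes W: "W \<subseteq> verts Q"
    and corner: "coset_incl Q I ` carrier (bq_algebra (Q \<restriction> W) (restrict_ideal (Q \<restriction> W) I)) =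
      peirce (bq_algebra Q I) (idem_sum Q I W) (idem_sum Q I W)"
begin

abbreviation J where "J \<equiv> restrict_ideal (Q \<restriction> W) I"
abbreviation A where "A \<equiv> carrier (bq_algebra (Q \<restriction> W) J)"
abbreviation iota ("\<kappa>") where "iota \<equiv> coset_incl Q I"

sublocale C: bound_path_algebra "Q \<restriction> W" J
  by (rule bound_path_algebra_induce[OF W])

section \<open>The inclusion of a corner respects the algebra structure\<close>

lemma sub_paths: "paths (Q \<restriction> W) \<subseteq> paths Q"
  using paths_induce(1)[OF W] by auto

lemma sub_kQ: "f \<in> C.kQ \<Longrightarrow> f \<in> kQ"
  using sub_paths by auto

lemma J_iff: "f \<in> C.kQ \<Longrightarrow> f \<in> J \<longleftrightarrow> f \<in> I"
  by (simp add: restrict_ideal_def)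

lemma iota_cl: assumes "f \<in> C.kQ" shows "\<kappa> (C.cl f) = cl f"
proof -
  have "\<kappa> (C.cl f) = (\<Union>g\<in>C.cl f. cl g)" by (simp add: coset_incl_def cl_def)
  moreover have "cl g = cl f" if g: "g \<in> C.cl f" for g
  proof -
    obtain h where "h \<in> J" "g = h + f" using g by (auto simp: C.cl_alt)
    then show ?thesis by (simp add: cl_eq_iff restrict_ideal_def)
  qed
  moreover have "f \<in> C.cl f" unfolding C.cl_alt by (metis C.I_zero add_0 imageI)
  ultimately show ?thesis by blast
qed

lemma iota_closed: "X \<in> A \<Longrightarrow> \<kappa> X \<in> \<Lambda>"
  by (elim C.L_E) (use sub_kQ cl_L in \<open>simp add: iota_cl\<close>)

lemma iota_inj: "inj_on \<kappa> A"
proof (rule inj_onI)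
  fix X Y assume "X \<in> A" "Y \<in> A" and eq: "\<kappa> X = \<kappa> Y"
  then obtain f g where "f \<in> C.kQ" "X = C.cl f" "g \<in> C.kQ" "Y = C.cl g" using C.L_E by metis
  then show "X = Y"
    using eq C.kQ_diff[of f g] by (simp add: iota_cl cl_eq_iff C.cl_eq_iff J_iff)
qed

lemma iota_eq_iff: "X \<in> A \<Longrightarrow> Y \<in> A \<Longrightarrow> \<kappa> X = \<kappa> Y \<longleftrightarrow> X = Y"
  using iota_inj by (simp add: inj_on_eq_iff)

lemma iota_mult:
  assumes "X \<in> A" "Y \<in> A" shows "\<kappa> (C.lmult X Y) = \<kappa> X \<odot> \<kappa> Y"
proof -
  obtain f g where "f \<in> C.kQ" "X = C.cl f" "g \<in> C.kQ" "Y = C.cl g" using assms C.L_E by metis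
  then show ?thesis
    using C.kQ_mult[of f g] sub_kQ[of f] sub_kQ[of g] by (simp add: iota_cl C.mult_L mult_L)
qed

lemma iota_add:
  assumes "X \<in> A" "Y \<in> A" shows "\<kappa> (C.ladd X Y) = \<kappa> X \<boxplus> \<kappa> Y"
proof -
  obtain f g where "f \<in> C.kQ" "X = C.cl f" "g \<in> C.kQ" "Y = C.cl g" using assms C.L_E by metis
  then show ?thesis
    using C.kQ_add[of f g] sub_kQ[of f] sub_kQ[of g] by (simp add: iota_cl C.add_L add_L)
qed

lemma iota_zero: "\<kappa> C.lzero = \<o>"
  using iota_cl[of 0] by (simp add: C.zero_L zero_L)

lemma iota_zero_iff: "X \<in> A \<Longrightarrow> \<kappa> X = \<o> \<longleftrightarrow> X = C.lzero"
  using iota_eq_iff[of X C.lzero] iota_zero by simp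

lemma iota_smult: "X \<in> A \<Longrightarrow> \<kappa> (C.smult c X) = c \<bullet> \<kappa> X"
  by (elim C.L_E) (use sub_kQ C.kQ_scale in \<open>simp add: iota_cl C.smult_L smult_L\<close>)

lemma iota_pcl: "k \<in> paths (Q \<restriction> W) \<Longrightarrow> \<kappa> (C.pcl k) = pcl k"
  by (simp add: C.pcl_def pcl_def iota_cl)

lemma iota_idem: "x \<in> W \<Longrightarrow> \<kappa> (C.idem x) = \<epsilon> x"
  by (simp add: C.vertex_idem_pcl vertex_idem_pcl iota_pcl)

lemma C_idem_closed: "x \<in> W \<Longrightarrow> C.idem x \<in> A"
  by simp

lemma iota_arrow: "a \<in> arcs (Q \<restriction> W) \<Longrightarrow> \<kappa> (arrow_class (Q \<restriction> W) J a) = arrow_class Q I a"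
  using C.arrow_path[of a] by (simp add: C.arrow_class_pcl arrow_class_pcl iota_pcl)

lemma C_arrow_closed: "a \<in> arcs (Q \<restriction> W) \<Longrightarrow> arrow_class (Q \<restriction> W) J a \<in> A"
  unfolding C.arrow_class_pcl by (intro C.pcl_closed C.arrow_path)

lemma iota_hs_iff:
  assumes "X \<in> A" "x \<in> W" "y \<in> W" shows "\<kappa> X \<in> hs x y \<longleftrightarrow> X \<in> C.hs x y"
proof -
  have V: "x \<in> verts Q" "y \<in> verts Q" "x \<in> verts (Q \<restriction> W)" "y \<in> verts (Q \<restriction> W)" using assms W by auto
  have "\<kappa> (C.lmult (C.idem x) X) = \<epsilon> x \<odot> \<kappa> X" "\<kappa> (C.lmult X (C.idem y)) = \<kappa> X \<odot> \<epsilon> y"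
    using assms iota_mult iota_idem C_idem_closed by metis+
  moreover have "\<kappa> (C.lmult (C.idem x) X) = \<kappa> X \<longleftrightarrow> C.lmult (C.idem x) X = X"
    "\<kappa> (C.lmult X (C.idem y)) = \<kappa> X \<longleftrightarrow> C.lmult X (C.idem y) = X"
    using assms C_idem_closed by (simp_all add: iota_eq_iff)
  ultimately show ?thesis using assms V iota_closed by (simp add: hs_iff C.hs_iff)
qed

lemma hs_range: assumes "x \<in> W" "y \<in> W" shows "hs x y \<subseteq> \<kappa> ` A"
proof
  fix X assume X: "X \<in> hs x y"
  have V: "x \<in> verts Q" "y \<in> verts Q" using assms W by auto
  have "X = idem_sum Q I W \<odot> X \<odot> idem_sum Q I W"
    using hs_idem_sum[OF W V X] assms by simp
  then show "X \<in> \<kappa> ` A"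
    unfolding corner peirce_def using hs_closed[OF V X] by blast
qed

lemma iota_hs: assumes "x \<in> W" "y \<in> W" shows "\<kappa> ` C.hs x y = hs x y"
proof -
  have "X \<in> A" if "X \<in> C.hs x y" for X
    using C.hs_closed[OF _ _ that] assms by simp
  then show ?thesis using iota_hs_iff[OF _ assms] hs_range[OF assms] by blast
qed

lemma hs_span: assumes "x \<in> W" "y \<in> W" shows "hs x y \<subseteq> cl ` carrier (path_algebra (Q \<restriction> W))"
proof
  fix X assume "X \<in> hs x y"
  then obtain Y where Y: "Y \<in> A" "X = \<kappa> Y" using hs_range[OF assms] by blast
  then obtain f where "f \<in> C.kQ" "Y = C.cl f" using C.L_E by metis
  then show "X \<in> cl ` carrier (path_algebra (Q \<restriction> W))" using Y iota_cl by auto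
qed

lemma iota_finsum:
  "finite F \<Longrightarrow> u \<in> F \<rightarrow> A \<Longrightarrow> \<kappa> (\<Oplus>\<^bsub>bq_algebra (Q \<restriction> W) J\<^esub>\<sigma>\<in>F. u \<sigma>) = (\<Oplus>\<^bsub>bq_algebra Q I\<^esub>\<sigma>\<in>F. \<kappa> (u \<sigma>))"
proof (induction F rule: finite_induct)
  case (insert \<sigma> F)
  then have u: "u \<in> F \<rightarrow> A" "u \<sigma> \<in> A" "(\<lambda>\<sigma>. \<kappa> (u \<sigma>)) \<in> F \<rightarrow> \<Lambda>" "\<kappa> (u \<sigma>) \<in> \<Lambda>"
    using iota_closed by auto
  then show ?case using insert by (simp add: iota_add)
qed (simp add: iota_zero)

lemma lc_push:
  assumes "B \<subseteq> A" "Poly_Mapping.keys c \<subseteq> B" "Poly_Mapping.keys c' \<subseteq> \<kappa> ` B"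
    and l: "\<And>\<sigma>. \<sigma> \<in> B \<Longrightarrow> Poly_Mapping.lookup c' (\<kappa> \<sigma>) = Poly_Mapping.lookup c \<sigma>"
  shows "lc c' = \<kappa> (C.lc c)"
proof -
  let ?F = "Poly_Mapping.keys c"
  have F: "?F \<subseteq> A" "inj_on \<kappa> ?F" using assms iota_inj by (auto intro: inj_on_subset)
  have sub: "Poly_Mapping.keys c' \<subseteq> \<kappa> ` ?F"
  proof
    fix \<tau> assume \<tau>: "\<tau> \<in> Poly_Mapping.keys c'"
    then obtain \<sigma> where "\<sigma> \<in> B" "\<tau> = \<kappa> \<sigma>" using assms by blast
    then show "\<tau> \<in> \<kappa> ` ?F" using \<tau> l[of \<sigma>] by (auto simp: in_keys_iff)
  qed
  have "lc c' = (\<Oplus>\<^bsub>bq_algebra Q I\<^esub>\<tau>\<in>\<kappa> ` ?F. Poly_Mapping.lookup c' \<tau> \<bullet> \<tau>)"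
    by (rule lc_superset[OF _ sub]) (use F iota_closed in auto)
  also have "\<dots> = (\<Oplus>\<^bsub>bq_algebra Q I\<^esub>\<sigma>\<in>?F. Poly_Mapping.lookup c' (\<kappa> \<sigma>) \<bullet> \<kappa> \<sigma>)"
    by (rule L.finsum_reindex) (use F iota_closed in auto)
  also have "\<dots> = (\<Oplus>\<^bsub>bq_algebra Q I\<^esub>\<sigma>\<in>?F. \<kappa> (C.smult (Poly_Mapping.lookup c \<sigma>) \<sigma>))"
  proof (rule L.finsum_cong'[OF refl])
    show "(\<lambda>\<sigma>. \<kappa> (C.smult (Poly_Mapping.lookup c \<sigma>) \<sigma>)) \<in> ?F \<rightarrow> \<Lambda>"
      using F iota_closed C.smult_closed by blast
    fix \<sigma> assume "\<sigma> \<in> ?F"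
    then have "\<sigma> \<in> B" "\<sigma> \<in> A" using assms F by auto
    then show "Poly_Mapping.lookup c' (\<kappa> \<sigma>) \<bullet> \<kappa> \<sigma> = \<kappa> (C.smult (Poly_Mapping.lookup c \<sigma>) \<sigma>)"
      by (simp add: l iota_smult)
  qed
  also have "\<dots> = \<kappa> (C.lc c)"
    unfolding C.lc_def by (rule iota_finsum[symmetric]) (use F C.smult_closed in auto)
  finally show ?thesis .
qed

lemma lc_closed: "Poly_Mapping.keys c \<subseteq> A \<Longrightarrow> C.lc c \<in> A"
  unfolding C.lc_def by (intro C.L.finsum_closed) (use C.smult_closed in auto)

text \<open>\<kappa> is a linear bijection between the two hom-spaces, so existence and uniqueness
  of coordinates correspond; \<open>lc_push\<close> matches the combinations themselves.\<close>

lemma iota_k_basis: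
  assumes B: "B \<subseteq> A" and xy: "x \<in> W" "y \<in> W"
  shows "k_basis (Q \<restriction> W) J (C.hs x y) B \<longleftrightarrow> k_basis Q I (hs x y) (\<kappa> ` B)"
proof -
  have hsA: "C.hs x y \<subseteq> A" using C.hs_closed xy by auto
  have inj: "inj_on \<kappa> B" using iota_inj B inj_on_subset by blast
  have 1: "B \<subseteq> C.hs x y \<longleftrightarrow> \<kappa> ` B \<subseteq> hs x y" using iota_hs_iff[OF _ xy] B by blast
  have 2: "(\<exists>!c. Poly_Mapping.keys c \<subseteq> B \<and> w = C.lc c) \<longleftrightarrow>
      (\<exists>!c. Poly_Mapping.keys c \<subseteq> \<kappa> ` B \<and> \<kappa> w = lc c)" if w: "w \<in> A" for w
  proof -
    define rel where "rel c c' \<longleftrightarrow> Poly_Mapping.keys c \<subseteq> B \<and> Poly_Mapping.keys c' \<subseteq> \<kappa> ` B \<and>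
      (\<forall>\<sigma>\<in>B. Poly_Mapping.lookup c' (\<kappa> \<sigma>) = Poly_Mapping.lookup c \<sigma>)"
      for c :: "_ \<Rightarrow>\<^sub>0 'k" and c' :: "_ \<Rightarrow>\<^sub>0 'k"
    have lc: "w = C.lc c \<longleftrightarrow> \<kappa> w = lc c'" if r: "rel c c'" for c c'
    proof -
      have "lc c' = \<kappa> (C.lc c)" using lc_push[OF B] r by (simp add: rel_def)
      moreover have "C.lc c \<in> A" using r B by (intro lc_closed) (auto simp: rel_def)
      ultimately show ?thesis using w by (simp add: iota_eq_iff)
    qed
    have left: "\<exists>c'. rel c c'" if "Poly_Mapping.keys c \<subseteq> B" for c
      using poly_mapping_push[OF inj that] that unfolding rel_def by metis
    have right: "\<exists>c. rel c c'" if "Poly_Mapping.keys c' \<subseteq> \<kappa> ` B" for c'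
      using poly_mapping_transport[OF inj that] that unfolding rel_def by metis
    have u1: "c = d" if "rel c c'" "rel d c'" for c d c'
    proof (rule poly_mapping_eqI)
      fix \<sigma> show "Poly_Mapping.lookup c \<sigma> = Poly_Mapping.lookup d \<sigma>"
        using that unfolding rel_def by (metis in_keys_iff subsetD)
    qed
    have u2: "c' = d'" if "rel c c'" "rel c d'" for c c' d'
    proof (rule poly_mapping_eqI)
      fix \<tau> show "Poly_Mapping.lookup c' \<tau> = Poly_Mapping.lookup d' \<tau>"
      proof (cases "\<tau> \<in> \<kappa> ` B")
        case True
        then show ?thesis using that by (auto simp: rel_def)
      next
        case False
        then have "\<tau> \<notin> Poly_Mapping.keys c'" "\<tau> \<notin> Poly_Mapping.keys d'"
          using that unfolding rel_def by blast+
        then show ?thesis by (simp add: in_keys_iff)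
      qed
    qed
    have keys: "Poly_Mapping.keys c \<subseteq> B" "Poly_Mapping.keys c' \<subseteq> \<kappa> ` B" if "rel c c'" for c c'
      using that by (simp_all add: rel_def)
    show ?thesis
    proof (rule ex1_transfer[of rel])
      show "Poly_Mapping.keys c \<subseteq> B \<and> w = C.lc c \<longleftrightarrow> Poly_Mapping.keys c' \<subseteq> \<kappa> ` B \<and> \<kappa> w = lc c'"
        if "rel c c'" for c c'
        using lc[OF that] keys[OF that] by simp
    qed (use left right u1 u2 in blast)+
  qed
  have 3: "(\<forall>w\<in>C.hs x y. \<exists>!c. Poly_Mapping.keys c \<subseteq> B \<and> w = C.lc c) \<longleftrightarrow>
      (\<forall>w\<in>\<kappa> ` C.hs x y. \<exists>!c. Poly_Mapping.keys c \<subseteq> \<kappa> ` B \<and> w = lc c)"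
    using 2 hsA by (simp add: subset_iff)
  show ?thesis
    by (simp only: k_basis_lc C.k_basis_lc 1 3 iota_hs[OF xy])
qed

text \<open>The bases of the corners are sets of cosets of different ideals. Their images in R can
  be intersected and united, and each clause of the definition is preserved and reflected by
  \<kappa>.\<close>

lemma iota_snb:
  assumes B: "B \<subseteq> A"
  shows "semi_normed_basis (Q \<restriction> W) J B \<longleftrightarrow> snb W (\<kappa> ` B)"
proof -
  have mem: "\<kappa> X \<in> \<kappa> ` B \<longleftrightarrow> X \<in> B" if "X \<in> A" for X
    using inj_on_image_mem_iff[OF iota_inj that B] .
  have hs_mem: "\<kappa> \<sigma> \<in> hs x y \<longleftrightarrow> \<sigma> \<in> C.hs x y" if "\<sigma> \<in> B" "x \<in> W" "y \<in> W" for \<sigma> x y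
    using iota_hs_iff that B by blast
  have "B \<subseteq> (\<Union>x\<in>W. \<Union>y\<in>W. C.hs x y) \<longleftrightarrow> \<kappa> ` B \<subseteq> (\<Union>x\<in>W. \<Union>y\<in>W. hs x y)"
    unfolding image_subset_iff unfolding subset_iff Ball_def[symmetric] by (simp add: hs_mem)
  moreover have "k_basis (Q \<restriction> W) J (C.hs x y) (B \<inter> C.hs x y) \<longleftrightarrow> k_basis Q I (hs x y) (\<kappa> ` B \<inter> hs x y)"
    if xy: "x \<in> W" "y \<in> W" for x y
  proof -
    have "\<kappa> ` B \<inter> hs x y = \<kappa> ` (B \<inter> C.hs x y)" using hs_mem[OF _ xy] by auto
    then show ?thesis using iota_k_basis[OF _ xy, of "B \<inter> C.hs x y"] B by (simp add: le_infI1)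
  qed
  moreover have "C.idem x \<in> B \<longleftrightarrow> \<epsilon> x \<in> \<kappa> ` B" if "x \<in> W" for x
    using mem[OF C_idem_closed[OF that]] iota_idem[OF that] by simp
  moreover have "arrow_class (Q \<restriction> W) J a \<in> B \<longleftrightarrow> arrow_class Q I a \<in> \<kappa> ` B" if "a \<in> arcs (Q \<restriction> W)" for a
    using mem[OF C_arrow_closed[OF that]] iota_arrow[OF that] by simp
  moreover have "(C.lmult \<sigma> \<tau> = C.lzero \<or> (\<exists>c \<rho>. c \<noteq> 0 \<and> \<rho> \<in> B \<and> C.lmult \<sigma> \<tau> = C.smult c \<rho>)) \<longleftrightarrow>
      (\<kappa> \<sigma> \<odot> \<kappa> \<tau> = \<o> \<or> (\<exists>c \<rho>. c \<noteq> 0 \<and> \<rho> \<in> \<kappa> ` B \<and> \<kappa> \<sigma> \<odot> \<kappa> \<tau> = c \<bullet> \<rho>))"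
    if "\<sigma> \<in> B" "\<tau> \<in> B" for \<sigma> \<tau>
  proof -
    have st: "\<sigma> \<in> A" "\<tau> \<in> A" using that B by auto
    have "C.lmult \<sigma> \<tau> = C.lzero \<longleftrightarrow> \<kappa> \<sigma> \<odot> \<kappa> \<tau> = \<o>"
      using st iota_zero_iff[of "C.lmult \<sigma> \<tau>"] by (simp add: iota_mult)
    moreover have "C.lmult \<sigma> \<tau> = C.smult c \<rho> \<longleftrightarrow> \<kappa> \<sigma> \<odot> \<kappa> \<tau> = c \<bullet> \<kappa> \<rho>" if "\<rho> \<in> B" for c \<rho>
      using st iota_eq_iff[of "C.lmult \<sigma> \<tau>" "C.smult c \<rho>"] that B
      by (simp add: iota_mult iota_smult subset_iff)
    ultimately show ?thesis by blast
  qed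
  ultimately show ?thesis
    unfolding semi_normed_basis_def snb_def by simp
qed

end

section \<open>Chain maps induced by corners\<close>

abbreviation frag_map :: "('a \<Rightarrow> 'b) \<Rightarrow> ('a \<Rightarrow>\<^sub>0 int) \<Rightarrow> ('b \<Rightarrow>\<^sub>0 int)" where
  "frag_map f \<equiv> frag_extend (frag_of \<circ> f)"

lemma keys_frag_map: "Poly_Mapping.keys c \<subseteq> S \<Longrightarrow> Poly_Mapping.keys (frag_map f c) \<subseteq> f ` S"
  using keys_frag_extend[of "frag_of \<circ> f" c] by fastforce

text \<open>A section of the map on simplices extends additively to a section on chains; injectivity
  below comes from the same device.\<close>

lemma frag_map_surj:
  assumes "Poly_Mapping.keys z \<subseteq> f ` S"
  obtains c where "Poly_Mapping.keys c \<subseteq> S" "frag_map f c = z"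
proof
  have "inv_into S f ` f ` S \<subseteq> S" by (auto intro: inv_into_into)
  then show "Poly_Mapping.keys (frag_map (inv_into S f) z) \<subseteq> S"
    using keys_frag_map[OF assms, of "inv_into S f"] by blast
  have "frag_map f (frag_map (inv_into S f) z) = frag_extend (frag_of \<circ> f \<circ> inv_into S f) z"
    by (rule frag_extend_compose)
  also have "\<dots> = frag_extend frag_of z"
  proof (rule frag_extend_eq)
    fix x assume "x \<in> Poly_Mapping.keys z"
    then have "x \<in> f ` S" using assms by blast
    then show "(frag_of \<circ> f \<circ> inv_into S f) x = frag_of x" by (simp add: f_inv_into_f)
  qed
  finally show "frag_map f (frag_map (inv_into S f) z) = z" by (simp flip: frag_expansion)
qed

lemma frag_map_inj:
  assumes "inj_on f S" "Poly_Mapping.keys c \<subseteq> S" "frag_map f c = 0"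
  shows "c = 0"
proof -
  have "frag_map (inv_into S f) (frag_map f c) = frag_extend (frag_of \<circ> inv_into S f \<circ> f) c"
    by (rule frag_extend_compose)
  also have "\<dots> = frag_extend frag_of c"
    by (rule frag_extend_eq) (use assms in \<open>auto simp: subset_iff\<close>)
  finally show ?thesis using assms(3) by (simp flip: frag_expansion)
qed

text \<open>\<open>sub\<close> asks for inclusion on the nose, not up to scalars: simplices are
  tuples of basis elements, and \<kappa> has to carry them to simplices of R.\<close>

locale corner_basis = corner Q I W
  for Q :: "('v, 'a) pre_digraph" and I :: "(('v, 'a) path \<Rightarrow>\<^sub>0 'k::field) set" and W +
  fixes B BR
  assumes basis_C: "semi_normed_basis (Q \<restriction> W) (restrict_ideal (Q \<restriction> W) I) B"
    and basis_R: "semi_normed_basis Q I BR" and sub: "coset_incl Q I ` B \<subseteq> BR"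
begin

sublocale CB: semi_normed_algebra "Q \<restriction> W" J B
  by unfold_locales (rule basis_C)

sublocale RB: semi_normed_algebra Q I BR
  by unfold_locales (rule basis_R)

lemma B_A: "B \<subseteq> A"
  using CB.basis_closed by blast

lemma iota_B: "\<sigma> \<in> B \<Longrightarrow> \<kappa> \<sigma> \<in> BR"
  using sub by blast

lemma iota_src_tgt:
  assumes "\<sigma> \<in> B" shows "RB.sr (\<kappa> \<sigma>) = CB.sr \<sigma>" "RB.tg (\<kappa> \<sigma>) = CB.tg \<sigma>" "CB.sr \<sigma> \<in> W" "CB.tg \<sigma> \<in> W"
proof -
  show v: "CB.sr \<sigma> \<in> W" "CB.tg \<sigma> \<in> W" using CB.src_tgt(1,2)[OF assms] by simp_all
  then have v': "CB.sr \<sigma> \<in> verts Q" "CB.tg \<sigma> \<in> verts Q" using W by auto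
  have "\<sigma> \<in> A" using assms B_A by blast
  then have "\<kappa> \<sigma> \<in> hs (CB.sr \<sigma>) (CB.tg \<sigma>)"
    using iota_hs_iff[OF _ v] CB.src_tgt(3)[OF assms] by blast
  from RB.src_tgt_eq[OF v' this RB.basis_nonzero[OF iota_B[OF assms]]]
  show "RB.sr (\<kappa> \<sigma>) = CB.sr \<sigma>" "RB.tg (\<kappa> \<sigma>) = CB.tg \<sigma>" by blast+
qed

text \<open>R has stationary idempotents outside \<open>W\<close> too, but the source of \<kappa>
  \<sigma> lies in \<open>W\<close>, so only those at vertices of \<open>W\<close> can be
  met.\<close>

lemma iota_nonidem:
  assumes "\<sigma> \<in> B" shows "\<kappa> \<sigma> \<in> RB.nonidem \<longleftrightarrow> \<sigma> \<in> CB.nonidem"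
proof -
  have "\<sigma> \<in> A" using assms B_A by blast
  have "\<kappa> \<sigma> = \<epsilon> x \<Longrightarrow> x \<in> W" if x: "x \<in> verts Q" for x
    using RB.src_tgt_eq(1)[OF x x hs_idem[OF x] idem_nonzero[OF x]] iota_src_tgt[OF assms] by metis
  then have "\<kappa> \<sigma> \<in> \<epsilon> ` verts Q \<longleftrightarrow> (\<exists>x\<in>W. \<kappa> \<sigma> = \<epsilon> x)"
    using W by blast
  also have "\<dots> \<longleftrightarrow> (\<exists>x\<in>W. \<sigma> = C.idem x)"
    using iota_eq_iff[OF \<open>\<sigma> \<in> A\<close> C_idem_closed] iota_idem by simp
  finally show ?thesis
    using assms iota_B[OF assms] by (auto simp: RB.nonidem_def CB.nonidem_def)
qed

text \<open>The empty list has to be excluded: \<kappa> takes the identity of the corner to the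
  idempotent of \<open>W\<close>, which can differ from the identity of R.\<close>

lemma iota_prodl:
  assumes "set xs \<subseteq> A" "xs \<noteq> []" shows "RB.prodl (map \<kappa> xs) = \<kappa> (CB.prodl xs)"
  using assms(2,1)
proof (induction xs rule: list_nonempty_induct)
  case (single x)
  then show ?case using iota_closed[of x] by simp
next
  case (cons x xs)
  then show ?case using CB.prodl_closed[of xs] by (simp add: iota_mult)
qed

lemma iota_chainl:
  assumes "set xs \<subseteq> B" "xs \<noteq> []" shows "RB.chainl (map \<kappa> xs) \<longleftrightarrow> CB.chainl xs"
proof -
  have A: "set xs \<subseteq> A" using assms B_A by blast
  have "set (map \<kappa> xs) \<subseteq> RB.nonidem \<longleftrightarrow> set xs \<subseteq> CB.nonidem"
    using assms(1) iota_nonidem by auto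
  moreover have "RB.prodl (map \<kappa> xs) = \<o> \<longleftrightarrow> CB.prodl xs = C.lzero"
    unfolding iota_prodl[OF A assms(2)] by (rule iota_zero_iff[OF CB.prodl_closed[OF A]])
  ultimately show ?thesis by (simp add: RB.chainl_def CB.chainl_def)
qed

lemma iota_bp:
  assumes "\<sigma> \<in> B" "\<tau> \<in> B" "C.lmult \<sigma> \<tau> \<noteq> C.lzero"
  shows "RB.bp (\<kappa> \<sigma>) (\<kappa> \<tau>) = \<kappa> (CB.bp \<sigma> \<tau>)"
proof -
  obtain c where c: "CB.bp \<sigma> \<tau> \<in> B" "c \<noteq> 0" "C.lmult \<sigma> \<tau> = C.smult c (CB.bp \<sigma> \<tau>)"
    using CB.bp[OF assms] .
  have "\<sigma> \<in> A" "\<tau> \<in> A" "CB.bp \<sigma> \<tau> \<in> A" using assms c B_A by auto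
  then have "\<kappa> \<sigma> \<odot> \<kappa> \<tau> = c \<bullet> \<kappa> (CB.bp \<sigma> \<tau>)"
    using c(3) iota_mult iota_smult by metis
  then show ?thesis by (rule RB.bp_eq[OF iota_B[OF c(1)] c(2)])
qed

definition phi where "phi = map_sum id (map \<kappa>)"

text \<open>Membership in the image of \<open>phi\<close>, read off entry by entry. Unions and
  intersections of images turn into questions about vertices and entries.\<close>

definition supported where
  "supported s = (case s of Inl x \<Rightarrow> x \<in> W | Inr xs \<Rightarrow> set xs \<subseteq> \<kappa> ` B)"

lemma phi_simps [simp]: "phi (Inl x) = Inl x" "phi (Inr xs) = Inr (map \<kappa> xs)"
  by (simp_all add: phi_def)

lemma inj_phi: "inj_on phi (CB.S n)"
proof (rule inj_onI)
  fix s t assume s: "s \<in> CB.S n" and t: "t \<in> CB.S n" and eq: "phi s = phi t"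
  have sub: "set xs \<subseteq> A" if "Inr xs \<in> CB.S n" for xs
    using that B_A by (auto simp: sc_simplices_def split: if_splits)
  show "s = t"
  proof (cases s; cases t)
    fix xs ys assume st: "s = Inr xs" "t = Inr ys"
    then have "inj_on \<kappa> (set xs \<union> set ys)" using sub s t iota_inj by (meson Un_least inj_on_subset)
    moreover have "map \<kappa> xs = map \<kappa> ys" using eq st by simp
    ultimately show ?thesis using map_inj_on st by blast
  qed (use eq in simp_all)
qed

text \<open>A tuple of R with entries in the image of \<open>B\<close> lifts entrywise; being
  nonstationary and having nonzero product are both reflected by \<kappa>.\<close>

lemma phi_S: "phi ` CB.S n = {s \<in> RB.S n. supported s}"
proof -
  consider "n = 0" | "n = Suc 0" | m where "n = Suc (Suc m)" by (metis not0_implies_Suc)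
  then show ?thesis
  proof cases
    case 1
    then show ?thesis using W by (auto simp: CB.S_0 RB.S_0 supported_def image_image)
  next
    case 2
    have "phi ` CB.S n = {Inr [\<kappa> \<sigma>] | \<sigma>. \<sigma> \<in> B}"
      by (force simp: 2 CB.S_1)
    then show ?thesis using sub by (auto simp: 2 RB.S_1 supported_def)
  next
    case 3
    have "phi ` CB.S n = {Inr (map \<kappa> xs) | xs. length xs = n \<and> CB.chainl xs}"
      by (force simp: 3 CB.S_2)
    also have "\<dots> = {Inr ys | ys. length ys = n \<and> RB.chainl ys \<and> set ys \<subseteq> \<kappa> ` B}"
    proof (intro Collect_cong iffI)
      fix s :: "('v, 'a, 'k) simplex"
      assume "\<exists>xs. s = Inr (map \<kappa> xs) \<and> length xs = n \<and> CB.chainl xs"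
      then obtain xs where xs: "s = Inr (map \<kappa> xs)" "length xs = n" "CB.chainl xs" by blast
      have sB: "set xs \<subseteq> B" using xs(3) CB.nonidem_closed(2) by (auto simp: CB.chainl_def)
      have "xs \<noteq> []" using xs 3 by auto
      then show "\<exists>ys. s = Inr ys \<and> length ys = n \<and> RB.chainl ys \<and> set ys \<subseteq> \<kappa> ` B"
        using xs sB iota_chainl[OF sB] by (intro exI[of _ "map \<kappa> xs"]) auto
    next
      fix s :: "('v, 'a, 'k) simplex"
      assume "\<exists>ys. s = Inr ys \<and> length ys = n \<and> RB.chainl ys \<and> set ys \<subseteq> \<kappa> ` B"
      then obtain ys where ys: "s = Inr ys" "length ys = n" "RB.chainl ys" "set ys \<subseteq> \<kappa> ` B" by blast
      then have "ys \<in> lists (\<kappa> ` B)" by auto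
      then obtain xs where xs: "xs \<in> lists B" "ys = map \<kappa> xs" unfolding lists_image by blast
      then have "set xs \<subseteq> B" "xs \<noteq> []" using ys 3 by auto
      then show "\<exists>xs. s = Inr (map \<kappa> xs) \<and> length xs = n \<and> CB.chainl xs"
        using ys xs iota_chainl by (intro exI[of _ xs]) simp
    qed
    also have "\<dots> = {s \<in> RB.S n. supported s}"
      by (auto simp: 3 RB.S_2 supported_def)
    finally show ?thesis .
  qed
qed

lemma phi_in_S: "s \<in> CB.S n \<Longrightarrow> phi s \<in> RB.S n"
  using phi_S by blast

lemma phi_sface:
  assumes s: "s \<in> CB.S (Suc n)" and j: "j \<le> Suc n"
  shows "RB.sface j (phi s) = phi (CB.sface j s)"
proof (cases n)
  case 0
  then obtain \<sigma> where "s = Inr [\<sigma>]" "\<sigma> \<in> B" using s by (auto simp: CB.S_1)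
  then show ?thesis using iota_src_tgt by (simp add: CB.sface_def RB.sface_def)
next
  case (Suc m)
  then obtain xs where xs: "s = Inr xs" "length xs = Suc (Suc m)" "CB.chainl xs"
    using s by (auto simp: CB.S_2)
  have "RB.mface j (map \<kappa> xs) = map \<kappa> (CB.mface j xs)"
  proof (rule nth_equalityI)
    fix k assume "k < length (RB.mface j (map \<kappa> xs))"
    then have k: "Suc k < length xs" by simp
    have "xs = take k xs @ [xs ! k, xs ! Suc k] @ drop (Suc (Suc k)) xs"
      using k by (simp add: Cons_nth_drop_Suc)
    then have "CB.chainl [xs ! k, xs ! Suc k]" using CB.chainl_append xs(3) by metis
    then have ch: "set [xs ! k, xs ! Suc k] \<subseteq> CB.nonidem" "CB.prodl [xs ! k, xs ! Suc k] \<noteq> C.lzero"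
      unfolding CB.chainl_def by blast+
    then have B: "xs ! k \<in> B" "xs ! Suc k \<in> B" using CB.nonidem_closed(2) by auto
    then have "xs ! k \<in> A" "xs ! Suc k \<in> A" using B_A by auto
    then have "C.lmult (xs ! k) (xs ! Suc k) \<noteq> C.lzero" using ch(2) by simp
    from iota_bp[OF B this]
    show "RB.mface j (map \<kappa> xs) ! k = map \<kappa> (CB.mface j xs) ! k"
      using k by (auto simp: RB.nth_mface CB.nth_mface)
  qed simp
  then show ?thesis using xs by (simp add: CB.sface_def RB.sface_def)
qed

lemma phi_boundary_simplex:
  assumes s: "s \<in> CB.S n"
  shows "frag_map phi (sc_boundary_simplex (Q \<restriction> W) J B s) = sc_boundary_simplex Q I BR (phi s)"
proof (cases n)
  case 0
  then show ?thesis using s by (auto simp: CB.S_0 sc_boundary_simplex_def)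
next
  case (Suc m)
  have s': "s \<in> CB.S (Suc m)" "phi s \<in> RB.S (Suc m)" using s phi_in_S Suc by auto
  have "frag_map phi (sc_boundary_simplex (Q \<restriction> W) J B s) =
      (\<Sum>j\<le>Suc m. frag_cmul ((- 1) ^ j) (frag_of (phi (CB.sface j s))))"
    unfolding CB.boundary_simplex[OF s'(1)]
    by (simp add: frag_extend_sum frag_extend_cmul del: sum.atMost_Suc)
  also have "\<dots> = sc_boundary_simplex Q I BR (phi s)"
    unfolding RB.boundary_simplex[OF s'(2)] using phi_sface[OF s'(1)] by (intro sum.cong) simp_all
  finally show ?thesis .
qed

lemma phi_boundary:
  assumes "Poly_Mapping.keys c \<subseteq> CB.S n"
  shows "frag_map phi (sc_boundary (Q \<restriction> W) J B c) = sc_boundary Q I BR (frag_map phi c)"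
  using assms
  by (induction c rule: frag_induction)
    (simp_all add: sc_boundary_def phi_boundary_simplex[unfolded comp_def] frag_extend_diff)

end

section \<open>Gluing semi-normed bases\<close>

context bound_path_algebra
begin

text \<open>Flanking the zero product by the stationary idempotent of a common vertex would make
  that idempotent zero. Orthogonality thus becomes disjointness of vertex sets.\<close>

lemma idem_sum_disjoint:
  assumes "U \<subseteq> verts Q" "U' \<subseteq> verts Q" "idem_sum Q I U \<odot> idem_sum Q I U' = \<o>"
  shows "U \<inter> U' = {}"
proof (rule ccontr)
  assume "U \<inter> U' \<noteq> {}"
  then obtain x where x: "x \<in> U" "x \<in> U'" by blast
  then have V: "x \<in> verts Q" using assms by blast
  have "\<epsilon> x = (\<epsilon> x \<odot> idem_sum Q I U) \<odot> (idem_sum Q I U' \<odot> \<epsilon> x)"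
    using x V assms(1,2) by (simp add: idem_sum_mult idem_mult)
  also have "\<dots> = \<epsilon> x \<odot> (idem_sum Q I U \<odot> idem_sum Q I U') \<odot> \<epsilon> x"
    using V assms(1,2) by (simp add: L.m_assoc)
  also have "\<dots> = \<o>" using V assms(3) by simp
  finally show False using idem_nonzero[OF V] by blast
qed

lemma idem_sum_eq_one:
  assumes "U \<subseteq> verts Q" "\<one>\<^bsub>bq_algebra Q I\<^esub> = idem_sum Q I U" shows "verts Q \<subseteq> U"
proof
  fix x assume x: "x \<in> verts Q"
  have "\<epsilon> x = \<epsilon> x \<odot> idem_sum Q I U" using x by (simp flip: assms(2))
  then show "x \<in> U" using idem_sum_mult(2)[OF assms(1) x] idem_nonzero[OF x] by metis
qed

lemma peirce_zero_hs:
  assumes "U \<subseteq> verts Q" "U' \<subseteq> verts Q"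
    "peirce (bq_algebra Q I) (idem_sum Q I U) (idem_sum Q I U') = {\<o>}" "x \<in> U" "y \<in> U'"
  shows "hs x y = {\<o>}"
proof -
  have V: "x \<in> verts Q" "y \<in> verts Q" using assms by auto
  have "X = \<o>" if "X \<in> hs x y" for X
    using peirce_iff[OF assms(1,2) V that] assms(3-5) by blast
  then show ?thesis using hs_zero[OF V] by blast
qed

end

text \<open>The hypotheses of the theorem in terms of vertices and hom-spaces. \<open>span\<close>
  concerns \<open>V\<close> only, where the two bases overlap; the roles of \<open>V1\<close> and
  \<open>V2\<close> can be exchanged (\<open>swap\<close>).\<close>

locale gluing = bound_path_algebra Q I
  for Q :: "('v, 'a) pre_digraph" and I :: "(('v, 'a) path \<Rightarrow>\<^sub>0 'k::field) set" +
  fixes V V1 V2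
  assumes disjoint: "V \<inter> V1 = {}" "V \<inter> V2 = {}" "V1 \<inter> V2 = {}" and cover: "verts Q = V1 \<union> V \<union> V2"
    and vanish: "\<And>x y. x \<in> V1 \<Longrightarrow> y \<in> V2 \<Longrightarrow> hom_space Q I x y = {\<zero>\<^bsub>bq_algebra Q I\<^esub>}"
      "\<And>x y. x \<in> V2 \<Longrightarrow> y \<in> V1 \<Longrightarrow> hom_space Q I x y = {\<zero>\<^bsub>bq_algebra Q I\<^esub>}"
    and span: "\<And>x y. x \<in> V \<Longrightarrow> y \<in> V \<Longrightarrow>
      hom_space Q I x y \<subseteq> (\<lambda>f. I +>\<^bsub>path_algebra Q\<^esub> f) ` carrier (path_algebra (Q \<restriction> V))"
begin

abbreviation E where "E \<equiv> peirce (bq_algebra Q I) (idem_sum Q I V) (idem_sum Q I V)"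

lemma V_verts: "V \<subseteq> verts Q" "V1 \<union> V \<subseteq> verts Q" "V2 \<union> V \<subseteq> verts Q"
  using cover by auto

lemma swap: "gluing Q I V V2 V1"
  by unfold_locales (use disjoint cover vanish span in auto)

lemma E_iff: "x \<in> verts Q \<Longrightarrow> y \<in> verts Q \<Longrightarrow> X \<in> hs x y \<Longrightarrow> X \<noteq> \<o> \<Longrightarrow> X \<in> E \<longleftrightarrow> x \<in> V \<and> y \<in> V"
  by (rule peirce_iff[OF V_verts(1) V_verts(1)])

text \<open>By \<open>span\<close> and \<open>snb_line\<close>, \<sigma> lies on the line of a path
  inside \<open>V\<close>. That path also runs in \<open>W'\<close>, so \<open>snb_path\<close>
  finds an element of \<open>D'\<close> on the same line.\<close>

lemma line_transfer:
  assumes D: "snb W D" "snb W' D'" and W: "V \<subseteq> W" "W \<subseteq> verts Q" "V \<subseteq> W'" "W' \<subseteq> verts Q"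
    and \<sigma>: "\<sigma> \<in> D \<inter> E"
  obtains c \<tau> where "c \<noteq> 0" "\<tau> \<in> D' \<inter> E" "\<sigma> = c \<bullet> \<tau>"
proof -
  obtain x y where xy: "x \<in> W" "y \<in> W" "\<sigma> \<in> hs x y" using snb_E[OF D(1)] \<sigma> by blast
  then have v: "x \<in> verts Q" "y \<in> verts Q" using W by auto
  have nz: "\<sigma> \<noteq> \<o>" using snb_nonzero[OF D(1) W(2)] \<sigma> by blast
  have xyV: "x \<in> V" "y \<in> V" using E_iff[OF v xy(3) nz] \<sigma> by auto
  have "hs x y \<subseteq> cl ` carrier (path_algebra (Q \<restriction> V))" using span[OF xyV] by (simp add: cl_def)
  from snb_line[OF D(1) W(1,2) xyV this]
  obtain p c where p: "(x, p, y) \<in> paths (Q \<restriction> V)" "c \<noteq> 0" "\<sigma> = c \<bullet> pcl (x, p, y)"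
    using \<sigma> xy(3) by blast
  have "pcl (x, p, y) \<noteq> \<o>" using p(3) nz smult_zero by metis
  then obtain d b where b: "d \<noteq> 0" "b \<in> D'" "pcl (x, p, y) = d \<bullet> b"
    using snb_path[OF D(2) W(4) paths_induce_mono[OF W(3) p(1)]] by metis
  have bL: "b \<in> \<Lambda>" using snb_closed[OF D(2) W(4) b(2)] .
  have "\<sigma> = (c * d) \<bullet> b" using p(3) b(3) bL by (simp add: smult_smult)
  moreover have "b \<in> hs x y"
    using hs_smult_iff[OF v bL, of "c * d"] calculation xy(3) p(2) b(1) by simp
  then have "b \<in> E" using E_iff[OF v] snb_nonzero[OF D(2) W(4) b(2)] xyV by blast
  ultimately show thesis using that[of "c * d" b] p(2) b(1,2) by simp
qed

text \<open>\<open>D\<close> takes its part in eRe from \<open>D1\<close> and the rest from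
  \<open>D2\<close>. On each hom-space of the corner it coincides with one of the two, so the basis
  property is inherited; for products the factors are rescaled to \<open>D2\<close>, multiplied
  there and rescaled back.\<close>

lemma snb_rescale:
  assumes D1: "snb (V1 \<union> V) D1" and D2: "snb (V2 \<union> V) D2"
  defines "D \<equiv> (D1 \<inter> E) \<union> (D2 - E)"
  shows "snb (V2 \<union> V) D" "D1 \<inter> E = D \<inter> E" "\<And>\<sigma>. \<sigma> \<in> D \<Longrightarrow> \<exists>c. \<exists>\<tau>\<in>D2. c \<noteq> 0 \<and> \<sigma> = c \<bullet> \<tau>"
proof -
  note nz1 = snb_nonzero[OF D1 V_verts(2)] and nz2 = snb_nonzero[OF D2 V_verts(3)]
  note cl1 = snb_closed[OF D1 V_verts(2)] and cl2 = snb_closed[OF D2 V_verts(3)]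
  show "D1 \<inter> E = D \<inter> E" by (auto simp: D_def)
  show to: "\<exists>c. \<exists>\<tau>\<in>D2. c \<noteq> 0 \<and> \<sigma> = c \<bullet> \<tau>" if \<sigma>: "\<sigma> \<in> D" for \<sigma>
  proof (cases "\<sigma> \<in> E")
    case True
    then have "\<sigma> \<in> D1 \<inter> E" using \<sigma> by (auto simp: D_def)
    from line_transfer[OF D1 D2 _ V_verts(2) _ V_verts(3) this] show ?thesis by blast
  next
    case False
    then have "\<sigma> \<in> D2" using \<sigma> by (auto simp: D_def)
    then show ?thesis using cl2[of \<sigma>] by (intro exI[of _ 1] bexI[of _ \<sigma>]) simp_all
  qed
  have from2: "\<exists>c. \<exists>\<tau>\<in>D. c \<noteq> 0 \<and> \<sigma> = c \<bullet> \<tau>" if \<sigma>: "\<sigma> \<in> D2" for \<sigma>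
  proof (cases "\<sigma> \<in> E")
    case True
    then have "\<sigma> \<in> D2 \<inter> E" using \<sigma> by simp
    from line_transfer[OF D2 D1 _ V_verts(3) _ V_verts(2) this]
    show ?thesis unfolding D_def by blast
  next
    case False
    then show ?thesis using \<sigma> cl2[of \<sigma>] unfolding D_def by (intro exI[of _ 1] bexI[of _ \<sigma>]) simp_all
  qed
  have nzD: "\<sigma> \<noteq> \<o>" "\<sigma> \<in> \<Lambda>" if "\<sigma> \<in> D" for \<sigma>
    using that nz1 nz2 cl1 cl2 unfolding D_def by blast+
  have in_V: "D \<inter> hs x y = D1 \<inter> hs x y" if "x \<in> V" "y \<in> V" for x y
  proof -
    have "\<sigma> \<in> E" if "\<sigma> \<in> hs x y" "\<sigma> \<noteq> \<o>" for \<sigma>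
      using E_iff[OF _ _ that] \<open>x \<in> V\<close> \<open>y \<in> V\<close> V_verts by blast
    then show ?thesis using nz1 nz2 unfolding D_def by blast
  qed
  have out_V: "D \<inter> hs x y = D2 \<inter> hs x y" if "x \<in> verts Q" "y \<in> verts Q" "\<not> (x \<in> V \<and> y \<in> V)" for x y
  proof -
    have "\<sigma> \<notin> E" if "\<sigma> \<in> hs x y" "\<sigma> \<noteq> \<o>" for \<sigma>
      using E_iff[OF _ _ that] \<open>x \<in> verts Q\<close> \<open>y \<in> verts Q\<close> \<open>\<not> (x \<in> V \<and> y \<in> V)\<close> by blast
    then show ?thesis using nz1 nz2 unfolding D_def by blast
  qed
  \<comment> \<open>Serves the idempotents and arrow classes: an arrow between vertices of
    \<open>V\<close> belongs to both subquivers, so its class is in both bases without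
    rescaling.\<close>
  have mem: "X \<in> D" if X: "X \<in> hs x y" "x \<in> V2 \<union> V" "y \<in> V2 \<union> V" "X \<in> D2" "x \<in> V \<Longrightarrow> y \<in> V \<Longrightarrow> X \<in> D1" for X x y
  proof (cases "x \<in> V \<and> y \<in> V")
    case True
    then show ?thesis using in_V X by blast
  next
    case False
    have "x \<in> verts Q" "y \<in> verts Q" using X V_verts by auto
    then show ?thesis using out_V[OF _ _ False] X by blast
  qed
  show "snb (V2 \<union> V) D"
    unfolding snb_def
  proof (intro conjI ballI)
    show "D \<subseteq> (\<Union>x\<in>V2 \<union> V. \<Union>y\<in>V2 \<union> V. hs x y)"
    proof
      fix \<sigma> assume \<sigma>: "\<sigma> \<in> D"
      then obtain c \<tau> where t: "\<tau> \<in> D2" "c \<noteq> 0" "\<sigma> = c \<bullet> \<tau>" using to by blast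
      obtain x y where xy: "x \<in> V2 \<union> V" "y \<in> V2 \<union> V" "\<tau> \<in> hs x y" using snb_E[OF D2 t(1)] .
      then have "x \<in> verts Q" "y \<in> verts Q" using V_verts by auto
      then have "\<sigma> \<in> hs x y" using hs_smult xy(3) t(3) by blast
      then show "\<sigma> \<in> (\<Union>x\<in>V2 \<union> V. \<Union>y\<in>V2 \<union> V. hs x y)" using xy by blast
    qed
    show "k_basis Q I (hs x y) (D \<inter> hs x y)" if xy: "x \<in> V2 \<union> V" "y \<in> V2 \<union> V" for x y
    proof (cases "x \<in> V \<and> y \<in> V")
      case True
      then show ?thesis using snb_k_basis[OF D1, of x y] in_V[of x y] by simp
    next
      case False
      moreover have "x \<in> verts Q" "y \<in> verts Q" using xy V_verts by auto
      ultimately show ?thesis using snb_k_basis[OF D2 xy] out_V[of x y] by simp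
    qed
    show "\<epsilon> x \<in> D" if x: "x \<in> V2 \<union> V" for x
    proof (rule mem[of _ x x])
      have "x \<in> verts Q" using x V_verts by auto
      then show "\<epsilon> x \<in> hs x x" by (rule hs_idem)
    qed (use x snb_idem[OF D1] snb_idem[OF D2] in auto)
    show "arrow_class Q I a \<in> D" if a: "a \<in> arcs (Q \<restriction> (V2 \<union> V))" for a
    proof (rule mem[of _ "tail Q a" "head Q a"])
      show "arrow_class Q I a \<in> hs (tail Q a) (head Q a)" using a by (intro hs_arrow) simp
      show "arrow_class Q I a \<in> D1" if "tail Q a \<in> V" "head Q a \<in> V"
      proof -
        have "a \<in> arcs (Q \<restriction> (V1 \<union> V))" using a that by simp
        then show ?thesis by (rule snb_arrow[OF D1])
      qed
      show "arrow_class Q I a \<in> D2" using snb_arrow[OF D2 a] .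
    qed (use a in simp_all)
    show "\<sigma> \<odot> \<tau> = \<o> \<or> (\<exists>c \<rho>. c \<noteq> 0 \<and> \<rho> \<in> D \<and> \<sigma> \<odot> \<tau> = c \<bullet> \<rho>)" if st: "\<sigma> \<in> D" "\<tau> \<in> D" for \<sigma> \<tau>
    proof -
      obtain c \<sigma>' d \<tau>' where s: "\<sigma>' \<in> D2" "c \<noteq> 0" "\<sigma> = c \<bullet> \<sigma>'" and t: "\<tau>' \<in> D2" "d \<noteq> 0" "\<tau> = d \<bullet> \<tau>'"
        using to[OF st(1)] to[OF st(2)] by blast
      have L: "\<sigma>' \<in> \<Lambda>" "\<tau>' \<in> \<Lambda>" using s t cl2 by blast+
      have eq: "\<sigma> \<odot> \<tau> = (d * c) \<bullet> (\<sigma>' \<odot> \<tau>')"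
        using s(3) t(3) L by (simp add: smult_mult_left smult_mult_right smult_smult)
      show ?thesis
      proof (cases "\<sigma>' \<odot> \<tau>' = \<o>")
        case True
        then show ?thesis using eq by simp
      next
        case False
        obtain e \<rho>' where r: "e \<noteq> 0" "\<rho>' \<in> D2" "\<sigma>' \<odot> \<tau>' = e \<bullet> \<rho>'"
          using snb_product[OF D2 s(1) t(1) False] .
        obtain f \<rho> where "f \<noteq> 0" "\<rho> \<in> D" "\<rho>' = f \<bullet> \<rho>" using from2[OF r(2)] by blast
        moreover from this have "\<sigma> \<odot> \<tau> = (d * c * e * f) \<bullet> \<rho>"
          using eq r(3) nzD(2) by (simp add: smult_smult mult.assoc)
        ultimately show ?thesis using s(2) t(2) r(1) by (metis mult_eq_0_iff)
      qed
    qed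
  qed
qed

text \<open>On the last claim: a nonzero product \<sigma> \<tau> forces the meeting vertex into
  \<open>V\<close>, and by \<open>vanish\<close> the outer ends cannot be in \<open>V1\<close> and
  \<open>V2\<close>. One factor therefore has both ends in \<open>V\<close>, where the bases
  agree.\<close>

lemma snb_agree:
  assumes D1: "snb (V1 \<union> V) D1" and D2: "snb (V2 \<union> V) D2" and agree: "D1 \<inter> E = D2 \<inter> E"
  shows "\<sigma> \<in> D1 \<Longrightarrow> x \<in> V \<Longrightarrow> y \<in> V \<Longrightarrow> \<sigma> \<in> hs x y \<Longrightarrow> \<sigma> \<in> D2"
    and "D1 \<inter> D2 = D1 \<inter> E"
    and "\<sigma> \<in> D1 \<Longrightarrow> \<tau> \<in> D2 \<Longrightarrow> \<sigma> \<odot> \<tau> \<noteq> \<o> \<Longrightarrow> \<sigma> \<in> D2 \<or> \<tau> \<in> D1"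
proof -
  note nz1 = snb_nonzero[OF D1 V_verts(2)] and nz2 = snb_nonzero[OF D2 V_verts(3)]
  have in_E: "X \<in> E" if "x \<in> V" "y \<in> V" "X \<in> hs x y" "X \<noteq> \<o>" for X x y
    using E_iff[of x y X] that V_verts(1) by blast
  show *: "\<sigma> \<in> D2" if "\<sigma> \<in> D1" "x \<in> V" "y \<in> V" "\<sigma> \<in> hs x y" for \<sigma> x y
    using in_E[OF that(2-4) nz1[OF that(1)]] that(1) agree by blast
  have **: "\<sigma> \<in> D1" if "\<sigma> \<in> D2" "x \<in> V" "y \<in> V" "\<sigma> \<in> hs x y" for \<sigma> x y
    using in_E[OF that(2-4) nz2[OF that(1)]] that(1) agree by blast
  show "D1 \<inter> D2 = D1 \<inter> E"
  proof
    show "D1 \<inter> D2 \<subseteq> D1 \<inter> E"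
    proof
      fix \<sigma> assume \<sigma>: "\<sigma> \<in> D1 \<inter> D2"
      obtain x y where xy: "x \<in> V1 \<union> V" "y \<in> V1 \<union> V" "\<sigma> \<in> hs x y" using snb_E[OF D1] \<sigma> by blast
      have vs: "x \<in> verts Q" "y \<in> verts Q" using xy V_verts by auto
      then have "x \<in> V2 \<union> V" "y \<in> V2 \<union> V"
        using snb_ends[OF D2 V_verts(3) _ xy(3)] \<sigma> by blast+
      then have "x \<in> V" "y \<in> V" using xy disjoint by auto
      then show "\<sigma> \<in> D1 \<inter> E" using in_E xy(3) nz1 \<sigma> by blast
    qed
  qed (use agree in blast)
  show "\<sigma> \<in> D2 \<or> \<tau> \<in> D1" if st: "\<sigma> \<in> D1" "\<tau> \<in> D2" "\<sigma> \<odot> \<tau> \<noteq> \<o>" for \<sigma> \<tau>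
  proof -
    obtain x y where xy: "x \<in> V1 \<union> V" "y \<in> V1 \<union> V" "\<sigma> \<in> hs x y" using snb_E[OF D1 st(1)] .
    obtain u v where uv: "u \<in> V2 \<union> V" "v \<in> V2 \<union> V" "\<tau> \<in> hs u v" using snb_E[OF D2 st(2)] .
    have vs: "x \<in> verts Q" "y \<in> verts Q" "u \<in> verts Q" "v \<in> verts Q" using xy uv V_verts by auto
    have yu: "y = u" using hs_mult_zero[OF vs xy(3) uv(3)] st(3) by blast
    then have yV: "y \<in> V" using xy uv disjoint by auto
    have "\<not> (x \<in> V1 \<and> v \<in> V2)"
      using vanish(1)[of x v] hs_mult[OF vs(1,2,4) xy(3)] uv(3) yu st(3) by blast
    then have "x \<in> V \<or> v \<in> V" using xy uv by blast
    then show ?thesis using *[OF st(1) _ yV xy(3)] **[OF st(2) yV, of v] uv(3) yu by blast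
  qed
qed

text \<open>Each hom-space lies in one of the two corners or vanishes, so the linear conditions are
  checked in a single basis at a time. A nonzero mixed product has both factors in one basis by
  \<open>snb_agree\<close>.\<close>

lemma snb_union:
  assumes D1: "snb (V1 \<union> V) D1" and D2: "snb (V2 \<union> V) D2" and agree: "D1 \<inter> E = D2 \<inter> E"
  shows "snb (verts Q) (D1 \<union> D2)"
proof -
  interpret swap: gluing Q I V V2 V1 by (rule swap)
  note nz1 = snb_nonzero[OF D1 V_verts(2)] and nz2 = snb_nonzero[OF D2 V_verts(3)]
  note ends1 = snb_ends[OF D1 V_verts(2)] and ends2 = snb_ends[OF D2 V_verts(3)]
  have cases: "(x \<in> V1 \<union> V \<and> y \<in> V1 \<union> V) \<or> (x \<in> V2 \<union> V \<and> y \<in> V2 \<union> V) \<or> hs x y = {\<o>}"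
    if "x \<in> verts Q" "y \<in> verts Q" for x y
    using that vanish[of x y] cover by blast
  have to2: "\<sigma> \<in> D2" if "\<sigma> \<in> D1" "x \<in> V" "y \<in> V" "\<sigma> \<in> hs x y" for \<sigma> x y
    by (rule snb_agree(1)[OF D1 D2 agree that])
  have to1: "\<sigma> \<in> D1" if "\<sigma> \<in> D2" "x \<in> V" "y \<in> V" "\<sigma> \<in> hs x y" for \<sigma> x y
    by (rule swap.snb_agree(1)[OF D2 D1 agree[symmetric] that])
  show ?thesis
    unfolding snb_def
  proof (intro conjI ballI)
    show "D1 \<union> D2 \<subseteq> (\<Union>x\<in>verts Q. \<Union>y\<in>verts Q. hs x y)"
    proof
      fix \<sigma> assume "\<sigma> \<in> D1 \<union> D2"
      then obtain x y where "x \<in> verts Q" "y \<in> verts Q" "\<sigma> \<in> hs x y"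
        using snb_E[OF D1, of \<sigma>] snb_E[OF D2, of \<sigma>] cover by (metis UnCI UnE)
      then show "\<sigma> \<in> (\<Union>x\<in>verts Q. \<Union>y\<in>verts Q. hs x y)" by blast
    qed
    show "k_basis Q I (hs x y) ((D1 \<union> D2) \<inter> hs x y)" if xy: "x \<in> verts Q" "y \<in> verts Q" for x y
      using cases[OF xy]
    proof (elim disjE conjE)
      assume W: "x \<in> V1 \<union> V" "y \<in> V1 \<union> V"
      have "\<sigma> \<in> D1" if "\<sigma> \<in> D2" "\<sigma> \<in> hs x y" for \<sigma>
        using ends2[OF that xy] W disjoint to1[OF that(1) _ _ that(2)] by blast
      then have "(D1 \<union> D2) \<inter> hs x y = D1 \<inter> hs x y" by blast
      then show ?thesis using snb_k_basis[OF D1 W] by simp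
    next
      assume W: "x \<in> V2 \<union> V" "y \<in> V2 \<union> V"
      have "\<sigma> \<in> D2" if "\<sigma> \<in> D1" "\<sigma> \<in> hs x y" for \<sigma>
        using ends1[OF that xy] W disjoint to2[OF that(1) _ _ that(2)] by blast
      then have "(D1 \<union> D2) \<inter> hs x y = D2 \<inter> hs x y" by blast
      then show ?thesis using snb_k_basis[OF D2 W] by simp
    next
      assume z: "hs x y = {\<o>}"
      have "(D1 \<union> D2) \<inter> hs x y = {}" using z nz1 nz2 by blast
      moreover have "k_basis Q I {\<o>} {}"
        unfolding k_basis_lc by (auto intro!: ex1I[of _ 0])
      ultimately show ?thesis using z by simp
    qed
    show "\<epsilon> x \<in> D1 \<union> D2" if "x \<in> verts Q" for x
      using that cover snb_idem[OF D1] snb_idem[OF D2] by blast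
    show "arrow_class Q I a \<in> D1 \<union> D2" if a: "a \<in> arcs (Q \<restriction> verts Q)" for a
    proof -
      have aQ: "a \<in> arcs Q" "tail Q a \<in> verts Q" "head Q a \<in> verts Q" using a by auto
      \<comment> \<open>Because I has no terms of length 1, arrow classes are nonzero; hence no
        arrow joins \<open>V1\<close> to \<open>V2\<close> in either direction.\<close>
      have "hs (tail Q a) (head Q a) \<noteq> {\<o>}" using hs_arrow[OF aQ(1)] arrow_nonzero[OF aQ(1)] by blast
      then have "a \<in> arcs (Q \<restriction> (V1 \<union> V)) \<or> a \<in> arcs (Q \<restriction> (V2 \<union> V))"
        using cases[OF aQ(2,3)] aQ(1) by simp
      then show ?thesis using snb_arrow[OF D1] snb_arrow[OF D2] by blast
    qed
    show "\<sigma> \<odot> \<tau> = \<o> \<or> (\<exists>c \<rho>. c \<noteq> 0 \<and> \<rho> \<in> D1 \<union> D2 \<and> \<sigma> \<odot> \<tau> = c \<bullet> \<rho>)"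
      if st: "\<sigma> \<in> D1 \<union> D2" "\<tau> \<in> D1 \<union> D2" for \<sigma> \<tau>
    proof (cases "\<sigma> \<odot> \<tau> = \<o>")
      case False
      then have "\<sigma> \<in> D1 \<and> \<tau> \<in> D1 \<or> \<sigma> \<in> D2 \<and> \<tau> \<in> D2"
        using st snb_agree(3)[OF D1 D2 agree] swap.snb_agree(3)[OF D2 D1 agree[symmetric]] by blast
      then show ?thesis
      proof (elim disjE conjE)
        assume "\<sigma> \<in> D1" "\<tau> \<in> D1"
        from snb_product[OF D1 this False] show ?thesis by (metis UnI1)
      next
        assume "\<sigma> \<in> D2" "\<tau> \<in> D2"
        from snb_product[OF D2 this False] show ?thesis by (metis UnI2)
      qed
    qed simp
  qed
qed

text \<open>On hom-spaces inside \<open>V\<close> the intersection is all of the \<open>D1\<close>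
  part. A nonzero product of two such elements again has both ends in \<open>V\<close>, so its basis
  element is in both bases.\<close>

lemma snb_inter:
  assumes D1: "snb (V1 \<union> V) D1" and D2: "snb (V2 \<union> V) D2" and agree: "D1 \<inter> E = D2 \<inter> E"
  shows "snb V (D1 \<inter> D2)"
proof -
  note nz1 = snb_nonzero[OF D1 V_verts(2)]
  have to2: "\<sigma> \<in> D2" if "\<sigma> \<in> D1" "x \<in> V" "y \<in> V" "\<sigma> \<in> hs x y" for \<sigma> x y
    by (rule snb_agree(1)[OF D1 D2 agree that])
  have ends: "\<exists>x\<in>V. \<exists>y\<in>V. \<sigma> \<in> hs x y" if \<sigma>: "\<sigma> \<in> D1 \<inter> D2" for \<sigma>
  proof -
    obtain x y where xy: "x \<in> V1 \<union> V" "y \<in> V1 \<union> V" "\<sigma> \<in> hs x y" using snb_E[OF D1] \<sigma> by blast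
    have "\<sigma> \<in> E" using \<sigma> snb_agree(2)[OF D1 D2 agree] by blast
    moreover have "x \<in> verts Q" "y \<in> verts Q" using xy V_verts by auto
    ultimately show ?thesis using E_iff[OF _ _ xy(3)] nz1 \<sigma> xy by blast
  qed
  show ?thesis
    unfolding snb_def
  proof (intro conjI ballI)
    show "D1 \<inter> D2 \<subseteq> (\<Union>x\<in>V. \<Union>y\<in>V. hs x y)" using ends by blast
    show "k_basis Q I (hs x y) (D1 \<inter> D2 \<inter> hs x y)" if xy: "x \<in> V" "y \<in> V" for x y
    proof -
      have "D1 \<inter> D2 \<inter> hs x y = D1 \<inter> hs x y" using to2 xy by blast
      then show ?thesis using snb_k_basis[OF D1, of x y] xy by simp
    qed
    show "\<epsilon> x \<in> D1 \<inter> D2" if "x \<in> V" for x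
      using that snb_idem[OF D1] snb_idem[OF D2] by blast
    show "arrow_class Q I a \<in> D1 \<inter> D2" if "a \<in> arcs (Q \<restriction> V)" for a
    proof -
      have "a \<in> arcs (Q \<restriction> (V1 \<union> V))" "a \<in> arcs (Q \<restriction> (V2 \<union> V))" using that by auto
      then show ?thesis using snb_arrow[OF D1] snb_arrow[OF D2] by blast
    qed
    show "\<sigma> \<odot> \<tau> = \<o> \<or> (\<exists>c \<rho>. c \<noteq> 0 \<and> \<rho> \<in> D1 \<inter> D2 \<and> \<sigma> \<odot> \<tau> = c \<bullet> \<rho>)"
      if st: "\<sigma> \<in> D1 \<inter> D2" "\<tau> \<in> D1 \<inter> D2" for \<sigma> \<tau>
    proof (cases "\<sigma> \<odot> \<tau> = \<o>")
      case False
      obtain x y where xy: "x \<in> V" "y \<in> V" "\<sigma> \<in> hs x y" using ends st by blast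
      obtain u v where uv: "u \<in> V" "v \<in> V" "\<tau> \<in> hs u v" using ends st by blast
      have vs: "x \<in> verts Q" "y \<in> verts Q" "u \<in> verts Q" "v \<in> verts Q" using xy uv V_verts by auto
      have yu: "y = u" using hs_mult_zero[OF vs xy(3) uv(3)] False by blast
      obtain c \<rho> where r: "c \<noteq> 0" "\<rho> \<in> D1" "\<sigma> \<odot> \<tau> = c \<bullet> \<rho>" using snb_product[OF D1 _ _ False] st by blast
      have "c \<bullet> \<rho> \<in> hs x v" using hs_mult[OF vs(1,2,4) xy(3)] uv(3) yu r(3) by metis
      then have "\<rho> \<in> hs x v" using hs_smult_iff[OF vs(1,4) snb_closed[OF D1 V_verts(2) r(2)] r(1)] by blast
      then show ?thesis using r to2[OF r(2) xy(1) uv(2)] by blast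
    qed simp
  qed
qed

text \<open>Entries outside \<open>D2\<close> and outside \<open>D1\<close> have an end in \<open>V1\<close> and in \<open>V2\<close>, respectively; the
  product of the chain between these two ends is nonzero, against \<open>vanish\<close>.\<close>

lemma chain_split_aux:
  assumes D1: "snb (V1 \<union> V) D1" and D2: "snb (V2 \<union> V) D2" and agree: "D1 \<inter> E = D2 \<inter> E"
    and basis: "semi_normed_basis Q I (D1 \<union> D2)"
    and xs: "semi_normed_algebra.chainl Q I (D1 \<union> D2) xs"
    and ij: "i < j" "j < length xs" and nin: "xs ! i \<notin> D2" "xs ! j \<notin> D1"
  shows False
proof -
  interpret N: semi_normed_algebra Q I "D1 \<union> D2" by unfold_locales (rule basis)
  interpret swap: gluing Q I V V2 V1 by (rule swap)
  have "set xs \<subseteq> D1 \<union> D2" using xs N.nonidem_closed(2) unfolding N.chainl_def by blast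
  then have B: "xs ! k \<in> D1 \<union> D2" if "k < length xs" for k using that nth_mem by blast
  note v = N.src_tgt[OF B]
  have step: "N.tg (xs ! k) = N.sr (xs ! Suc k)" if k: "Suc k < length xs" for k
  proof -
    have "xs = take k xs @ [xs ! k, xs ! Suc k] @ drop (Suc (Suc k)) xs"
      using k by (simp add: Cons_nth_drop_Suc)
    then have "N.chainl [xs ! k, xs ! Suc k]" using N.chainl_append xs by metis
    then have "N.prodl [xs ! k, xs ! Suc k] \<noteq> \<o>" unfolding N.chainl_def by blast
    moreover have "xs ! k \<in> D1 \<union> D2" "xs ! Suc k \<in> D1 \<union> D2" using B k by auto
    ultimately show ?thesis by (intro N.tgt_eq_src) simp_all
  qed
  \<comment> \<open>The product of the entries from \<open>a\<close> to \<open>b\<close> is a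
    witness: it joins the two outer ends and divides a nonzero product.\<close>
  have nz: "\<exists>X. X \<in> hs (N.sr (xs ! a)) (N.tg (xs ! b)) \<and> X \<noteq> \<o>" if ab: "a \<le> b" "b < length xs" for a b
  proof -
    have "N.prodl (drop a (take (Suc b) xs)) \<in> hs (N.sr (xs ! a)) (N.tg (xs ! b))"
      using ab
    proof (induction "b - a" arbitrary: a)
      case 0
      then have "drop a (take (Suc b) xs) = [xs ! a]" by (simp add: take_Suc_conv_app_nth)
      then show ?case using 0 v(3)[of b] N.basis_closed[OF B[of b]] by simp
    next
      case (Suc m)
      then have a: "a < b" by simp
      then have eq: "drop a (take (Suc b) xs) = xs ! a # drop (Suc a) (take (Suc b) xs)"
        using Suc.prems by (simp add: Cons_nth_drop_Suc[symmetric])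
      have "N.prodl (drop (Suc a) (take (Suc b) xs)) \<in> hs (N.sr (xs ! Suc a)) (N.tg (xs ! b))"
        using Suc a by auto
      moreover have "xs ! a \<in> hs (N.sr (xs ! a)) (N.sr (xs ! Suc a))"
        using v(3)[of a] step[of a] a Suc.prems by simp
      moreover have "N.sr (xs ! a) \<in> verts Q" "N.sr (xs ! Suc a) \<in> verts Q" "N.tg (xs ! b) \<in> verts Q"
        using v(1,2) a Suc.prems by simp_all
      ultimately show ?case
        unfolding eq using hs_mult by simp
    qed
    moreover have "N.prodl (drop a (take (Suc b) xs)) \<noteq> \<o>"
    proof -
      have "xs = take a (take (Suc b) xs) @ drop a (take (Suc b) xs) @ drop (Suc b) xs"
        by (metis append_assoc append_take_drop_id)
      then have "N.chainl (drop a (take (Suc b) xs))" using N.chainl_append xs by metis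
      then show ?thesis unfolding N.chainl_def by blast
    qed
    ultimately show ?thesis by blast
  qed
  have no12: "\<not> (N.sr (xs ! a) \<in> V1 \<and> N.tg (xs ! b) \<in> V2)" if "a \<le> b" "b < length xs" for a b
    using nz[OF that] vanish(1) by blast
  have i: "i < length xs" using ij by simp
  have i1: "xs ! i \<in> D1" "xs ! j \<in> D2" using B[OF i] B[OF ij(2)] nin by auto
  \<comment> \<open>An element of \<open>D1\<close> with both ends in \<open>V\<close> would be in
    \<open>D2\<close> by agreement, so one end is in \<open>V1\<close>; likewise the entry at
    \<open>j\<close> has an end in \<open>V2\<close>.\<close>
  have "\<not> (N.sr (xs ! i) \<in> V \<and> N.tg (xs ! i) \<in> V)"
    using snb_agree(1)[OF D1 D2 agree i1(1)] v(3)[OF i] nin(1) by blast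
  moreover have "\<not> (N.sr (xs ! j) \<in> V \<and> N.tg (xs ! j) \<in> V)"
    using swap.snb_agree(1)[OF D2 D1 agree[symmetric] i1(2)] v(3)[OF ij(2)] nin(2) by blast
  moreover have "N.sr (xs ! i) \<in> V1 \<union> V" "N.tg (xs ! i) \<in> V1 \<union> V"
    by (rule snb_ends[OF D1 V_verts(2) i1(1) v(3)[OF i] v(1,2)[OF i]])+
  moreover have "N.sr (xs ! j) \<in> V2 \<union> V" "N.tg (xs ! j) \<in> V2 \<union> V"
    by (rule snb_ends[OF D2 V_verts(3) i1(2) v(3)[OF ij(2)] v(1,2)[OF ij(2)]])+
  ultimately have ij_out: "N.sr (xs ! i) \<in> V1 \<or> N.tg (xs ! i) \<in> V1" "N.sr (xs ! j) \<in> V2 \<or> N.tg (xs ! j) \<in> V2"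
    by blast+
  \<comment> \<open>The end in \<open>V1\<close> may be the target of entry \<open>i\<close>, and
    the one in \<open>V2\<close> the source of entry \<open>j\<close>. Then the stretch to consider
    starts at \<open>Suc i\<close> or stops at \<open>j'\<close>, the predecessor of
    \<open>j\<close>.\<close>
  obtain j' where j': "j = Suc j'" "i \<le> j'" using ij(1) by (cases j) auto
  have e1: "N.tg (xs ! i) = N.sr (xs ! Suc i)" using step[of i] ij by simp
  have e2: "N.sr (xs ! j) = N.tg (xs ! j')" using step[of j'] ij j' by simp
  show False
    using ij_out
  proof (elim disjE)
    assume "N.sr (xs ! i) \<in> V1" "N.sr (xs ! j) \<in> V2"
    then show False using no12[of i j'] e2 j' ij by simp
  next
    assume "N.sr (xs ! i) \<in> V1" "N.tg (xs ! j) \<in> V2"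
    then show False using no12[of i j] ij by simp
  next
    assume a: "N.tg (xs ! i) \<in> V1" "N.sr (xs ! j) \<in> V2"
    show False
    \<comment> \<open>For neighbouring entries the stretch in between is empty; the common vertex
      would then lie in \<open>V1\<close> and in \<open>V2\<close>.\<close>
    proof (cases "i = j'")
      case True
      then show False using a e2 disjoint by auto
    next
      case False
      then show False using a no12[of "Suc i" j'] e1 e2 j' ij by simp
    qed
  next
    assume "N.tg (xs ! i) \<in> V1" "N.tg (xs ! j) \<in> V2"
    then show False using no12[of "Suc i" j] e1 ij by simp
  qed
qed

text \<open>A counterexample has an entry outside \<open>D2\<close> and one outside
  \<open>D1\<close>. Whichever comes first, the previous lemma applies, possibly with the two sides
  exchanged.\<close>

lemma chain_split:
  assumes D1: "snb (V1 \<union> V) D1" and D2: "snb (V2 \<union> V) D2" and agree: "D1 \<inter> E = D2 \<inter> E"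
    and basis: "semi_normed_basis Q I (D1 \<union> D2)"
    and xs: "semi_normed_algebra.chainl Q I (D1 \<union> D2) xs"
  shows "set xs \<subseteq> D1 \<or> set xs \<subseteq> D2"
proof (rule ccontr)
  interpret N: semi_normed_algebra Q I "D1 \<union> D2" by unfold_locales (rule basis)
  interpret swap: gluing Q I V V2 V1 by (rule swap)
  have B: "set xs \<subseteq> D1 \<union> D2" using xs N.nonidem_closed(2) unfolding N.chainl_def by blast
  assume "\<not> ?thesis"
  then obtain i j where ij: "i < length xs" "xs ! i \<notin> D2" "j < length xs" "xs ! j \<notin> D1"
    by (metis in_set_conv_nth subsetI)
  then have "xs ! i \<in> D1" using B nth_mem by blast
  then consider "i < j" | "j < i" using ij(4) by (metis linorder_neqE_nat)
  then show False
  proof cases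
    case 1
    then show False using chain_split_aux[OF D1 D2 agree basis xs] ij by blast
  next
    case 2
    have "semi_normed_basis Q I (D2 \<union> D1)" "semi_normed_algebra.chainl Q I (D2 \<union> D1) xs"
      using basis xs by (simp_all add: Un_commute)
    then show False using swap.chain_split_aux[OF D2 D1 agree[symmetric]] 2 ij by blast
  qed
qed

end

section \<open>The long exact sequence\<close>

text \<open>For free groups the conditions of \<open>mayer_vietoris\<close> can be read off the
  generators: the union of simplices gives \<open>split\<close>, their intersection gives
  \<open>lift\<close> and \<open>meet\<close>.\<close>

lemma long_exact_sequence_simplices:
  assumes "chain_complex SC dC" "chain_complex S1 d1" "chain_complex S2 d2" "chain_complex S d"
    and inj: "\<And>n. inj_on fC (SC n)" "\<And>n. inj_on f1 (S1 n)" "\<And>n. inj_on f2 (S2 n)"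
    and bd: "\<And>n c. Poly_Mapping.keys c \<subseteq> SC n \<Longrightarrow> frag_map fC (dC c) = d (frag_map fC c)"
      "\<And>n c. Poly_Mapping.keys c \<subseteq> S1 n \<Longrightarrow> frag_map f1 (d1 c) = d (frag_map f1 c)"
      "\<And>n c. Poly_Mapping.keys c \<subseteq> S2 n \<Longrightarrow> frag_map f2 (d2 c) = d (frag_map f2 c)"
    and union: "\<And>n. S n = f1 ` S1 n \<union> f2 ` S2 n" and inter: "\<And>n. fC ` SC n = f1 ` S1 n \<inter> f2 ` S2 n"
  shows "has_long_exact_sequence (chain_complex.homology SC dC)
    (\<lambda>n. chain_complex.homology S1 d1 n \<times>\<times> chain_complex.homology S2 d2 n) (chain_complex.homology S d)"
proof -
  interpret C: chain_complex SC dC by fact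
  interpret A: chain_complex S1 d1 by fact
  interpret B: chain_complex S2 d2 by fact
  interpret R: chain_complex S d by fact
  note ch = C.chains_def A.chains_def B.chains_def R.chains_def
  interpret mayer_vietoris SC dC S1 d1 S2 d2 S d "frag_map fC" "frag_map f1" "frag_map f2"
  proof
    fix n
    show "frag_map f1 a \<in> R.chains n" if "a \<in> A.chains n" for a
      using that keys_frag_map[of a "S1 n" f1] union[of n] by (auto simp: ch)
    show "frag_map f2 b \<in> R.chains n" if "b \<in> B.chains n" for b
      using that keys_frag_map[of b "S2 n" f2] union[of n] by (auto simp: ch)
    show "frag_map fC c \<in> R.chains n" if "c \<in> C.chains n" for c
      using that keys_frag_map[of c "SC n" fC] inter[of n] union[of n] by (auto simp: ch)
    show "\<exists>a\<in>A.chains n. frag_map f1 a = frag_map fC c" if "c \<in> C.chains n" for c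
    proof -
      have "Poly_Mapping.keys (frag_map fC c) \<subseteq> f1 ` S1 n"
        using that keys_frag_map[of c "SC n" fC] inter[of n] by (auto simp: ch)
      then show ?thesis by (rule frag_map_surj) (auto simp: ch)
    qed
    show "\<exists>b\<in>B.chains n. frag_map f2 b = frag_map fC c" if "c \<in> C.chains n" for c
    proof -
      have "Poly_Mapping.keys (frag_map fC c) \<subseteq> f2 ` S2 n"
        using that keys_frag_map[of c "SC n" fC] inter[of n] by (auto simp: ch)
      then show ?thesis by (rule frag_map_surj) (auto simp: ch)
    qed
    show "\<exists>c\<in>C.chains n. frag_map fC c = frag_map f1 a"
      if "a \<in> A.chains n" "b \<in> B.chains n" "frag_map f1 a = frag_map f2 b" for a b
    proof -
      have "Poly_Mapping.keys (frag_map f1 a) \<subseteq> fC ` SC n"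
        using that keys_frag_map[of a "S1 n" f1] keys_frag_map[of b "S2 n" f2] inter[of n]
        by (auto simp: ch)
      then show ?thesis by (rule frag_map_surj) (auto simp: ch)
    qed
    show "\<exists>a\<in>A.chains n. \<exists>b\<in>B.chains n. z = frag_map f1 a - frag_map f2 b" if "z \<in> R.chains n" for z
    proof -
      have "Poly_Mapping.keys z \<subseteq> f1 ` S1 n \<union> f2 ` S2 n" using that union[of n] by (simp add: ch)
      then obtain u v where uv: "Poly_Mapping.keys u \<subseteq> f1 ` S1 n" "Poly_Mapping.keys v \<subseteq> f2 ` S2 n" "u + v = z"
        by (rule frag_split)
      obtain a where a: "Poly_Mapping.keys a \<subseteq> S1 n" "frag_map f1 a = u" using frag_map_surj[OF uv(1)] .
      obtain b where b: "Poly_Mapping.keys b \<subseteq> S2 n" "frag_map f2 b = v" using frag_map_surj[OF uv(2)] .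
      \<comment> \<open>\<open>split\<close> asks for a difference while \<open>frag_split\<close>
        returns a sum, so the second part changes sign.\<close>
      have "z = frag_map f1 a - frag_map f2 (- b)" using uv(3) a b by (simp add: frag_extend_minus)
      then show ?thesis using a b by (intro bexI[of _ a] bexI[of _ "- b"]) (simp_all add: ch)
    qed
  qed (use frag_map_inj[OF inj(1)] frag_map_inj[OF inj(2)] frag_map_inj[OF inj(3)] bd
      in \<open>auto simp: ch frag_extend_diff\<close>)
  show ?thesis by (rule long_exact_sequence)
qed

context corner
begin

lemma semi_normed_basis_closed: "semi_normed_basis (Q \<restriction> W) J B \<Longrightarrow> B \<subseteq> A"
  using C.snb_closed[OF _ order_refl] unfolding C.semi_normed_basis_snb by blast

text \<open>The way back from R to the corner: a basis between vertices of \<open>W\<close> lies in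
  the image of \<kappa>, by \<open>hs_range\<close>.\<close>

lemma snb_preimage:
  assumes "snb W D"
  shows "\<kappa> ` {\<sigma> \<in> A. \<kappa> \<sigma> \<in> D} = D" "semi_normed_basis (Q \<restriction> W) J {\<sigma> \<in> A. \<kappa> \<sigma> \<in> D}"
proof -
  have "D \<subseteq> \<kappa> ` A"
  proof
    fix \<sigma> assume "\<sigma> \<in> D"
    then obtain x y where xy: "x \<in> W" "y \<in> W" "\<sigma> \<in> hs x y" using snb_E[OF assms] by blast
    then show "\<sigma> \<in> \<kappa> ` A" using hs_range[OF xy(1,2)] by blast
  qed
  then show eq: "\<kappa> ` {\<sigma> \<in> A. \<kappa> \<sigma> \<in> D} = D" by blast
  show "semi_normed_basis (Q \<restriction> W) J {\<sigma> \<in> A. \<kappa> \<sigma> \<in> D}"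
    by (subst iota_snb) (use assms eq in auto)
qed

end

context gluing
begin

lemma long_exact_sequence_gluing:
  assumes c1: "corner_basis Q I (V1 \<union> V) B1 BR" and c2: "corner_basis Q I (V2 \<union> V) B2 BR"
    and c0: "corner_basis Q I V B0 BR"
    and BR: "BR = coset_incl Q I ` B1 \<union> coset_incl Q I ` B2"
    and B0: "coset_incl Q I ` B0 = coset_incl Q I ` B1 \<inter> coset_incl Q I ` B2"
    and agree: "coset_incl Q I ` B1 \<inter> E = coset_incl Q I ` B2 \<inter> E"
  shows "has_long_exact_sequence
    (simplicial_homology (Q \<restriction> V) (restrict_ideal (Q \<restriction> V) I) B0)
    (\<lambda>n. simplicial_homology (Q \<restriction> (V1 \<union> V)) (restrict_ideal (Q \<restriction> (V1 \<union> V)) I) B1 n \<times>\<times>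
         simplicial_homology (Q \<restriction> (V2 \<union> V)) (restrict_ideal (Q \<restriction> (V2 \<union> V)) I) B2 n)
    (simplicial_homology Q I BR)"
proof -
  interpret A1: corner_basis Q I "V1 \<union> V" B1 BR by fact
  interpret A2: corner_basis Q I "V2 \<union> V" B2 BR by fact
  interpret A0: corner_basis Q I V B0 BR by fact
  let ?D1 = "coset_incl Q I ` B1" and ?D2 = "coset_incl Q I ` B2"
  have D1: "snb (V1 \<union> V) ?D1" using A1.iota_snb[OF A1.B_A] A1.basis_C by blast
  have D2: "snb (V2 \<union> V) ?D2" using A2.iota_snb[OF A2.B_A] A2.basis_C by blast
  \<comment> \<open>Degree 0 is the cover of the vertices and degree 1 the definition of
    \<open>BR\<close>; only tuples of two or more entries require
    \<open>chain_split\<close>.\<close>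
  have supp: "A1.supported s \<or> A2.supported s" if s: "s \<in> A1.RB.S n" for s n
  proof -
    consider "n = 0" | "n = Suc 0" | m where "n = Suc (Suc m)" by (metis not0_implies_Suc)
    then show ?thesis
    proof cases
      case 1
      then show ?thesis using s cover by (auto simp: A1.RB.S_0 A1.supported_def A2.supported_def)
    next
      case 2
      then obtain \<sigma> where "s = Inr [\<sigma>]" "\<sigma> \<in> BR" using s by (auto simp: A1.RB.S_1)
      then show ?thesis using BR by (auto simp: A1.supported_def A2.supported_def)
    next
      case 3
      then obtain xs where xs: "s = Inr xs" "A1.RB.chainl xs" using s by (auto simp: A1.RB.S_2)
      have "set xs \<subseteq> ?D1 \<or> set xs \<subseteq> ?D2"
        by (rule chain_split[OF D1 D2 agree]) (use A0.basis_R xs(2) BR in simp_all)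
      then show ?thesis by (simp add: xs(1) A1.supported_def A2.supported_def)
    qed
  qed
  have "V = (V1 \<union> V) \<inter> (V2 \<union> V)" using disjoint by blast
  then have inter: "A0.supported s \<longleftrightarrow> A1.supported s \<and> A2.supported s" for s
    using B0 by (auto simp: A0.supported_def A1.supported_def A2.supported_def split: sum.splits)
  show ?thesis
    unfolding A0.CB.simplicial_homology_eq A1.CB.simplicial_homology_eq A2.CB.simplicial_homology_eq
      A1.RB.simplicial_homology_eq
  proof (rule long_exact_sequence_simplices)
    show "A1.RB.S n = A1.phi ` A1.CB.S n \<union> A2.phi ` A2.CB.S n" for n
      unfolding A1.phi_S A2.phi_S using supp by blast
    show "A0.phi ` A0.CB.S n = A1.phi ` A1.CB.S n \<inter> A2.phi ` A2.CB.S n" for n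
      unfolding A0.phi_S A1.phi_S A2.phi_S using inter by blast
  qed (rule A0.CB.chain_complex_basis A1.CB.chain_complex_basis A2.CB.chain_complex_basis
      A1.RB.chain_complex_basis A0.inj_phi A1.inj_phi A2.inj_phi
      A0.phi_boundary A1.phi_boundary A2.phi_boundary, assumption?)+
qed

end

text \<open>The first half shows that the agreement demanded in the second can always be reached by
  rescaling the second basis. \<open>B\<^sub>C\<close> consists of cosets of
  \<open>I\<^sub>C\<close>, so the intersection is taken inside R and pulled back along
  \<open>\<iota>\<close>.\<close>

theorem proposition4p1:
  fixes Q :: "('v, 'a) pre_digraph"
    and I :: "(('v, 'a) path \<Rightarrow>\<^sub>0 'k::field) set"
    and V V\<^sub>1' V\<^sub>2' :: "'v set"
  defines "R \<equiv> bq_algebra Q I"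
    and "e \<equiv> idem_sum Q I V"
    and "e\<^sub>1' \<equiv> idem_sum Q I V\<^sub>1'"
    and "e\<^sub>2' \<equiv> idem_sum Q I V\<^sub>2'"
    and "e\<^sub>1 \<equiv> idem_sum Q I V\<^sub>1' \<oplus>\<^bsub>bq_algebra Q I\<^esub> idem_sum Q I V"
    and "e\<^sub>2 \<equiv> idem_sum Q I V\<^sub>2' \<oplus>\<^bsub>bq_algebra Q I\<^esub> idem_sum Q I V"
    and "Q\<^sub>1 \<equiv> Q \<restriction> (V\<^sub>1' \<union> V)"
    and "Q\<^sub>2 \<equiv> Q \<restriction> (V\<^sub>2' \<union> V)"
    and "Q\<^sub>C \<equiv> Q \<restriction> V"
    and "I\<^sub>1 \<equiv> restrict_ideal (Q \<restriction> (V\<^sub>1' \<union> V)) I"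
    and "I\<^sub>2 \<equiv> restrict_ideal (Q \<restriction> (V\<^sub>2' \<union> V)) I"
    and "I\<^sub>C \<equiv> restrict_ideal (Q \<restriction> V) I"
    and "\<iota> \<equiv> coset_incl Q I"
  assumes bound: "bound_quiver Q I"
    and vertices: "V \<subseteq> verts Q" "V\<^sub>1' \<subseteq> verts Q" "V\<^sub>2' \<subseteq> verts Q"
    and orthogonal:
      "e \<otimes>\<^bsub>R\<^esub> e\<^sub>1' = \<zero>\<^bsub>R\<^esub>" "e\<^sub>1' \<otimes>\<^bsub>R\<^esub> e = \<zero>\<^bsub>R\<^esub>"
      "e \<otimes>\<^bsub>R\<^esub> e\<^sub>2' = \<zero>\<^bsub>R\<^esub>" "e\<^sub>2' \<otimes>\<^bsub>R\<^esub> e = \<zero>\<^bsub>R\<^esub>"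
      "e\<^sub>1' \<otimes>\<^bsub>R\<^esub> e\<^sub>2' = \<zero>\<^bsub>R\<^esub>" "e\<^sub>2' \<otimes>\<^bsub>R\<^esub> e\<^sub>1' = \<zero>\<^bsub>R\<^esub>"
    and one_decomp: "\<one>\<^bsub>R\<^esub> = e\<^sub>1' \<oplus>\<^bsub>R\<^esub> e \<oplus>\<^bsub>R\<^esub> e\<^sub>2'"
    and vanishing: "peirce R e\<^sub>1' e\<^sub>2' = {\<zero>\<^bsub>R\<^esub>}" "peirce R e\<^sub>2' e\<^sub>1' = {\<zero>\<^bsub>R\<^esub>}"
    and A1: "\<iota> ` carrier (bq_algebra Q\<^sub>1 I\<^sub>1) = peirce R e\<^sub>1 e\<^sub>1"
    and A2: "\<iota> ` carrier (bq_algebra Q\<^sub>2 I\<^sub>2) = peirce R e\<^sub>2 e\<^sub>2"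
    and C: "\<iota> ` carrier (bq_algebra Q\<^sub>C I\<^sub>C) = peirce R e e"
    and bases: "\<exists>B. semi_normed_basis Q\<^sub>1 I\<^sub>1 B" "\<exists>B. semi_normed_basis Q\<^sub>2 I\<^sub>2 B"
  shows
    "(\<forall>B\<^sub>1 B\<^sub>2. semi_normed_basis Q\<^sub>1 I\<^sub>1 B\<^sub>1 \<and> semi_normed_basis Q\<^sub>2 I\<^sub>2 B\<^sub>2 \<longrightarrow>
        (\<exists>B\<^sub>2'. semi_normed_basis Q\<^sub>2 I\<^sub>2 B\<^sub>2' \<and>
           (\<forall>\<sigma>\<in>B\<^sub>2'. \<exists>c. \<exists>\<tau>\<in>B\<^sub>2. c \<noteq> 0 \<and> \<sigma> = coset_smult Q\<^sub>2 I\<^sub>2 c \<tau>) \<and>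
           \<iota> ` B\<^sub>1 \<inter> peirce R e e = \<iota> ` B\<^sub>2' \<inter> peirce R e e)) \<and>
     (\<forall>B\<^sub>1 B\<^sub>2. semi_normed_basis Q\<^sub>1 I\<^sub>1 B\<^sub>1 \<and> semi_normed_basis Q\<^sub>2 I\<^sub>2 B\<^sub>2 \<and>
        \<iota> ` B\<^sub>1 \<inter> peirce R e e = \<iota> ` B\<^sub>2 \<inter> peirce R e e \<longrightarrow>
        (let B\<^sub>R = \<iota> ` B\<^sub>1 \<union> \<iota> ` B\<^sub>2;
             B\<^sub>C = {\<sigma> \<in> carrier (bq_algebra Q\<^sub>C I\<^sub>C). \<iota> \<sigma> \<in> \<iota> ` B\<^sub>1 \<inter> \<iota> ` B\<^sub>2}
         in semi_normed_basis Q I B\<^sub>R \<and> semi_normed_basis Q\<^sub>C I\<^sub>C B\<^sub>C \<and>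
            has_long_exact_sequence
              (simplicial_homology Q\<^sub>C I\<^sub>C B\<^sub>C)
              (\<lambda>n. simplicial_homology Q\<^sub>1 I\<^sub>1 B\<^sub>1 n \<times>\<times> simplicial_homology Q\<^sub>2 I\<^sub>2 B\<^sub>2 n)
              (simplicial_homology Q I B\<^sub>R)))"
proof -
  interpret P: bound_path_algebra Q I by (rule bound_quiver_bound_path_algebra[OF bound])
  note defs = R_def e_def e\<^sub>1'_def e\<^sub>2'_def e\<^sub>1_def e\<^sub>2_def Q\<^sub>1_def Q\<^sub>2_def Q\<^sub>C_def
    I\<^sub>1_def I\<^sub>2_def I\<^sub>C_def \<iota>_def
  have disj: "V \<inter> V\<^sub>1' = {}" "V \<inter> V\<^sub>2' = {}" "V\<^sub>1' \<inter> V\<^sub>2' = {}"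
    using P.idem_sum_disjoint[OF vertices(1,2)] P.idem_sum_disjoint[OF vertices(1,3)]
      P.idem_sum_disjoint[OF vertices(2,3)] orthogonal(1,3,5) unfolding defs by simp_all
  have sub: "V\<^sub>1' \<union> V \<subseteq> verts Q" "V\<^sub>2' \<union> V \<subseteq> verts Q" using vertices by auto
  have e1: "e\<^sub>1 = idem_sum Q I (V\<^sub>1' \<union> V)" and e2: "e\<^sub>2 = idem_sum Q I (V\<^sub>2' \<union> V)"
    using P.idem_sum_union vertices disj unfolding defs by (simp_all add: Int_commute)
  \<comment> \<open>Adding idempotents of disjoint vertex sets amounts to taking unions, so the
    decomposition of the identity becomes a cover of the vertices.\<close>
  have "\<one>\<^bsub>bq_algebra Q I\<^esub> = idem_sum Q I (V\<^sub>1' \<union> V \<union> V\<^sub>2')"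
    using one_decomp e1 P.idem_sum_union[OF sub(1) vertices(3)] disj unfolding defs
    by (simp add: Int_Un_distrib2)
  then have cover: "verts Q = V\<^sub>1' \<union> V \<union> V\<^sub>2'"
    using P.idem_sum_eq_one[of "V\<^sub>1' \<union> V \<union> V\<^sub>2'"] vertices by blast
  interpret A1: corner Q I "V\<^sub>1' \<union> V"
    by unfold_locales (use sub A1 e1 in \<open>simp_all add: defs\<close>)
  interpret A2: corner Q I "V\<^sub>2' \<union> V"
    by unfold_locales (use sub A2 e2 in \<open>simp_all add: defs\<close>)
  interpret A0: corner Q I V
    by unfold_locales (use vertices C in \<open>simp_all add: defs\<close>)
  interpret gluing Q I V "V\<^sub>1'" "V\<^sub>2'"
  proof
    show "P.hs x y = {P.lzero}" if "x \<in> V\<^sub>1'" "y \<in> V\<^sub>2'" for x y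
      by (rule P.peirce_zero_hs[OF vertices(2,3) _ that]) (use vanishing(1) in \<open>simp add: defs\<close>)
    show "P.hs x y = {P.lzero}" if "x \<in> V\<^sub>2'" "y \<in> V\<^sub>1'" for x y
      by (rule P.peirce_zero_hs[OF vertices(3,2) _ that]) (use vanishing(2) in \<open>simp add: defs\<close>)
    show "P.hs x y \<subseteq> (+>\<^bsub>path_algebra Q\<^esub>) I ` carrier (path_algebra (Q \<restriction> V))" if "x \<in> V" "y \<in> V" for x y
      using A0.hs_span[OF that] by (simp add: P.cl_def)
  qed (use disj cover in simp_all)
  have snb1: "P.snb (V\<^sub>1' \<union> V) (\<iota> ` B)" "B \<subseteq> A1.A" if "semi_normed_basis Q\<^sub>1 I\<^sub>1 B" for B
    using that A1.semi_normed_basis_closed A1.iota_snb unfolding defs by blast+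
  have snb2: "P.snb (V\<^sub>2' \<union> V) (\<iota> ` B)" "B \<subseteq> A2.A" if "semi_normed_basis Q\<^sub>2 I\<^sub>2 B" for B
    using that A2.semi_normed_basis_closed A2.iota_snb unfolding defs by blast+
  have part1: "\<exists>B\<^sub>2'. semi_normed_basis Q\<^sub>2 I\<^sub>2 B\<^sub>2' \<and>
           (\<forall>\<sigma>\<in>B\<^sub>2'. \<exists>c. \<exists>\<tau>\<in>B\<^sub>2. c \<noteq> 0 \<and> \<sigma> = coset_smult Q\<^sub>2 I\<^sub>2 c \<tau>) \<and>
           \<iota> ` B\<^sub>1 \<inter> peirce R e e = \<iota> ` B\<^sub>2' \<inter> peirce R e e"
    if B: "semi_normed_basis Q\<^sub>1 I\<^sub>1 B\<^sub>1" "semi_normed_basis Q\<^sub>2 I\<^sub>2 B\<^sub>2" for B\<^sub>1 B\<^sub>2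
  proof -
    \<comment> \<open>The basis of \<open>snb_rescale\<close>, formed inside R; its preimage under
      \<open>\<iota>\<close> is the rescaled basis of the second corner.\<close>
    define D where "D = \<iota> ` B\<^sub>1 \<inter> E \<union> (\<iota> ` B\<^sub>2 - E)"
    note D = snb_rescale[OF snb1(1)[OF B(1)] snb2(1)[OF B(2)], folded D_def]
    define B' where "B' = {\<sigma> \<in> A2.A. \<iota> \<sigma> \<in> D}"
    have B': "\<iota> ` B' = D" "semi_normed_basis Q\<^sub>2 I\<^sub>2 B'"
      using A2.snb_preimage[OF D(1)] unfolding B'_def defs by blast+
    have "\<exists>c. \<exists>\<tau>\<in>B\<^sub>2. c \<noteq> 0 \<and> \<sigma> = coset_smult Q\<^sub>2 I\<^sub>2 c \<tau>" if \<sigma>: "\<sigma> \<in> B'" for \<sigma>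
    proof -
      have sA: "\<sigma> \<in> A2.A" "\<iota> \<sigma> \<in> D" using \<sigma> by (auto simp: B'_def)
      obtain c \<tau> where t: "\<tau> \<in> B\<^sub>2" "c \<noteq> 0" "\<iota> \<sigma> = P.smult c (\<iota> \<tau>)" using D(3)[OF sA(2)] by blast
      have tA: "\<tau> \<in> A2.A" using t(1) snb2(2)[OF B(2)] by blast
      \<comment> \<open>The proportionality is known in R; linearity and injectivity of the
        inclusion bring it back to the corner.\<close>
      have "\<iota> \<sigma> = \<iota> (A2.C.smult c \<tau>)"
        using t(3) A2.iota_smult[OF tA] unfolding \<iota>_def by simp
      then have "\<sigma> = A2.C.smult c \<tau>"
        using A2.iota_eq_iff[OF sA(1) A2.C.smult_closed[OF tA]] unfolding \<iota>_def by simp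
      then show ?thesis using t(1,2) unfolding Q\<^sub>2_def I\<^sub>2_def by blast
    qed
    moreover have "\<iota> ` B\<^sub>1 \<inter> peirce R e e = \<iota> ` B' \<inter> peirce R e e"
      using D(2) B'(1) unfolding R_def e_def by simp
    ultimately show ?thesis using B'(2) by blast
  qed
  have part2: "semi_normed_basis Q I (\<iota> ` B\<^sub>1 \<union> \<iota> ` B\<^sub>2) \<and>
      semi_normed_basis Q\<^sub>C I\<^sub>C {\<sigma> \<in> carrier (bq_algebra Q\<^sub>C I\<^sub>C). \<iota> \<sigma> \<in> \<iota> ` B\<^sub>1 \<inter> \<iota> ` B\<^sub>2} \<and>
      has_long_exact_sequence
        (simplicial_homology Q\<^sub>C I\<^sub>C {\<sigma> \<in> carrier (bq_algebra Q\<^sub>C I\<^sub>C). \<iota> \<sigma> \<in> \<iota> ` B\<^sub>1 \<inter> \<iota> ` B\<^sub>2})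
        (\<lambda>n. simplicial_homology Q\<^sub>1 I\<^sub>1 B\<^sub>1 n \<times>\<times> simplicial_homology Q\<^sub>2 I\<^sub>2 B\<^sub>2 n)
        (simplicial_homology Q I (\<iota> ` B\<^sub>1 \<union> \<iota> ` B\<^sub>2))"
    if B: "semi_normed_basis Q\<^sub>1 I\<^sub>1 B\<^sub>1" "semi_normed_basis Q\<^sub>2 I\<^sub>2 B\<^sub>2"
      and agree: "\<iota> ` B\<^sub>1 \<inter> peirce R e e = \<iota> ` B\<^sub>2 \<inter> peirce R e e" for B\<^sub>1 B\<^sub>2
  proof -
    define B\<^sub>C where "B\<^sub>C = {\<sigma> \<in> A0.A. \<iota> \<sigma> \<in> \<iota> ` B\<^sub>1 \<inter> \<iota> ` B\<^sub>2}"
    have ag: "\<iota> ` B\<^sub>1 \<inter> E = \<iota> ` B\<^sub>2 \<inter> E" using agree unfolding R_def e_def .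
    note D = snb1(1)[OF B(1)] snb2(1)[OF B(2)] ag
    have BR: "semi_normed_basis Q I (\<iota> ` B\<^sub>1 \<union> \<iota> ` B\<^sub>2)"
      using snb_union[OF D] unfolding P.semi_normed_basis_snb .
    have BC: "\<iota> ` B\<^sub>C = \<iota> ` B\<^sub>1 \<inter> \<iota> ` B\<^sub>2" "semi_normed_basis (Q \<restriction> V) (restrict_ideal (Q \<restriction> V) I) B\<^sub>C"
      using A0.snb_preimage[OF snb_inter[OF D]] unfolding B\<^sub>C_def \<iota>_def by blast+
    have c1: "corner_basis Q I (V\<^sub>1' \<union> V) B\<^sub>1 (\<iota> ` B\<^sub>1 \<union> \<iota> ` B\<^sub>2)"
      by unfold_locales (use B(1) BR in \<open>auto simp: Q\<^sub>1_def I\<^sub>1_def \<iota>_def\<close>)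
    have c2: "corner_basis Q I (V\<^sub>2' \<union> V) B\<^sub>2 (\<iota> ` B\<^sub>1 \<union> \<iota> ` B\<^sub>2)"
      by unfold_locales (use B(2) BR in \<open>auto simp: Q\<^sub>2_def I\<^sub>2_def \<iota>_def\<close>)
    have c0: "corner_basis Q I V B\<^sub>C (\<iota> ` B\<^sub>1 \<union> \<iota> ` B\<^sub>2)"
      by unfold_locales (use BC BR in \<open>auto simp: \<iota>_def\<close>)
    have "has_long_exact_sequence
        (simplicial_homology (Q \<restriction> V) (restrict_ideal (Q \<restriction> V) I) B\<^sub>C)
        (\<lambda>n. simplicial_homology Q\<^sub>1 I\<^sub>1 B\<^sub>1 n \<times>\<times> simplicial_homology Q\<^sub>2 I\<^sub>2 B\<^sub>2 n)
        (simplicial_homology Q I (\<iota> ` B\<^sub>1 \<union> \<iota> ` B\<^sub>2))"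
      using long_exact_sequence_gluing[OF c1 c2 c0] BC(1) ag
      unfolding \<iota>_def Q\<^sub>1_def I\<^sub>1_def Q\<^sub>2_def I\<^sub>2_def by blast
    with BR BC(2) show ?thesis unfolding Q\<^sub>C_def I\<^sub>C_def B\<^sub>C_def by blast
  qed
  show ?thesis
  proof (intro conjI allI impI; elim conjE)
    fix B\<^sub>1 B\<^sub>2 assume "semi_normed_basis Q\<^sub>1 I\<^sub>1 B\<^sub>1" "semi_normed_basis Q\<^sub>2 I\<^sub>2 B\<^sub>2"
    then show "\<exists>B\<^sub>2'. semi_normed_basis Q\<^sub>2 I\<^sub>2 B\<^sub>2' \<and>
           (\<forall>\<sigma>\<in>B\<^sub>2'. \<exists>c. \<exists>\<tau>\<in>B\<^sub>2. c \<noteq> 0 \<and> \<sigma> = coset_smult Q\<^sub>2 I\<^sub>2 c \<tau>) \<and>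
           \<iota> ` B\<^sub>1 \<inter> peirce R e e = \<iota> ` B\<^sub>2' \<inter> peirce R e e"
      by (rule part1)
  qed (unfold Let_def, rule part2)
qed

end
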